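(* Under the assumptions in the context, for every $\varepsilon>0$ the problem \[ M\Big(\iint_{\mathbb{R}^6}\frac{|u(x)-u(y)|^2}{|x-y|^{3+2s}}dxdy+\int_{\mathbb{R}^3}V(\varepsilon x)u^2dx\Big)\big[(-\Delta)^su+V(\varepsilon x)u\big]=g(\varepsilon x,u)\quad\text{in }\mathbb{R}^3 \] has a nonnegative ground state solution (a nonnegative nontrivial critical point of $\mathcal J_\varepsilon$).
   Context: Let $s\in(\frac34,1)$, $[u]^2=\iint_{\mathbb{R}^6}\frac{|u(x)-u(y)|^2}{|x-y|^{3+2s}}dxdy$, $H^s(\mathbb{R}^3)=\{u\in L^2(\mathbb{R}^3):[u]<\infty\}$. $M:[0,\infty)\to[0,\infty)$ continuous with $(M_1)$ $M(t)\ge m_0>0$ for all $t\ge0$; $(M_2)$ $M$ increasing; $(M_3)$ $\frac{M(t_1)}{t_1}-\frac{M(t_2)}{t_2}\le m_0(\frac1{t_1}-\frac1{t_2})$ for $t_1\ge t_2>0$; $\widehat M(t)=\int_0^tM$. $V\in C(\mathbb{R}^3,\mathbb{R})$ with $V_0:=\inf V>0$. $f:\mathbb{R}\to\mathbb{R}$ continuous, $f=0$ on $(-\infty,0)$, $F(t)=\int_0^tf$, with $(f_1)$ $f(t)/t^3\to0$ as $t\to0^+$; $(f_2)$ $f(t)/t^{q-1}\to0$ as $t\to\infty$ for some $q\in(4,\frac6{3-2s})$; $(f_3)$ $0<\vartheta F(t)\le f(t)t$ for $t>0$, some $\vartheta\in(4,\frac6{3-2s})$; $(f_4)$ $f(t)/t^3$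 nondecreasing on $(0,\infty)$. Fix a bounded Lipschitz domain $\Omega\subset\mathbb{R}^3$ with $V_0<\min_{\partial\Omega}V$ and $\{x\in\Omega:V(x)=V_0\}\ne\emptyset$. Fix $K>2/m_0$ and $a>0$ with $f(a)=\frac{V_0}{K}a$; let $\tilde f(t)=f(t)$ for $t\le a$, $\tilde f(t)=\frac{V_0}{K}t$ for $t>a$; $g(x,t)=\chi_\Omega(x)f(t)+(1-\chi_\Omega(x))\tilde f(t)$, $G(x,t)=\int_0^tg(x,\tau)d\tau$. For $\varepsilon>0$ let $\mathcal H_\varepsilon=\{u\in H^s(\mathbb{R}^3):\int V(\varepsilon x)u^2<\infty\}$ with norm $\|u\|_\varepsilon^2=[u]^2+\int_{\mathbb{R}^3}V(\varepsilon x)u^2dx$, and $\mathcal J_\varepsilon(u)=\frac12\widehat M(\|u\|_\varepsilon^2)-\int_{\mathbb{R}^3}G(\varepsilon x,u)dx$. A ground state is a nontrivial critical point of $\mathcal J_\varepsilon$ at the level $\inf_{\mathcal N_\varepsilon}\mathcal J_\varepsilon$, where $\mathcal N_\varepsilon=\{u\in\mathcal H_\varepsilon\setminus\{0\}:\langle\mathcal J_\varepsilon'(u),u\rangle=0\}$. *)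

theory Defs
  imports "HOL-Analysis.Analysis"
begin

type_synonym R3 = "real ^ 3"

definition lipschitz_domain :: "R3 set \<Rightarrow> bool" where
  "lipschitz_domain \<Omega> \<longleftrightarrow> open \<Omega> \<and> connected \<Omega> \<and> \<Omega> \<noteq> {} \<and>
     (\<forall>p \<in> frontier \<Omega>. \<exists>(T::R3 \<Rightarrow> R3) r h L (\<phi>::real \<Rightarrow> real \<Rightarrow> real).
        orthogonal_transformation T \<and> r > 0 \<and> h > 0 \<and>
        (\<forall>a b c d. \<bar>\<phi> a b - \<phi> c d\<bar> \<le> L * sqrt ((a - c)^2 + (b - d)^2)) \<and>
        (let C = {x. ((T (x - p))$1)^2 + ((T (x - p))$2)^2 < r^2 \<and> \<bar>(T (x - p))$3\<bar> < h}
         in \<Omega> \<inter> C = {x \<in> C. (T (x - p))$3 > \<phi> ((T (x - p))$1) ((T (x - p))$2)}))"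

definition gagliardo_ennreal :: "real \<Rightarrow> (R3 \<Rightarrow> real) \<Rightarrow> ennreal" where
  "gagliardo_ennreal s u =
     nn_integral (pair_measure lborel lborel)
       (\<lambda>z. ennreal ((u (fst z) - u (snd z))^2 / norm (fst z - snd z) powr (3 + 2 * s)))"

definition gagliardo :: "real \<Rightarrow> (R3 \<Rightarrow> real) \<Rightarrow> real" where
  "gagliardo s u = enn2real (gagliardo_ennreal s u)"

definition pot_ennreal :: "(R3 \<Rightarrow> real) \<Rightarrow> real \<Rightarrow> (R3 \<Rightarrow> real) \<Rightarrow> ennreal" where
  "pot_ennreal V \<epsilon> u = (\<integral>\<^sup>+ x. ennreal (V (\<epsilon> *\<^sub>R x) * (u x)^2) \<partial>lborel)"

text \<open>The space H_\<epsilon> (functions represented by Borel measurable representatives).\<close>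
definition H_eps :: "real \<Rightarrow> (R3 \<Rightarrow> real) \<Rightarrow> real \<Rightarrow> (R3 \<Rightarrow> real) set" where
  "H_eps s V \<epsilon> = {u. u \<in> borel_measurable borel \<and> integrable lborel (\<lambda>x. (u x)^2) \<and>
       gagliardo_ennreal s u < \<infinity> \<and> pot_ennreal V \<epsilon> u < \<infinity>}"

definition norm_eps_sq :: "real \<Rightarrow> (R3 \<Rightarrow> real) \<Rightarrow> real \<Rightarrow> (R3 \<Rightarrow> real) \<Rightarrow> real" where
  "norm_eps_sq s V \<epsilon> u = gagliardo s u + enn2real (pot_ennreal V \<epsilon> u)"

definition Mhat :: "(real \<Rightarrow> real) \<Rightarrow> real \<Rightarrow> real" where
  "Mhat M t = integral {0..t} M"

definition primitive :: "(real \<Rightarrow> real) \<Rightarrow> real \<Rightarrow> real" where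
  "primitive f t = integral {0..t} f"

definition f_tilde :: "(real \<Rightarrow> real) \<Rightarrow> real \<Rightarrow> real \<Rightarrow> real \<Rightarrow> real \<Rightarrow> real" where
  "f_tilde f V0 K a t = (if t \<le> a then f t else V0 / K * t)"

definition g_pen :: "R3 set \<Rightarrow> (real \<Rightarrow> real) \<Rightarrow> real \<Rightarrow> real \<Rightarrow> real \<Rightarrow> R3 \<Rightarrow> real \<Rightarrow> real" where
  "g_pen \<Omega> f V0 K a x t = (if x \<in> \<Omega> then f t else f_tilde f V0 K a t)"

definition G_pen :: "R3 set \<Rightarrow> (real \<Rightarrow> real) \<Rightarrow> real \<Rightarrow> real \<Rightarrow> real \<Rightarrow> R3 \<Rightarrow> real \<Rightarrow> real" where
  "G_pen \<Omega> f V0 K a x t = integral {0..t} (g_pen \<Omega> f V0 K a x)"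

definition J_eps :: "(real \<Rightarrow> real) \<Rightarrow> real \<Rightarrow> (R3 \<Rightarrow> real) \<Rightarrow> real \<Rightarrow> (R3 \<Rightarrow> real \<Rightarrow> real)
                     \<Rightarrow> (R3 \<Rightarrow> real) \<Rightarrow> real" where
  "J_eps M s V \<epsilon> G u = 1/2 * Mhat M (norm_eps_sq s V \<epsilon> u) - (\<integral>x. G (\<epsilon> *\<^sub>R x) (u x) \<partial>lborel)"

definition J_dir_deriv :: "((R3 \<Rightarrow> real) \<Rightarrow> real) \<Rightarrow> (R3 \<Rightarrow> real) \<Rightarrow> (R3 \<Rightarrow> real) \<Rightarrow> real \<Rightarrow> bool" where
  "J_dir_deriv J u v d \<longleftrightarrow> ((\<lambda>t::real. J (\<lambda>x. u x + t * v x)) has_real_derivative d) (at 0)"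

definition critical_point :: "(R3 \<Rightarrow> real) set \<Rightarrow> ((R3 \<Rightarrow> real) \<Rightarrow> real) \<Rightarrow> (R3 \<Rightarrow> real) \<Rightarrow> bool" where
  "critical_point H J u \<longleftrightarrow> u \<in> H \<and> (\<forall>v \<in> H. J_dir_deriv J u v 0)"

definition nontrivial :: "(R3 \<Rightarrow> real) \<Rightarrow> bool" where
  "nontrivial u \<longleftrightarrow> \<not> (AE x in lborel. u x = 0)"

definition nehari :: "(R3 \<Rightarrow> real) set \<Rightarrow> ((R3 \<Rightarrow> real) \<Rightarrow> real) \<Rightarrow> (R3 \<Rightarrow> real) set" where
  "nehari H J = {u \<in> H. nontrivial u \<and> J_dir_deriv J u u 0}"

definition ground_state :: "(R3 \<Rightarrow> real) set \<Rightarrow> ((R3 \<Rightarrow> real) \<Rightarrow> real) \<Rightarrow> (R3 \<Rightarrow> real) \<Rightarrow> bool" where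
  "ground_state H J u \<longleftrightarrow> critical_point H J u \<and> nontrivial u \<and> J u = Inf (J ` nehari H J)"

end

theory Submission
  imports Defs "HOL-Complex_Analysis.Great_Picard"
begin

text \<open>
  The ground state is a minimizer of the energy on the Nehari set, obtained without weak convergence.

  Comparing the superlevel sets of \<open>u\<close> at heights \<open>l\<close> and \<open>2 l\<close> in the Gagliardo integral bounds the
  measure of the second by a power of the measure of the first; iterating over dyadic heights gives a
  weak-type Sobolev inequality, hence uniformly small tails of \<open>\<bar>u\<bar> powr q\<close> on bounded sets of the
  energy space. Averaging over small cubes shows that bounded sequences have subsequences that
  converge almost everywhere.

  Along a ray \<open>t u\<close> the derivative of the energy divided by \<open>t\<^sup>3\<close> is strictly decreasing, so points of
  the Nehari set maximize the energy on their ray, and every \<open>u\<close> whose positive part does not vanish in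
  the scaled domain can be projected to the Nehari set. Let \<open>u\<^sub>n\<close> be a minimizing sequence with almost
  everywhere limit \<open>u\<close>. Inside the scaled domain the nonlinear terms converge, outside the penalized
  integrand together with the quadratic term is nonnegative, so Fatou's lemma gives
  \<open>J (t u) \<le> liminf J (t u\<^sub>n) \<le> inf J\<close> for all \<open>t > 0\<close>. Passing to the positive part of \<open>u\<close> only
  lowers the energy, and its projection is a nonnegative minimizer \<open>z\<close>.

  Neither the functional nor the Nehari set is smooth enough for Lagrange multipliers. If the
  derivative at \<open>z\<close> in a direction \<open>v\<close> were negative, then by the intermediate value theorem some
  \<open>\<alpha> z + \<beta> v\<close> near \<open>z\<close> would lie on the Nehari set with smaller energy.
\<close>

section \<open>Measure and integration\<close>

lemma ex_dyadic_level:
  fixes t :: real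
  assumes "2 ^ k < t"
  obtains j where "2 ^ (k + j) < t" "t \<le> 2 ^ (k + j + 1)"
proof -
  obtain n where "t < 2 ^ n" using real_arch_pow[of 2 t] by auto
  also have "(2 :: real) ^ n \<le> 2 ^ (k + n)" by (intro power_increasing) auto
  finally have "\<exists>j<n. (\<forall>i\<le>j. \<not> t \<le> 2 ^ (k + i)) \<and> t \<le> 2 ^ (k + Suc j)"
    using assms by (intro ex_least_nat_less[of "\<lambda>j. t \<le> 2 ^ (k + j)"]) auto
  then show ?thesis using that by (metis Suc_eq_plus1 add.assoc le_refl not_le)
qed

lemma nn_integral_dyadic_le:
  fixes c :: "nat \<Rightarrow> ennreal"
  assumes L [measurable]: "\<And>j. L j \<in> sets M"
    and layer: "\<And>j x. x \<in> space M \<Longrightarrow> 2 ^ (k + j) < h x \<Longrightarrow> h x \<le> (2 :: real) ^ (k + j + 1) \<Longrightarrow>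
        x \<in> L j \<and> g x \<le> c j"
    and bound: "\<And>j. c j * emeasure M (L j) \<le> ennreal (A * y ^ j)"
    and A: "0 \<le> A" and y: "0 \<le> y" "y < 1"
  shows "(\<integral>\<^sup>+ x. g x * indicator {x. 2 ^ k < h x} x \<partial>M) \<le> ennreal (A / (1 - y))"
proof -
  have "g x * indicator {x. 2 ^ k < h x} x \<le> (\<Sum>j. c j * indicator (L j) x)" if "x \<in> space M" for x
  proof (cases "2 ^ k < h x")
    case True
    then obtain j where "2 ^ (k + j) < h x" "h x \<le> 2 ^ (k + j + 1)" by (rule ex_dyadic_level)
    then have "g x * indicator {x. 2 ^ k < h x} x \<le> (\<Sum>i\<in>{j}. c i * indicator (L i) x)"
      using layer[of x j] that True by simp
    also have "\<dots> \<le> (\<Sum>j. c j * indicator (L j) x)" by (rule sum_le_suminf) auto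
    finally show ?thesis .
  qed simp
  then have "(\<integral>\<^sup>+ x. g x * indicator {x. 2 ^ k < h x} x \<partial>M)
      \<le> (\<integral>\<^sup>+ x. (\<Sum>j. c j * indicator (L j) x) \<partial>M)"
    by (intro nn_integral_mono)
  also have "\<dots> = (\<Sum>j. c j * emeasure M (L j))"
    by (subst nn_integral_suminf) (auto simp: nn_integral_cmult_indicator)
  also have "\<dots> \<le> (\<Sum>j. ennreal (A * y ^ j))" by (intro suminf_le summableI bound)
  also have "\<dots> = ennreal (A * (1 / (1 - y)))"
    using A y by (intro suminf_ennreal_eq sums_mult geometric_sums) auto
  finally show ?thesis by simp
qed

lemma emeasure_abs_superlevel_le:
  fixes u :: "'a \<Rightarrow> real"
  assumes [measurable]: "u \<in> borel_measurable M" and t: "0 < t"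
    and second_moment: "(\<integral>\<^sup>+ x. ennreal ((u x)\<^sup>2) \<partial>M) \<le> ennreal R"
  shows "emeasure M {x \<in> space M. t < \<bar>u x\<bar>} \<le> ennreal (R / t\<^sup>2)"
proof -
  have "1 \<le> ennreal (1 / t\<^sup>2) * ennreal ((u x)\<^sup>2)" if "t < \<bar>u x\<bar>" for x
  proof -
    have "t\<^sup>2 \<le> (u x)\<^sup>2" using that t by (metis abs_le_square_iff abs_of_pos less_imp_le)
    then show ?thesis using t by (simp flip: ennreal_mult)
  qed
  then have "emeasure M {x \<in> space M. t < \<bar>u x\<bar>}
      \<le> emeasure M {x \<in> space M. 1 \<le> ennreal (1 / t\<^sup>2) * ennreal ((u x)\<^sup>2)}"
    by (intro emeasure_mono) auto
  also have "\<dots> \<le> ennreal (1 / t\<^sup>2) * (\<integral>\<^sup>+ x. ennreal ((u x)\<^sup>2) * indicator (space M) x \<partial>M)"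
    by (intro nn_integral_Markov_inequality) auto
  also have "\<dots> \<le> ennreal (1 / t\<^sup>2) * ennreal R"
    using second_moment by (intro mult_left_mono) (auto cong: nn_integral_cong)
  also have "\<dots> = ennreal (R / t\<^sup>2)" by (simp flip: ennreal_mult')
  finally show ?thesis .
qed

lemma nn_integral_fatou_le:
  fixes f :: "'a \<Rightarrow> real" and g :: "nat \<Rightarrow> 'a \<Rightarrow> real"
  assumes [measurable]: "\<And>n. g n \<in> borel_measurable M"
    and conv: "AE x in M. (\<lambda>n. g n x) \<longlonglongrightarrow> f x"
    and bound: "\<And>n. (\<integral>\<^sup>+ x. ennreal (g n x) \<partial>M) \<le> ennreal (c n)" and c: "c \<longlonglongrightarrow> d"
  shows "(\<integral>\<^sup>+ x. ennreal (f x) \<partial>M) \<le> ennreal d"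
proof -
  have "(\<integral>\<^sup>+ x. ennreal (f x) \<partial>M) = (\<integral>\<^sup>+ x. liminf (\<lambda>n. ennreal (g n x)) \<partial>M)"
  proof (rule nn_integral_cong_AE, use conv in eventually_elim)
    fix x assume "(\<lambda>n. g n x) \<longlonglongrightarrow> f x"
    then show "ennreal (f x) = liminf (\<lambda>n. ennreal (g n x))"
      using lim_imp_Liminf[OF sequentially_bot tendsto_ennrealI] by metis
  qed
  also have "\<dots> \<le> liminf (\<lambda>n. \<integral>\<^sup>+ x. ennreal (g n x) \<partial>M)" by (rule nn_integral_liminf) auto
  also have "\<dots> \<le> liminf (\<lambda>n. ennreal (c n))" by (intro Liminf_mono always_eventually allI bound)
  also have "\<dots> = ennreal d" using c by (intro lim_imp_Liminf tendsto_ennrealI) auto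
  finally show ?thesis .
qed

lemma (in pair_sigma_finite) AE_pair_fst_snd:
  assumes "AE x in M1. P x" "AE y in M2. Q y"
  shows "AE z in M1 \<Otimes>\<^sub>M M2. P (fst z) \<and> Q (snd z)"
proof -
  obtain A where A: "{x \<in> space M1. \<not> P x} \<subseteq> A" "emeasure M1 A = 0"
    and A_sets [measurable]: "A \<in> sets M1"
    using assms(1) by (rule AE_E)
  obtain B where B: "{y \<in> space M2. \<not> Q y} \<subseteq> B" "emeasure M2 B = 0"
    and B_sets [measurable]: "B \<in> sets M2"
    using assms(2) by (rule AE_E)
  have "AE z in M1 \<Otimes>\<^sub>M M2. fst z \<notin> A \<and> snd z \<notin> B"
  proof (rule AE_pair_measure)
    have "AE x in M1. x \<notin> A" "AE y in M2. y \<notin> B" using A B by (auto intro!: AE_not_in)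
    then show "AE x in M1. AE y in M2. fst (x, y) \<notin> A \<and> snd (x, y) \<notin> B" by auto
  qed measurable
  with AE_space show ?thesis
    by eventually_elim (use A(1) B(1) in \<open>auto simp: space_pair_measure\<close>)
qed

lemma integrable_weighted_product:
  fixes k f g :: "'a \<Rightarrow> real"
  assumes [measurable]: "k \<in> borel_measurable M" "f \<in> borel_measurable M" "g \<in> borel_measurable M"
    and k_nonneg: "\<And>x. 0 \<le> k x"
    and f: "integrable M (\<lambda>x. k x * (f x)\<^sup>2)" and g: "integrable M (\<lambda>x. k x * (g x)\<^sup>2)"
  shows "integrable M (\<lambda>x. k x * f x * g x)"
proof (rule Bochner_Integration.integrable_bound)
  show "integrable M (\<lambda>x. k x * (f x)\<^sup>2 + k x * (g x)\<^sup>2)" using f g by auto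
  have "\<bar>k x * f x * g x\<bar> \<le> k x * (f x)\<^sup>2 + k x * (g x)\<^sup>2" for x
  proof -
    have "2 * (\<bar>f x\<bar> * \<bar>g x\<bar>) \<le> (f x)\<^sup>2 + (g x)\<^sup>2"
      using sum_squares_bound[of "\<bar>f x\<bar>" "\<bar>g x\<bar>"] by simp
    moreover have "0 \<le> \<bar>f x\<bar> * \<bar>g x\<bar>" by simp
    ultimately have "\<bar>f x\<bar> * \<bar>g x\<bar> \<le> (f x)\<^sup>2 + (g x)\<^sup>2" by linarith
    from mult_left_mono[OF this k_nonneg[of x]] show ?thesis
      using k_nonneg[of x] by (simp add: abs_mult distrib_left mult.assoc)
  qed
  then show "AE x in M. norm (k x * f x * g x) \<le> norm (k x * (f x)\<^sup>2 + k x * (g x)\<^sup>2)"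
    using k_nonneg by (intro AE_I2) simp
qed measurable

lemma integral_le_of_nn_integral_le:
  fixes f :: "'a \<Rightarrow> real"
  assumes "f \<in> borel_measurable M" "\<And>x. 0 \<le> f x"
    and "(\<integral>\<^sup>+ x. ennreal (f x) \<partial>M) \<le> ennreal c" "0 \<le> c"
  shows "integrable M f" "(\<integral>x. f x \<partial>M) \<le> c"
  using assms
  by (auto intro!: integrableI_nonneg enn2real_leI simp: integral_eq_nn_integral le_less_trans)

lemma has_real_derivative_integral_dominated:
  fixes F :: "real \<Rightarrow> 'a \<Rightarrow> real"
  assumes int: "\<And>t. integrable M (F t)" and [measurable]: "F' \<in> borel_measurable M"
    and deriv: "\<And>x. ((\<lambda>t. F t x) has_real_derivative F' x) (at a)"
    and lipschitz: "\<And>t x. \<bar>t - a\<bar> \<le> 1 \<Longrightarrow> \<bar>F t x - F a x\<bar> \<le> L x * \<bar>t - a\<bar>" and L: "integrable M L"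
  shows "((\<lambda>t. \<integral>x. F t x \<partial>M) has_real_derivative (\<integral>x. F' x \<partial>M)) (at a)"
proof -
  have at_eq: "at a within {a - 1..a + 1} = at a"
    by (rule at_within_interior) (simp add: interior_atLeastAtMost_real)
  have [measurable]: "F t \<in> borel_measurable M" for t by (rule borel_measurable_integrable[OF int])
  have "((\<lambda>t. ((\<integral>x. F t x \<partial>M) - (\<integral>x. F a x \<partial>M)) / (t - a)) \<longlongrightarrow> (\<integral>x. F' x \<partial>M))
      (at a within {a - 1..a + 1})"
    unfolding tendsto_at_iff_sequentially
  proof (intro allI impI)
    fix X assume X: "\<forall>i. X i \<in> {a - 1..a + 1} - {a}" "X \<longlonglongrightarrow> a"
    have "(\<lambda>n. \<integral>x. (F (X n) x - F a x) / (X n - a) \<partial>M) \<longlonglongrightarrow> (\<integral>x. F' x \<partial>M)"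
    proof (rule integral_dominated_convergence[where w = L])
      show "AE x in M. (\<lambda>n. (F (X n) x - F a x) / (X n - a)) \<longlonglongrightarrow> F' x"
        using deriv X unfolding has_field_derivative_iff tendsto_at_iff_sequentially
        by (auto simp: o_def)
      show "AE x in M. norm ((F (X n) x - F a x) / (X n - a)) \<le> L x" for n
        using lipschitz[of "X n"] X(1)[rule_format, of n]
        by (intro AE_I2) (auto simp: abs_le_iff pos_divide_le_eq)
    qed (use L in auto)
    then show "((\<lambda>t. ((\<integral>x. F t x \<partial>M) - (\<integral>x. F a x \<partial>M)) / (t - a)) \<circ> X) \<longlonglongrightarrow> (\<integral>x. F' x \<partial>M)"
      using int by (simp add: o_def)
  qed
  then show ?thesis by (simp add: has_field_derivative_iff at_eq)
qed

lemma positive_superlevel_set: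
  fixes u :: "'a \<Rightarrow> real"
  assumes [measurable]: "u \<in> borel_measurable M" "B \<in> sets M"
    and pos: "\<not> (AE x in M. x \<in> B \<longrightarrow> u x \<le> 0)"
  obtains \<delta> where "0 < \<delta>" "emeasure M {x \<in> B. \<delta> < u x} \<noteq> 0"
proof -
  have [measurable]: "{x \<in> B. \<delta> < u x} \<in> sets M" for \<delta>
  proof -
    have "{x \<in> B. \<delta> < u x} = {x \<in> space M. x \<in> B \<and> \<delta> < u x}"
      using sets.sets_into_space[OF assms(2)] by blast
    then show ?thesis by simp
  qed
  have "\<exists>k. emeasure M {x \<in> B. inverse (real (Suc k)) < u x} \<noteq> 0"
  proof (rule ccontr)
    assume "\<nexists>k. emeasure M {x \<in> B. inverse (real (Suc k)) < u x} \<noteq> 0"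
    then have "AE x in M. x \<notin> {x \<in> B. inverse (real (Suc k)) < u x}" for k
      by (intro AE_not_in) (auto simp: null_sets_def)
    then have "AE x in M. \<forall>k. x \<notin> {x \<in> B. inverse (real (Suc k)) < u x}"
      by (subst AE_all_countable) blast
    then have "AE x in M. x \<in> B \<longrightarrow> u x \<le> 0"
      by eventually_elim (use reals_Archimedean not_le in blast)
    then show False using pos by blast
  qed
  then show ?thesis using that[of "inverse (real (Suc k))" for k] by auto
qed

lemma open_not_AE_avoided:
  fixes S :: "'a::euclidean_space set"
  assumes S: "open S" "S \<noteq> {}"
  shows "\<not> (AE x in lborel. x \<notin> S)"
proof
  assume "AE x in lborel. x \<notin> S"
  then have "S \<in> null_sets lborel" using S(1) by (subst AE_iff_null_sets) auto
  then have "S \<in> null_sets lebesgue" by (rule null_sets_completionI)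
  then show False using open_not_negligible[OF S] by (simp add: negligible_iff_null_sets)
qed

section \<open>A weak-type fractional Sobolev inequality\<close>

definition frac_kernel :: "real \<Rightarrow> 'a::euclidean_space \<times> 'a \<Rightarrow> real" where
  "frac_kernel s z = 1 / norm (fst z - snd z) powr (real DIM('a) + 2 * s)"

definition frac_energy :: "real \<Rightarrow> ('a::euclidean_space \<Rightarrow> real) \<Rightarrow> ennreal" where
  "frac_energy s u =
     (\<integral>\<^sup>+ z. ennreal (frac_kernel s z * (u (fst z) - u (snd z))\<^sup>2) \<partial>(lborel \<Otimes>\<^sub>M lborel))"

definition critical_exponent :: "nat \<Rightarrow> real \<Rightarrow> real" where
  "critical_exponent d s = 2 * real d / (real d - 2 * s)"

definition sobolev_ball :: "real \<Rightarrow> real \<Rightarrow> ('a::euclidean_space \<Rightarrow> real) set" where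
  "sobolev_ball s R = {u. u \<in> borel_measurable borel \<and>
     (\<integral>\<^sup>+ x. ennreal ((u x)\<^sup>2) \<partial>lborel) \<le> ennreal R \<and> frac_energy s u \<le> ennreal R}"

lemma frac_kernel_nonneg: "0 \<le> frac_kernel s z"
  by (simp add: frac_kernel_def)

lemma frac_kernel_measurable [measurable]:
  "frac_kernel s \<in> borel_measurable (lborel \<Otimes>\<^sub>M lborel)"
  unfolding frac_kernel_def[abs_def] by measurable

lemma frac_kernel_pair_measurable [measurable (raw)]:
  assumes [measurable]: "f \<in> borel_measurable M" "g \<in> borel_measurable M"
  shows "(\<lambda>x. frac_kernel s (f x, g x)) \<in> borel_measurable M"
  unfolding frac_kernel_def by measurable

lemma frac_kernel_commute: "frac_kernel s (x, y) = frac_kernel s (y, x)"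
  by (simp add: frac_kernel_def norm_minus_commute)

lemma frac_kernel_ge:
  fixes x y :: "'a::euclidean_space"
  assumes "x \<noteq> y" "norm (x - y) \<le> r" "0 \<le> s"
  shows "r powr (- (real DIM('a) + 2 * s)) \<le> frac_kernel s (x, y)"
proof -
  have "r powr (- (real DIM('a) + 2 * s)) \<le> norm (x - y) powr (- (real DIM('a) + 2 * s))"
    using assms by (intro powr_mono2') auto
  then show ?thesis by (simp only: frac_kernel_def powr_minus_divide fst_conv snd_conv)
qed

lemma frac_kernel_le:
  fixes x y :: "'a::euclidean_space"
  assumes "0 < r" "r \<le> norm (x - y)" "0 \<le> s"
  shows "frac_kernel s (x, y) \<le> r powr (- (real DIM('a) + 2 * s))"
proof -
  have "norm (x - y) powr (- (real DIM('a) + 2 * s)) \<le> r powr (- (real DIM('a) + 2 * s))"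
    using assms by (intro powr_mono2') auto
  then show ?thesis by (simp only: frac_kernel_def powr_minus_divide fst_conv snd_conv)
qed

lemma frac_energy_iterated:
  assumes [measurable]: "u \<in> borel_measurable borel"
  shows "frac_energy s u =
    (\<integral>\<^sup>+ x. \<integral>\<^sup>+ y. ennreal (frac_kernel s (x, y) * (u x - u y)\<^sup>2) \<partial>lborel \<partial>lborel)"
  unfolding frac_energy_def by (subst lborel.nn_integral_fst[symmetric]) auto

lemma frac_energy_fatou:
  assumes [measurable]: "\<And>n. v n \<in> borel_measurable borel"
    and conv: "AE x in lborel. (\<lambda>n. v n x) \<longlonglongrightarrow> w x"
    and bound: "\<And>n. frac_energy s (v n) \<le> ennreal (c n)" and c: "c \<longlonglongrightarrow> d"
  shows "frac_energy s w \<le> ennreal d"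
  unfolding frac_energy_def
proof (rule nn_integral_fatou_le[OF _ _ _ c])
  show "AE z in lborel \<Otimes>\<^sub>M lborel. (\<lambda>n. frac_kernel s z * (v n (fst z) - v n (snd z))\<^sup>2)
      \<longlonglongrightarrow> frac_kernel s z * (w (fst z) - w (snd z))\<^sup>2"
    using lborel_pair.AE_pair_fst_snd[OF conv conv] by eventually_elim (intro tendsto_intros, auto)
qed (use bound in \<open>auto simp: frac_energy_def\<close>)

text \<open>A ball of measure \<open>2 m\<close> around \<open>x\<close> meets the complement of \<open>E\<close> in measure at least \<open>m\<close>.\<close>

lemma frac_kernel_complement_bound:
  fixes E :: "'a::euclidean_space set"
  assumes E [measurable]: "E \<in> sets borel" and emeasure_E: "emeasure lborel E = ennreal m"
    and m: "0 < m" and s: "0 < s"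
  shows "ennreal ((2 / unit_ball_vol (real DIM('a))) powr (- (1 + 2 * s / real DIM('a)))
      * m powr (- (2 * s / real DIM('a))))
    \<le> (\<integral>\<^sup>+ y. ennreal (frac_kernel s (x, y)) * indicator (- E) y \<partial>lborel)"
proof -
  define d where "d = real DIM('a)"
  define \<omega> where "\<omega> = unit_ball_vol d"
  define r where "r = (2 * m / \<omega>) powr (1 / d)"
  define D where "D = cball x r - E - {x}"
  have d: "0 < d" and \<omega>: "0 < \<omega>" by (auto simp: d_def \<omega>_def)
  have r: "0 < r" using m \<omega> by (simp add: r_def)
  have [measurable]: "D \<in> sets borel" by (auto simp: D_def)
  have "r ^ DIM('a) = 2 * m / \<omega>" using m \<omega> d by (simp add: r_def powr_powr d_def flip: powr_realpow)
  then have ball: "emeasure lborel (cball x r) = ennreal m + ennreal m"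
    using r \<omega> m by (simp add: emeasure_cball flip: ennreal_plus d_def \<omega>_def)
  have "emeasure lborel (cball x r) \<le> emeasure lborel (D \<union> (E \<union> {x}))"
    by (rule emeasure_mono) (auto simp: D_def)
  also have "\<dots> \<le> emeasure lborel D + (emeasure lborel E + emeasure lborel {x})"
    by (intro order_trans[OF emeasure_subadditive] add_left_mono emeasure_subadditive) auto
  finally have D_ge: "ennreal m \<le> emeasure lborel D"
    by (simp add: ball emeasure_E add.commute ennreal_add_left_cancel_le)
  have "(2 / \<omega>) powr (- (1 + 2 * s / d)) * m powr (- (2 * s / d)) = r powr (- (d + 2 * s)) * m"
  proof -
    have "r powr (- (d + 2 * s)) = (2 / \<omega> * m) powr (- (1 + 2 * s / d))"
      using d by (simp add: r_def powr_powr) (simp add: field_simps)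
    also have "\<dots> = (2 / \<omega>) powr (- (1 + 2 * s / d)) * m powr (- (1 + 2 * s / d))"
      using m \<omega> by (intro powr_mult)
    also have "m powr (- (1 + 2 * s / d)) = m powr (- 1) * m powr (- (2 * s / d))"
      by (subst powr_add[symmetric]) simp
    finally show ?thesis using m by (simp add: powr_minus_divide)
  qed
  then have "ennreal ((2 / \<omega>) powr (- (1 + 2 * s / d)) * m powr (- (2 * s / d)))
      = ennreal (r powr (- (d + 2 * s))) * ennreal m"
    using m by (simp add: ennreal_mult)
  also have "\<dots> \<le> ennreal (r powr (- (d + 2 * s))) * emeasure lborel D"
    by (intro mult_left_mono D_ge) auto
  also have "\<dots> = (\<integral>\<^sup>+ y. ennreal (r powr (- (d + 2 * s))) * indicator D y \<partial>lborel)"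
    by (simp add: nn_integral_cmult_indicator)
  also have "\<dots> \<le> (\<integral>\<^sup>+ y. ennreal (frac_kernel s (x, y)) * indicator (- E) y \<partial>lborel)"
    using s frac_kernel_ge[of x _ r s]
    by (intro nn_integral_mono) (auto simp: indicator_def D_def d_def dist_norm intro!: ennreal_leI)
  finally show ?thesis by (simp add: d_def \<omega>_def)
qed

lemma frac_energy_ge_superlevel:
  fixes u :: "'a::euclidean_space \<Rightarrow> real"
  assumes [measurable]: "u \<in> borel_measurable borel" and t: "0 < t" and c: "0 \<le> c"
    and kernel: "\<And>x. ennreal c
        \<le> (\<integral>\<^sup>+ y. ennreal (frac_kernel s (x, y)) * indicator (- {y. t < \<bar>u y\<bar>}) y \<partial>lborel)"
  shows "ennreal (t\<^sup>2 * c) * emeasure lborel {x. 2 * t < \<bar>u x\<bar>} \<le> frac_energy s u"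
proof -
  have jump: "ennreal (t\<^sup>2) * (ennreal (frac_kernel s (x, y)) * indicator (- {y. t < \<bar>u y\<bar>}) y)
      \<le> ennreal (frac_kernel s (x, y) * (u x - u y)\<^sup>2)" if "2 * t < \<bar>u x\<bar>" for x y
  proof (cases "t < \<bar>u y\<bar>")
    case False
    then have "t \<le> \<bar>u x - u y\<bar>" using that by linarith
    then have "t\<^sup>2 \<le> (u x - u y)\<^sup>2" using t by (metis abs_le_square_iff abs_of_pos)
    then have "ennreal (frac_kernel s (x, y) * t\<^sup>2) \<le> ennreal (frac_kernel s (x, y) * (u x - u y)\<^sup>2)"
      by (intro ennreal_leI mult_left_mono frac_kernel_nonneg)
    then show ?thesis using False by (simp add: ennreal_mult frac_kernel_nonneg mult.commute)
  qed simp
  have "ennreal (t\<^sup>2 * c) * indicator {x. 2 * t < \<bar>u x\<bar>} x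
      \<le> (\<integral>\<^sup>+ y. ennreal (frac_kernel s (x, y) * (u x - u y)\<^sup>2) \<partial>lborel)" for x
  proof (cases "2 * t < \<bar>u x\<bar>")
    case True
    have "ennreal (t\<^sup>2 * c)
        \<le> ennreal (t\<^sup>2) *
          (\<integral>\<^sup>+ y. ennreal (frac_kernel s (x, y)) * indicator (- {y. t < \<bar>u y\<bar>}) y \<partial>lborel)"
      using c by (simp add: ennreal_mult mult_left_mono kernel)
    also have "\<dots> = (\<integral>\<^sup>+ y. ennreal (t\<^sup>2) *
        (ennreal (frac_kernel s (x, y)) * indicator (- {y. t < \<bar>u y\<bar>}) y) \<partial>lborel)"
      by (subst nn_integral_cmult) auto
    also have "\<dots> \<le> (\<integral>\<^sup>+ y. ennreal (frac_kernel s (x, y) * (u x - u y)\<^sup>2) \<partial>lborel)"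
      by (intro nn_integral_mono jump True)
    finally show ?thesis using True by simp
  qed simp
  then have "(\<integral>\<^sup>+ x. ennreal (t\<^sup>2 * c) * indicator {x. 2 * t < \<bar>u x\<bar>} x \<partial>lborel) \<le> frac_energy s u"
    by (subst frac_energy_iterated) (auto intro: nn_integral_mono)
  then show ?thesis by (simp add: nn_integral_cmult_indicator)
qed

lemma emeasure_superlevel_eq_measure:
  assumes u: "u \<in> sobolev_ball s R" and r: "0 < r"
  shows "emeasure lborel {x. r < \<bar>u x\<bar>} = ennreal (measure lborel {x. r < \<bar>u x\<bar>})"
proof -
  have "emeasure lborel {x. r < \<bar>u x\<bar>} \<le> ennreal (R / r\<^sup>2)"
    using emeasure_abs_superlevel_le[of u lborel r R] u r by (simp add: sobolev_ball_def)
  then have "emeasure lborel {x. r < \<bar>u x\<bar>} < \<infinity>" by (simp add: le_less_trans)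
  then show ?thesis by (simp add: emeasure_eq_ennreal_measure top.not_eq_extremum)
qed

lemma measure_double_superlevel_le:
  fixes u :: "'a::euclidean_space \<Rightarrow> real"
  assumes s: "0 < s" and R: "0 \<le> R" and u: "u \<in> sobolev_ball s R" and t: "0 < t"
    and pos: "0 < measure lborel {x. t < \<bar>u x\<bar>}"
  shows "measure lborel {x. 2 * t < \<bar>u x\<bar>}
    \<le> (2 / unit_ball_vol (real DIM('a))) powr (1 + 2 * s / real DIM('a)) * R / t\<^sup>2
      * measure lborel {x. t < \<bar>u x\<bar>} powr (2 * s / real DIM('a))"
proof -
  define \<sigma> where "\<sigma> = 2 * s / real DIM('a)"
  define C where "C = (2 / unit_ball_vol (real DIM('a))) powr (1 + \<sigma>)"
  define m where "m = measure lborel {x. t < \<bar>u x\<bar>}"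
  define c where "c = 1 / (C * m powr \<sigma>)"
  have [measurable]: "u \<in> borel_measurable borel" using u by (simp add: sobolev_ball_def)
  note superlevel = emeasure_superlevel_eq_measure[OF u]
  have m: "0 < m" using pos by (simp add: m_def)
  have "0 < 2 / unit_ball_vol (real DIM('a))" by (intro divide_pos_pos) auto
  then have "0 < C" unfolding C_def by (metis powr_gt_zero less_irrefl)
  then have c: "0 < c" using m by (simp add: c_def)
  have "(2 / unit_ball_vol (real DIM('a))) powr (- (1 + \<sigma>)) * m powr (- \<sigma>) = c"
    by (simp only: c_def C_def powr_minus_divide) simp
  then have "ennreal c
      \<le> (\<integral>\<^sup>+ y. ennreal (frac_kernel s (x, y)) * indicator (- {y. t < \<bar>u y\<bar>}) y \<partial>lborel)" for x
    using frac_kernel_complement_bound[of "{y. t < \<bar>u y\<bar>}" m s x] superlevel[OF t] m s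
    by (simp add: m_def \<sigma>_def)
  then have "ennreal (t\<^sup>2 * c) * emeasure lborel {x. 2 * t < \<bar>u x\<bar>} \<le> frac_energy s u"
    using t c by (intro frac_energy_ge_superlevel) auto
  also have "\<dots> \<le> ennreal R" using u by (simp add: sobolev_ball_def)
  finally have "t\<^sup>2 * c * measure lborel {x. 2 * t < \<bar>u x\<bar>} \<le> R"
    using superlevel[of "2 * t"] t R c by (simp add: ennreal_le_iff flip: ennreal_mult)
  then have "measure lborel {x. 2 * t < \<bar>u x\<bar>} \<le> R / (t\<^sup>2 * c)"
    using t c by (simp add: pos_le_divide_eq mult.commute)
  also have "\<dots> = C * R / t\<^sup>2 * m powr \<sigma>" by (simp add: c_def)
  finally show ?thesis by (simp add: m_def C_def \<sigma>_def)
qed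

lemma measure_superlevel_recursion:
  assumes s: "0 < s" and R: "0 \<le> R"
  obtains C where "0 < C"
    "\<And>(u :: 'a::euclidean_space \<Rightarrow> real) t. u \<in> sobolev_ball s R \<Longrightarrow> 0 < t \<Longrightarrow>
       measure lborel {x. 2 * t < \<bar>u x\<bar>}
         \<le> C * R / t\<^sup>2 * measure lborel {x. t < \<bar>u x\<bar>} powr (2 * s / real DIM('a))"
proof -
  define C where "C = (2 / unit_ball_vol (real DIM('a))) powr (1 + 2 * s / real DIM('a))"
  have "0 < 2 / unit_ball_vol (real DIM('a))" by (intro divide_pos_pos) auto
  then have C: "0 < C" unfolding C_def by (metis powr_gt_zero less_irrefl)
  have "measure lborel {x. 2 * t < \<bar>u x\<bar>}
      \<le> C * R / t\<^sup>2 * measure lborel {x. t < \<bar>u x\<bar>} powr (2 * s / real DIM('a))"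
    if u: "u \<in> sobolev_ball s R" and t: "0 < t" for u :: "'a \<Rightarrow> real" and t
  proof (cases "measure lborel {x. t < \<bar>u x\<bar>} = 0")
    case True
    have [measurable]: "u \<in> borel_measurable borel" using u by (simp add: sobolev_ball_def)
    have "measure lborel {x. 2 * t < \<bar>u x\<bar>} \<le> measure lborel {x. t < \<bar>u x\<bar>}"
      using emeasure_superlevel_eq_measure[OF u t] t
      by (intro measure_mono_fmeasurable) (auto simp: fmeasurable_def)
    then show ?thesis using True by simp
  next
    case False
    then show ?thesis
      unfolding C_def by (intro measure_double_superlevel_le s R u t) (simp add: zero_less_measure_iff)
  qed
  then show ?thesis using that[OF C] by blast
qed

lemma powr_fixed_point_step:
  fixes p \<sigma> :: real
  assumes p: "p = 2 + \<sigma> * p"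
  shows "2 powr (- real k * (\<sigma> * p)) / (2 ^ k)\<^sup>2 = 2 powr p * 2 powr (- real (Suc k) * p)"
proof -
  have "((2 :: real) ^ k)\<^sup>2 = 2 powr (2 * real k)"
    by (metis mult.commute of_nat_mult of_nat_numeral power_mult powr_realpow zero_less_numeral)
  then have "2 powr (- real k * (\<sigma> * p)) / (2 ^ k)\<^sup>2 = 2 powr (- real k * (2 + \<sigma> * p))"
    by (simp add: algebra_simps flip: powr_diff)
  also have "\<dots> = 2 powr (- real k * p)" using p by simp
  also have "\<dots> = 2 powr p * 2 powr (- real (Suc k) * p)"
    by (simp flip: powr_add add: algebra_simps)
  finally show ?thesis .
qed

text \<open>The exponent \<open>2 / (1 - \<sigma>)\<close> is the fixed point of \<open>p \<mapsto> 2 + \<sigma> p\<close>.\<close>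

lemma geometric_decay_of_recursion:
  fixes A C \<sigma> :: real
  assumes A: "0 < A" and C: "0 < C" and \<sigma>: "0 < \<sigma>" "\<sigma> < 1"
  obtains D where "0 < D"
    "\<And>a k. a 0 \<le> A \<Longrightarrow> (\<And>k. 0 \<le> a k) \<Longrightarrow> (\<And>k. a (Suc k) \<le> C / (2 ^ k)\<^sup>2 * a k powr \<sigma>) \<Longrightarrow>
       a k \<le> D * 2 powr (- real k * (2 / (1 - \<sigma>)))"
proof -
  define p where "p = 2 / (1 - \<sigma>)"
  define D where "D = max A ((C * 2 powr p) powr (1 / (1 - \<sigma>)))"
  have p: "p = 2 + \<sigma> * p" using \<sigma> by (simp add: p_def field_simps)
  have D: "0 < D" using A by (simp add: D_def)
  have D_invariant: "C * 2 powr p * D powr \<sigma> \<le> D"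
  proof -
    have "C * 2 powr p = ((C * 2 powr p) powr (1 / (1 - \<sigma>))) powr (1 - \<sigma>)"
      using \<sigma> C by (simp add: powr_powr)
    also have "\<dots> \<le> D powr (1 - \<sigma>)" using \<sigma> by (intro powr_mono2) (auto simp: D_def)
    finally have "C * 2 powr p * D powr \<sigma> \<le> D powr (1 - \<sigma>) * D powr \<sigma>"
      by (intro mult_right_mono) auto
    also have "\<dots> = D" using D by (simp flip: powr_add)
    finally show ?thesis .
  qed
  have "a k \<le> D * 2 powr (- real k * p)"
    if "a 0 \<le> A" and nonneg: "\<And>k. 0 \<le> a k"
      and step: "\<And>k. a (Suc k) \<le> C / (2 ^ k)\<^sup>2 * a k powr \<sigma>" for a k
  proof (induction k)
    case 0
    then show ?case using \<open>a 0 \<le> A\<close> by (simp add: D_def)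
  next
    case (Suc k)
    have "a (Suc k) \<le> C / (2 ^ k)\<^sup>2 * (D * 2 powr (- real k * p)) powr \<sigma>"
      using Suc.IH nonneg[of k] \<sigma> C
      by (intro order_trans[OF step] mult_left_mono powr_mono2) auto
    also have "\<dots> = C * D powr \<sigma> * (2 powr (- real k * (\<sigma> * p)) / (2 ^ k)\<^sup>2)"
      using D by (simp add: powr_mult powr_powr mult_ac)
    also have "\<dots> = (C * 2 powr p * D powr \<sigma>) * 2 powr (- real (Suc k) * p)"
      unfolding powr_fixed_point_step[OF p] by simp
    also have "\<dots> \<le> D * 2 powr (- real (Suc k) * p)"
      using D_invariant by (intro mult_right_mono) auto
    finally show ?case .
  qed
  then show ?thesis using that[OF D] by (simp add: p_def)
qed

lemma weak_sobolev:
  assumes s: "0 < s" "2 * s < real DIM('a)" and R: "0 < R"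
  obtains D where "0 < D"
    "\<And>(u :: 'a::euclidean_space \<Rightarrow> real) k. u \<in> sobolev_ball s R \<Longrightarrow>
       emeasure lborel {x. 2 ^ k < \<bar>u x\<bar>}
         \<le> ennreal (D * 2 powr (- real k * critical_exponent DIM('a) s))"
proof -
  define \<sigma> where "\<sigma> = 2 * s / real DIM('a)"
  have \<sigma>: "0 < \<sigma>" "\<sigma> < 1" using s by (auto simp: \<sigma>_def)
  have p: "critical_exponent DIM('a) s = 2 / (1 - \<sigma>)"
    using s by (simp add: critical_exponent_def \<sigma>_def field_simps)
  obtain C where C: "0 < C" and recursion: "\<And>(u :: 'a \<Rightarrow> real) t. u \<in> sobolev_ball s R \<Longrightarrow> 0 < t \<Longrightarrow>
      measure lborel {x. 2 * t < \<bar>u x\<bar>} \<le> C * R / t\<^sup>2 * measure lborel {x. t < \<bar>u x\<bar>} powr \<sigma>"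
    using measure_superlevel_recursion[of s R, where 'a = 'a] s R unfolding \<sigma>_def
    by (metis less_imp_le)
  obtain D where D: "0 < D" and decay: "\<And>a k. a 0 \<le> R \<Longrightarrow> (\<And>k. 0 \<le> a k) \<Longrightarrow>
      (\<And>k. a (Suc k) \<le> C * R / (2 ^ k)\<^sup>2 * a k powr \<sigma>) \<Longrightarrow> a k \<le> D * 2 powr (- real k * (2 / (1 - \<sigma>)))"
    using geometric_decay_of_recursion[of R "C * R" \<sigma>] R C \<sigma> by (metis mult_pos_pos)
  have "emeasure lborel {x. 2 ^ k < \<bar>u x\<bar>}
      \<le> ennreal (D * 2 powr (- real k * critical_exponent DIM('a) s))"
    if u: "u \<in> sobolev_ball s R" for u :: "'a \<Rightarrow> real" and k
  proof -
    define a where "a j = measure lborel {x. 2 ^ j < \<bar>u x\<bar>}" for j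
    have superlevel: "emeasure lborel {x. 2 ^ j < \<bar>u x\<bar>} = ennreal (a j)" for j
      unfolding a_def by (rule emeasure_superlevel_eq_measure[OF u]) simp
    have "a k \<le> D * 2 powr (- real k * (2 / (1 - \<sigma>)))"
    proof (rule decay)
      have "emeasure lborel {x. 2 ^ 0 < \<bar>u x\<bar>} \<le> ennreal R"
        using emeasure_abs_superlevel_le[of u lborel 1 R] u by (simp add: sobolev_ball_def)
      then show "a 0 \<le> R" using R unfolding superlevel by (simp add: ennreal_le_iff)
      show "a (Suc k) \<le> C * R / (2 ^ k)\<^sup>2 * a k powr \<sigma>" for k
        using recursion[OF u, of "2 ^ k"] by (simp add: a_def)
    qed (simp add: a_def)
    then show ?thesis unfolding superlevel p by (rule ennreal_leI)
  qed
  then show ?thesis using that[OF D] by blast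
qed

section \<open>Uniform tails and convergence of subcritical integrals\<close>

definition uniform_tails :: "'a measure \<Rightarrow> real \<Rightarrow> ('a \<Rightarrow> real) set \<Rightarrow> bool" where
  "uniform_tails M q U \<longleftrightarrow>
     (\<forall>e>0. \<exists>T\<ge>1. \<forall>u\<in>U. (\<integral>\<^sup>+ x. ennreal (\<bar>u x\<bar> powr q) * indicator {x. T < \<bar>u x\<bar>} x \<partial>M) \<le> ennreal e)"

lemma uniform_tailsE:
  assumes "uniform_tails M q U" "0 < e"
  obtains T where "1 \<le> T"
    "\<And>u. u \<in> U \<Longrightarrow> (\<integral>\<^sup>+ x. ennreal (\<bar>u x\<bar> powr q) * indicator {x. T < \<bar>u x\<bar>} x \<partial>M) \<le> ennreal e"
  using assms unfolding uniform_tails_def by blast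

lemma nn_integral_tail_le_of_weak_bound:
  assumes [measurable]: "u \<in> borel_measurable M"
    and weak: "\<And>j. emeasure M {x \<in> space M. 2 ^ j < \<bar>u x\<bar>} \<le> ennreal (D * 2 powr (- real j * p))"
    and D: "0 \<le> D" and q: "0 < q" "q < p"
  shows "(\<integral>\<^sup>+ x. ennreal (\<bar>u x\<bar> powr q) * indicator {x. 2 ^ k < \<bar>u x\<bar>} x \<partial>M)
    \<le> ennreal (2 powr q * D / (1 - 2 powr (q - p)) * (2 powr (q - p)) ^ k)"
proof -
  define y :: real where "y = 2 powr (q - p)"
  have y: "0 < y" "y < 1" using q powr_less_mono[of "q - p" 0 2] by (auto simp: y_def)
  have "(\<integral>\<^sup>+ x. ennreal (\<bar>u x\<bar> powr q) * indicator {x. 2 ^ k < \<bar>u x\<bar>} x \<partial>M)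
      \<le> ennreal (2 powr q * D * y ^ k / (1 - y))"
  proof (rule nn_integral_dyadic_le)
    fix j
    let ?c = "ennreal (2 powr (real (k + j + 1) * q))"
    show "x \<in> {x \<in> space M. 2 ^ (k + j) < \<bar>u x\<bar>} \<and> ennreal (\<bar>u x\<bar> powr q) \<le> ?c"
      if "x \<in> space M" "2 ^ (k + j) < \<bar>u x\<bar>" "\<bar>u x\<bar> \<le> 2 ^ (k + j + 1)" for x
    proof -
      have "\<bar>u x\<bar> powr q \<le> (2 ^ (k + j + 1)) powr q" using that q by (intro powr_mono2) auto
      also have "\<dots> = 2 powr (real (k + j + 1) * q)"
        by (simp only: powr_realpow[symmetric] powr_powr zero_less_numeral)
      finally show ?thesis using that by (simp add: ennreal_leI)
    qed
    have "2 powr (real (k + j + 1) * q) * (D * 2 powr (- real (k + j) * p))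
        = 2 powr q * D * y ^ k * y ^ j"
    proof -
      have "y ^ k * y ^ j = 2 powr (real (k + j) * (q - p))"
        by (simp add: y_def powr_power algebra_simps flip: powr_add)
      then have "2 powr q * D * (y ^ k * y ^ j)
          = 2 powr (real (k + j + 1) * q) * (D * 2 powr (- real (k + j) * p))"
        by (simp add: algebra_simps powr_add powr_diff powr_minus_divide)
      then show ?thesis by (simp only: mult.assoc)
    qed
    then have eq: "?c * ennreal (D * 2 powr (- real (k + j) * p))
        = ennreal (2 powr q * D * y ^ k * y ^ j)"
      using D by (subst ennreal_mult[symmetric]) (simp_all only: powr_ge_zero mult_nonneg_nonneg)
    have "?c * emeasure M {x \<in> space M. 2 ^ (k + j) < \<bar>u x\<bar>}
        \<le> ?c * ennreal (D * 2 powr (- real (k + j) * p))"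
      by (intro mult_left_mono weak) simp
    then show "?c * emeasure M {x \<in> space M. 2 ^ (k + j) < \<bar>u x\<bar>}
        \<le> ennreal (2 powr q * D * y ^ k * y ^ j)"
      unfolding eq .
  qed (use D y in auto)
  then show ?thesis by (simp add: y_def)
qed

lemma nn_integral_powr_le_tail:
  assumes [measurable]: "u \<in> borel_measurable M" and T: "0 < T" and q: "2 \<le> q"
  shows "(\<integral>\<^sup>+ x. ennreal (\<bar>u x\<bar> powr q) \<partial>M) \<le> ennreal (T powr (q - 2)) * (\<integral>\<^sup>+ x. ennreal ((u x)\<^sup>2) \<partial>M)
    + (\<integral>\<^sup>+ x. ennreal (\<bar>u x\<bar> powr q) * indicator {x. T < \<bar>u x\<bar>} x \<partial>M)"
proof -
  have "ennreal (\<bar>u x\<bar> powr q)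
      \<le> ennreal (T powr (q - 2)) * ennreal ((u x)\<^sup>2)
        + ennreal (\<bar>u x\<bar> powr q) * indicator {x. T < \<bar>u x\<bar>} x" for x
  proof (cases "T < \<bar>u x\<bar>")
    case False
    have "\<bar>u x\<bar> powr q = \<bar>u x\<bar> powr (q - 2) * (u x)\<^sup>2"
      by (cases "u x = 0") (simp_all add: powr_diff)
    also have "\<dots> \<le> T powr (q - 2) * (u x)\<^sup>2"
      using False q by (intro mult_right_mono powr_mono2) auto
    finally show ?thesis using False by (simp add: ennreal_leI flip: ennreal_mult)
  qed simp
  then have "(\<integral>\<^sup>+ x. ennreal (\<bar>u x\<bar> powr q) \<partial>M) \<le> (\<integral>\<^sup>+ x. ennreal (T powr (q - 2)) * ennreal ((u x)\<^sup>2)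
      + ennreal (\<bar>u x\<bar> powr q) * indicator {x. T < \<bar>u x\<bar>} x \<partial>M)"
    by (intro nn_integral_mono)
  then show ?thesis by (simp add: nn_integral_add nn_integral_cmult)
qed

lemma sobolev_ball_measurable: "u \<in> sobolev_ball s R \<Longrightarrow> u \<in> borel_measurable borel"
  by (simp add: sobolev_ball_def)

lemma sobolev_ball_uniform_tails:
  assumes s: "0 < s" "2 * s < real DIM('a)" and R: "0 < R"
    and q: "0 < q" "q < critical_exponent DIM('a) s"
  shows "uniform_tails lborel q (sobolev_ball s R :: ('a::euclidean_space \<Rightarrow> real) set)"
  unfolding uniform_tails_def
proof (intro allI impI)
  fix e :: real assume e: "0 < e"
  define y where "y = 2 powr (q - critical_exponent DIM('a) s)"
  have y: "0 < y" "y < 1"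
    using q powr_less_mono[of "q - critical_exponent DIM('a) s" 0 2] by (auto simp: y_def)
  obtain D where D: "0 < D" and weak: "\<And>(u :: 'a \<Rightarrow> real) k. u \<in> sobolev_ball s R \<Longrightarrow>
      emeasure lborel {x. 2 ^ k < \<bar>u x\<bar>}
        \<le> ennreal (D * 2 powr (- real k * critical_exponent DIM('a) s))"
    using weak_sobolev[OF s R] by blast
  define c where "c = 2 powr q * D / (1 - y)"
  have c: "0 < c" using D y by (simp add: c_def)
  obtain k where "y ^ k < e / c" using real_arch_pow_inv[of "e / c" y] y c e by auto
  then have k: "c * y ^ k \<le> e" using c by (simp add: field_simps)
  have "(\<integral>\<^sup>+ x. ennreal (\<bar>u x\<bar> powr q) * indicator {x. 2 ^ k < \<bar>u x\<bar>} x \<partial>lborel) \<le> ennreal e"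
    if u: "u \<in> sobolev_ball s R" for u :: "'a \<Rightarrow> real"
  proof -
    have "(\<integral>\<^sup>+ x. ennreal (\<bar>u x\<bar> powr q) * indicator {x. 2 ^ k < \<bar>u x\<bar>} x \<partial>lborel)
        \<le> ennreal (c * y ^ k)"
      unfolding c_def y_def using weak[OF u] D q sobolev_ball_measurable[OF u]
      by (intro nn_integral_tail_le_of_weak_bound) auto
    also have "\<dots> \<le> ennreal e" using k by (rule ennreal_leI)
    finally show ?thesis .
  qed
  then show "\<exists>T\<ge>1. \<forall>u\<in>sobolev_ball s R.
      (\<integral>\<^sup>+ x. ennreal (\<bar>u (x :: 'a)\<bar> powr q) * indicator {x. T < \<bar>u x\<bar>} x \<partial>lborel) \<le> ennreal e"
    by (intro exI[of _ "2 ^ k"]) auto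
qed

lemma sobolev_ball_powr_bound:
  assumes s: "0 < s" "2 * s < real DIM('a)" and R: "0 < R"
    and q: "2 \<le> q" "q < critical_exponent DIM('a) s"
  obtains C where "0 < C" "\<And>u :: 'a::euclidean_space \<Rightarrow> real. u \<in> sobolev_ball s R \<Longrightarrow>
    integrable lborel (\<lambda>x. \<bar>u x\<bar> powr q) \<and> (LBINT x. \<bar>u x\<bar> powr q) \<le> C"
proof -
  have "uniform_tails lborel q (sobolev_ball s R :: ('a \<Rightarrow> real) set)"
    using q by (intro sobolev_ball_uniform_tails s R) auto
  then obtain T where T: "1 \<le> T" and tail: "\<And>u :: 'a \<Rightarrow> real. u \<in> sobolev_ball s R \<Longrightarrow>
      (\<integral>\<^sup>+ x. ennreal (\<bar>u x\<bar> powr q) * indicator {x. T < \<bar>u x\<bar>} x \<partial>lborel) \<le> ennreal 1"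
    by (rule uniform_tailsE[OF _ zero_less_one]) blast
  define C where "C = T powr (q - 2) * R + 1"
  have C: "0 < C" using R by (simp add: C_def add_nonneg_pos)
  have "integrable lborel (\<lambda>x. \<bar>u x\<bar> powr q) \<and> (LBINT x. \<bar>u x\<bar> powr q) \<le> C"
    if u: "u \<in> sobolev_ball s R" for u :: "'a \<Rightarrow> real"
  proof -
    note [measurable] = sobolev_ball_measurable[OF u]
    have "(\<integral>\<^sup>+ x. ennreal (\<bar>u x\<bar> powr q) \<partial>lborel)
        \<le> ennreal (T powr (q - 2)) * (\<integral>\<^sup>+ x. ennreal ((u x)\<^sup>2) \<partial>lborel)
        + (\<integral>\<^sup>+ x. ennreal (\<bar>u x\<bar> powr q) * indicator {x. T < \<bar>u x\<bar>} x \<partial>lborel)"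
      using T q by (intro nn_integral_powr_le_tail) auto
    also have "\<dots> \<le> ennreal (T powr (q - 2)) * ennreal R + ennreal 1"
      using u tail[OF u] by (intro add_mono mult_left_mono) (auto simp: sobolev_ball_def)
    also have "\<dots> = ennreal C"
      unfolding C_def using R by (subst ennreal_plus) (auto simp: ennreal_mult)
    finally show ?thesis
      using integral_le_of_nn_integral_le[of "\<lambda>x. \<bar>u x\<bar> powr q" lborel C] C by simp
  qed
  then show ?thesis using that[OF C] by blast
qed

definition cutoff :: "real \<Rightarrow> real \<Rightarrow> real" where
  "cutoff T t = max (- T) (min T t)"

lemma cutoff_cont: "continuous_on UNIV (cutoff T)"
  unfolding cutoff_def[abs_def] by (intro continuous_intros)

lemma cutoff_eq: "\<bar>t\<bar> \<le> T \<Longrightarrow> cutoff T t = t"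
  by (auto simp: cutoff_def)

lemma abs_cutoff_le: "0 \<le> T \<Longrightarrow> \<bar>cutoff T t\<bar> \<le> T" "0 \<le> T \<Longrightarrow> \<bar>cutoff T t\<bar> \<le> \<bar>t\<bar>"
  by (auto simp: cutoff_def)

lemma growth_minus_cutoff_le:
  assumes growth: "\<And>t. \<bar>h t\<bar> \<le> C * (1 + \<bar>t\<bar> powr q)" and q: "0 \<le> q" and T: "1 \<le> T" "T < \<bar>t\<bar>"
  shows "\<bar>h t - h (cutoff T t)\<bar> \<le> 4 * C * \<bar>t\<bar> powr q"
proof -
  have C: "0 \<le> C" using growth[of 0] by auto
  have bound: "\<bar>h y\<bar> \<le> C * (2 * \<bar>t\<bar> powr q)" if "\<bar>y\<bar> \<le> \<bar>t\<bar>" for y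
  proof -
    have "\<bar>y\<bar> powr q \<le> \<bar>t\<bar> powr q" "1 \<le> \<bar>t\<bar> powr q"
      using that q T by (auto intro: powr_mono2 ge_one_powr_ge_zero)
    then show ?thesis using C by (intro order_trans[OF growth] mult_left_mono) auto
  qed
  have "\<bar>h t - h (cutoff T t)\<bar> \<le> C * (2 * \<bar>t\<bar> powr q) + C * (2 * \<bar>t\<bar> powr q)"
    using bound[of t] bound[of "cutoff T t"] abs_cutoff_le(2)[of T t] T by linarith
  then show ?thesis by (simp add: algebra_simps)
qed

lemma integrable_indicator_cutoff:
  assumes B [measurable]: "B \<in> sets M" "emeasure M B < \<infinity>" and cont: "continuous_on UNIV h"
    and T: "0 \<le> T"
    and growth: "\<And>t. \<bar>h t\<bar> \<le> C * (1 + \<bar>t\<bar> powr q)" and q: "0 \<le> q"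
    and [measurable]: "u \<in> borel_measurable M"
  shows "integrable M (\<lambda>x. indicator B x * h (cutoff T (u x)))"
    and "\<bar>indicator B x * h (cutoff T (u x))\<bar> \<le> C * (1 + T powr q) * indicator B x"
proof -
  note [measurable] =
    borel_measurable_continuous_onI[OF cont] borel_measurable_continuous_onI[OF cutoff_cont]
  have C: "0 \<le> C" using growth[of 0] by auto
  have bound: "\<bar>indicator B x * h (cutoff T (u x))\<bar> \<le> C * (1 + T powr q) * indicator B x" for x
  proof -
    have "\<bar>h (cutoff T (u x))\<bar> \<le> C * (1 + T powr q)"
      using abs_cutoff_le(1)[OF T] C q
      by (intro order_trans[OF growth] mult_left_mono add_left_mono powr_mono2) auto
    then show ?thesis by (simp add: indicator_def)
  qed
  then show "\<bar>indicator B x * h (cutoff T (u x))\<bar> \<le> C * (1 + T powr q) * indicator B x" .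
  show "integrable M (\<lambda>x. indicator B x * h (cutoff T (u x)))"
    by (rule Bochner_Integration.integrable_bound[of _ "\<lambda>x. C * (1 + T powr q) * indicator B x"])
      (use B bound C in \<open>auto simp: integrable_indicator_iff\<close>)
qed

lemma integral_cutoff_error:
  assumes B [measurable]: "B \<in> sets M" "emeasure M B < \<infinity>" and cont: "continuous_on UNIV h"
    and T: "1 \<le> T"
    and growth: "\<And>t. \<bar>h t\<bar> \<le> C * (1 + \<bar>t\<bar> powr q)" and q: "0 \<le> q"
    and [measurable]: "u \<in> borel_measurable M"
    and tail: "(\<integral>\<^sup>+ x. ennreal (\<bar>u x\<bar> powr q) * indicator {x. T < \<bar>u x\<bar>} x \<partial>M) \<le> ennreal e"
    and e: "0 \<le> e"
  shows "\<bar>(\<integral>x. indicator B x * h (u x) \<partial>M) - (\<integral>x. indicator B x * h (cutoff T (u x)) \<partial>M)\<bar>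
      \<le> 4 * C * e"
proof -
  note [measurable] =
    borel_measurable_continuous_onI[OF cont] borel_measurable_continuous_onI[OF cutoff_cont]
  define tail_part where "tail_part x = \<bar>u x\<bar> powr q * indicator {x. T < \<bar>u x\<bar>} x" for x
  define diff where "diff x = indicator B x * h (u x) - indicator B x * h (cutoff T (u x))" for x
  have C: "0 \<le> C" using growth[of 0] by auto
  have [measurable]: "tail_part \<in> borel_measurable M" unfolding tail_part_def by measurable
  have "(\<integral>\<^sup>+ x. ennreal (tail_part x) \<partial>M) \<le> ennreal e"
    using tail by (simp add: tail_part_def ennreal_mult' ennreal_indicator)
  then have tail_integral: "integrable M tail_part" "(\<integral>x. tail_part x \<partial>M) \<le> e"
    using integral_le_of_nn_integral_le[of tail_part M e] e by (auto simp: tail_part_def)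
  have diff_le: "norm (diff x) \<le> 4 * C * tail_part x" for x
    using growth_minus_cutoff_le[OF growth q T, of "u x"] C
    by (cases "T < \<bar>u x\<bar>") (auto simp: diff_def tail_part_def indicator_def cutoff_eq)
  have diff: "integrable M diff"
  proof (rule Bochner_Integration.integrable_bound)
    show "integrable M (\<lambda>x. 4 * C * tail_part x)" using tail_integral by simp
    show "AE x in M. norm (diff x) \<le> norm (4 * C * tail_part x)"
      using diff_le by (intro AE_I2) (metis abs_ge_self order_trans real_norm_def)
  qed (unfold diff_def, measurable)
  have "(\<integral>x. indicator B x * h (u x) \<partial>M) - (\<integral>x. indicator B x * h (cutoff T (u x)) \<partial>M)
      = (\<integral>x. diff x \<partial>M)"
  proof -
    have cut: "integrable M (\<lambda>x. indicator B x * h (cutoff T (u x)))"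
      using T by (intro integrable_indicator_cutoff[OF B cont _ growth q]) auto
    have "(\<integral>x. indicator B x * h (u x) \<partial>M) = (\<integral>x. diff x + indicator B x * h (cutoff T (u x)) \<partial>M)"
      by (simp add: diff_def)
    also have "\<dots> = (\<integral>x. diff x \<partial>M) + (\<integral>x. indicator B x * h (cutoff T (u x)) \<partial>M)"
      using diff cut by (rule Bochner_Integration.integral_add)
    finally show ?thesis by simp
  qed
  moreover have "norm (\<integral>x. diff x \<partial>M) \<le> (\<integral>x. 4 * C * tail_part x \<partial>M)"
    using tail_integral diff diff_le
    by (intro order_trans[OF integral_norm_bound] Bochner_Integration.integral_mono) auto
  moreover have "(\<integral>x. 4 * C * tail_part x \<partial>M) \<le> 4 * C * e"
    using tail_integral C by (simp add: mult_left_mono)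
  ultimately show ?thesis by simp
qed

lemma LIMSEQ_uniform_approximation:
  fixes x :: "nat \<Rightarrow> 'a::metric_space"
  assumes "\<And>e. 0 < e \<Longrightarrow> \<exists>y l. y \<longlonglongrightarrow> l \<and> (\<forall>n. dist (x n) (y n) \<le> e) \<and> dist l a \<le> e"
  shows "x \<longlonglongrightarrow> a"
proof (rule metric_LIMSEQ_I)
  fix e :: real assume "0 < e"
  then have e: "0 < e / 4" by simp
  obtain y l where y: "y \<longlonglongrightarrow> l" "\<And>n. dist (x n) (y n) \<le> e / 4" "dist l a \<le> e / 4"
    using assms[OF e] by blast
  obtain N where N: "\<And>n. N \<le> n \<Longrightarrow> dist (y n) l < e / 4" using metric_LIMSEQ_D[OF y(1) e] by blast
  have "dist (x n) a < e" if "N \<le> n" for n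
    using y(2)[of n] N[OF that] y(3) dist_triangle[of "x n" a l] dist_triangle[of "x n" l "y n"] e
    by linarith
  then show "\<exists>N. \<forall>n\<ge>N. dist (x n) a < e" by blast
qed

lemma integral_cutoff_tendsto:
  fixes h :: "real \<Rightarrow> real"
  assumes B [measurable]: "B \<in> sets M" "emeasure M B < \<infinity>" and cont: "continuous_on UNIV h"
    and T: "0 \<le> T" and growth: "\<And>t. \<bar>h t\<bar> \<le> C * (1 + \<bar>t\<bar> powr q)" and q: "0 \<le> q"
    and [measurable]: "\<And>n. v n \<in> borel_measurable M" "w \<in> borel_measurable M"
    and conv: "AE x in M. (\<lambda>n. v n x) \<longlonglongrightarrow> w x"
  shows "(\<lambda>n. \<integral>x. indicator B x * h (cutoff T (v n x)) \<partial>M)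
    \<longlonglongrightarrow> (\<integral>x. indicator B x * h (cutoff T (w x)) \<partial>M)"
proof (rule integral_dominated_convergence[where w = "\<lambda>x. C * (1 + T powr q) * indicator B x"])
  note [measurable] =
    borel_measurable_continuous_onI[OF cont] borel_measurable_continuous_onI[OF cutoff_cont]
  show "(\<lambda>x. indicator B x * h (cutoff T (v n x))) \<in> borel_measurable M" for n by measurable
  show "(\<lambda>x. indicator B x * h (cutoff T (w x))) \<in> borel_measurable M" by measurable
  show "integrable M (\<lambda>x. C * (1 + T powr q) * indicator B x)"
    using B by (simp add: integrable_indicator_iff)
  show "AE x in M. norm (indicator B x * h (cutoff T (v n x)))
      \<le> C * (1 + T powr q) * indicator B x" for n
    using integrable_indicator_cutoff(2)[OF B cont T growth q] by (intro AE_I2) auto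
  have "continuous_on UNIV (\<lambda>t. h (cutoff T t))"
    using continuous_on_compose2[OF cont cutoff_cont] by auto
  then have isCont: "isCont (\<lambda>t. h (cutoff T t)) t" for t
    by (simp add: continuous_on_eq_continuous_at)
  show "AE x in M. (\<lambda>n. indicator B x * h (cutoff T (v n x)))
      \<longlonglongrightarrow> indicator B x * h (cutoff T (w x))"
    using conv by eventually_elim (intro tendsto_mult_left isCont_tendsto_compose[OF isCont])
qed

lemma uniform_tails_integral_tendsto:
  fixes h :: "real \<Rightarrow> real"
  assumes B [measurable]: "B \<in> sets M" "emeasure M B < \<infinity>" and cont: "continuous_on UNIV h"
    and growth: "\<And>t. \<bar>h t\<bar> \<le> C * (1 + \<bar>t\<bar> powr q)" and q: "0 \<le> q"
    and U: "uniform_tails M q U" "U \<subseteq> borel_measurable M" "\<And>n. v n \<in> U" "w \<in> U"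
    and conv: "AE x in M. (\<lambda>n. v n x) \<longlonglongrightarrow> w x"
  shows "(\<lambda>n. \<integral>x. indicator B x * h (v n x) \<partial>M) \<longlonglongrightarrow> (\<integral>x. indicator B x * h (w x) \<partial>M)"
proof (rule LIMSEQ_uniform_approximation)
  fix e :: real assume e: "0 < e"
  have C: "0 \<le> C" using growth[of 0] by auto
  define \<delta> where "\<delta> = e / (4 * (C + 1))"
  have \<delta>: "0 < \<delta>" "4 * C * \<delta> \<le> e" using e C by (auto simp: \<delta>_def field_simps)
  obtain T where T: "1 \<le> T" and tail: "\<And>u. u \<in> U \<Longrightarrow>
      (\<integral>\<^sup>+ x. ennreal (\<bar>u x\<bar> powr q) * indicator {x. T < \<bar>u x\<bar>} x \<partial>M) \<le> ennreal \<delta>"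
    using uniform_tailsE[OF U(1) \<delta>(1)] by blast
  define I where "I u = (\<integral>x. indicator B x * h (u x) \<partial>M)" for u
  define I_cut where "I_cut u = (\<integral>x. indicator B x * h (cutoff T (u x)) \<partial>M)" for u
  have error: "dist (I u) (I_cut u) \<le> e" if "u \<in> U" for u
  proof -
    have [measurable]: "u \<in> borel_measurable M" using that U(2) by blast
    have "\<bar>I u - I_cut u\<bar> \<le> 4 * C * \<delta>"
      unfolding I_def I_cut_def using tail[OF that] \<delta>
      by (intro integral_cutoff_error[OF B cont T growth q]) auto
    then show ?thesis using \<delta>(2) by (simp add: dist_real_def)
  qed
  have "(\<lambda>n. I_cut (v n)) \<longlonglongrightarrow> I_cut w"
    unfolding I_cut_def using T U by (intro integral_cutoff_tendsto[OF B cont _ growth q _ _ conv]) auto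
  then show "\<exists>y l. y \<longlonglongrightarrow> l \<and> (\<forall>n. dist (\<integral>x. indicator B x * h (v n x) \<partial>M) (y n) \<le> e) \<and>
      dist l (\<integral>x. indicator B x * h (w x) \<partial>M) \<le> e"
    using error U
    by (intro exI[of _ "\<lambda>n. I_cut (v n)"] exI[of _ "I_cut w"]) (auto simp: I_def dist_commute)
qed

section \<open>Compactness\<close>

definition cell :: "nat \<Rightarrow> 'a::euclidean_space \<Rightarrow> 'a set" where
  "cell k x = {y. \<forall>b\<in>Basis. \<lfloor>real (Suc k) * (y \<bullet> b)\<rfloor> = \<lfloor>real (Suc k) * (x \<bullet> b)\<rfloor>}"

definition cell_mean :: "nat \<Rightarrow> ('a::euclidean_space \<Rightarrow> real) \<Rightarrow> 'a \<Rightarrow> real" where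
  "cell_mean k u x = real (Suc k) ^ DIM('a) * (LBINT y. indicator (cell k x) y * u y)"

lemma cell_measurable [measurable]: "cell k x \<in> sets borel"
proof -
  have "{y \<in> space borel. \<forall>b\<in>Basis. \<lfloor>real (Suc k) * (y \<bullet> b)\<rfloor> = \<lfloor>real (Suc k) * (x \<bullet> b)\<rfloor>} \<in> sets borel"
    by measurable
  then show ?thesis by (simp add: cell_def)
qed

lemma cell_pair_measurable [measurable]:
  "{z :: 'a::euclidean_space \<times> 'a. snd z \<in> cell k (fst z)} \<in> sets (borel \<Otimes>\<^sub>M borel)"
proof -
  have "{z \<in> space (borel \<Otimes>\<^sub>M borel). \<forall>b\<in>Basis.
      \<lfloor>real (Suc k) * ((snd z :: 'a) \<bullet> b)\<rfloor> = \<lfloor>real (Suc k) * ((fst z :: 'a) \<bullet> b)\<rfloor>}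
      \<in> sets (borel \<Otimes>\<^sub>M borel)"
    by measurable
  then show ?thesis by (simp add: cell_def space_pair_measure)
qed

lemma emeasure_cell:
  fixes x :: "'a::euclidean_space"
  shows "emeasure lborel (cell k x) = ennreal (1 / real (Suc k) ^ DIM('a))"
proof -
  define r where "r = 1 / real (Suc k)"
  define l :: 'a where "l = (\<Sum>b\<in>Basis. (r * of_int \<lfloor>real (Suc k) * (x \<bullet> b)\<rfloor>) *\<^sub>R b)"
  define h :: 'a where "h = l + (\<Sum>b\<in>Basis. r *\<^sub>R b)"
  have "0 < r" by (simp add: r_def)
  have floor_eq: "\<lfloor>real (Suc k) * t\<rfloor> = n \<longleftrightarrow> r * of_int n \<le> t \<and> t < r * of_int n + r" for t n
    unfolding floor_eq_iff by (simp add: r_def field_simps)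
  have corners: "l \<bullet> b = r * of_int \<lfloor>real (Suc k) * (x \<bullet> b)\<rfloor>"
      "h \<bullet> b = l \<bullet> b + r" if "b \<in> Basis" for b
    using that by (simp_all add: l_def h_def inner_add_left)
  have cell_eq: "y \<in> cell k x \<longleftrightarrow> (\<forall>b\<in>Basis. l \<bullet> b \<le> y \<bullet> b \<and> y \<bullet> b < h \<bullet> b)" for y
    unfolding cell_def mem_Collect_eq floor_eq by (simp add: corners)
  have "(\<Prod>b\<in>Basis. (h - l) \<bullet> b) = (\<Prod>b\<in>(Basis :: 'a set). r)"
    by (intro prod.cong) (auto simp: corners inner_diff_left)
  then have volume: "(\<Prod>b\<in>Basis. (h - l) \<bullet> b) = r ^ DIM('a)" by simp
  have "\<forall>b\<in>Basis. l \<bullet> b \<le> h \<bullet> b" using \<open>0 < r\<close> by (simp add: corners)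
  then have "emeasure lborel (cbox l h) = ennreal (r ^ DIM('a))"
      "emeasure lborel (box l h) = ennreal (r ^ DIM('a))"
    by (simp_all add: emeasure_lborel_cbox_eq emeasure_lborel_box_eq volume)
  moreover have "emeasure lborel (cell k x) \<le> emeasure lborel (cbox l h)"
    by (rule emeasure_mono) (auto simp: mem_box cell_eq less_imp_le)
  moreover have "emeasure lborel (box l h) \<le> emeasure lborel (cell k x)"
    by (rule emeasure_mono) (auto simp: mem_box cell_eq less_imp_le)
  ultimately have "emeasure lborel (cell k x) = ennreal (r ^ DIM('a))" by simp
  then show ?thesis by (simp add: r_def power_divide)
qed

lemma integrable_indicator_cell:
  "integrable lborel (indicator (cell k x) :: 'a::euclidean_space \<Rightarrow> real)"
  by (simp add: integrable_indicator_iff emeasure_cell)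

lemma measure_cell_le_1: "measure lborel (cell k (x :: 'a::euclidean_space)) \<le> 1"
proof -
  have "1 \<le> real (Suc k) ^ DIM('a)" by (intro one_le_power) simp
  then show ?thesis by (simp add: measure_def emeasure_cell)
qed

lemma norm_diff_cell_le:
  fixes x y :: "'a::euclidean_space"
  assumes "y \<in> cell k x"
  shows "norm (x - y) \<le> real DIM('a) / real (Suc k)"
proof -
  have "\<bar>(x - y) \<bullet> b\<bar> \<le> 1 / real (Suc k)" if "b \<in> Basis" for b
  proof -
    have "\<lfloor>real (Suc k) * (y \<bullet> b)\<rfloor> = \<lfloor>real (Suc k) * (x \<bullet> b)\<rfloor>"
      using assms that by (auto simp: cell_def)
    then have "\<bar>real (Suc k) * (x \<bullet> b) - real (Suc k) * (y \<bullet> b)\<bar> < 1" by linarith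
    also have "real (Suc k) * (x \<bullet> b) - real (Suc k) * (y \<bullet> b) = real (Suc k) * ((x - y) \<bullet> b)"
      by (simp add: algebra_simps)
    finally have "real (Suc k) * \<bar>(x - y) \<bullet> b\<bar> \<le> 1" unfolding abs_mult by simp
    then show ?thesis by (simp add: pos_le_divide_eq mult.commute del: of_nat_Suc)
  qed
  then have "norm (x - y) \<le> (\<Sum>b\<in>(Basis :: 'a set). 1 / real (Suc k))"
    by (intro order_trans[OF norm_le_l1] sum_mono)
  then show ?thesis by simp
qed

lemma countable_cells: "countable (range (\<lambda>(k, x). cell k (x :: 'a::euclidean_space)))"
proof (rule countable_subset)
  let ?grid = "UNIV \<times> (PiE (Basis :: 'a set) (\<lambda>_. UNIV :: int set))"
  let ?cube = "\<lambda>(k, n). {y :: 'a. \<forall>b\<in>Basis. \<lfloor>real (Suc k) * (y \<bullet> b)\<rfloor> = n b}"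
  have "cell k x \<in> ?cube ` ?grid" for k and x :: 'a
    by (rule image_eqI[of _ _ "(k, \<lambda>b\<in>Basis. \<lfloor>real (Suc k) * (x \<bullet> b)\<rfloor>)"]) (auto simp: cell_def)
  then show "range (\<lambda>(k, x). cell k x) \<subseteq> ?cube ` ?grid" by auto
  show "countable (?cube ` ?grid)" by (intro countable_image countable_SIGMA countable_PiE) auto
qed

lemma sobolev_ball_square_integral:
  assumes "u \<in> sobolev_ball s R" "0 \<le> R"
  shows "integrable lborel (\<lambda>x. (u x)\<^sup>2)" "(LBINT x. (u x)\<^sup>2) \<le> R"
proof -
  have "(\<lambda>x. (u x)\<^sup>2) \<in> borel_measurable lborel" using sobolev_ball_measurable[OF assms(1)] by simp
  moreover have "(\<integral>\<^sup>+ x. ennreal ((u x)\<^sup>2) \<partial>lborel) \<le> ennreal R"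
    using assms(1) by (simp add: sobolev_ball_def)
  ultimately show "integrable lborel (\<lambda>x. (u x)\<^sup>2)" "(LBINT x. (u x)\<^sup>2) \<le> R"
    using assms(2) by (rule integral_le_of_nn_integral_le[OF _ zero_le_power2])+
qed

lemma abs_le_one_plus_square: "\<bar>t\<bar> \<le> 1 + t\<^sup>2" for t :: real
proof -
  have "2 * \<bar>t\<bar> \<le> t\<^sup>2 + 1" using sum_squares_bound[of "\<bar>t\<bar>" 1] by simp
  then show ?thesis by linarith
qed

lemma integrable_mult_square_integrable:
  fixes w u :: "'a \<Rightarrow> real"
  assumes w: "integrable M w" "\<And>x. 0 \<le> w x" "\<And>x. w x \<le> 1"
    and [measurable]: "u \<in> borel_measurable M" and u: "integrable M (\<lambda>x. (u x)\<^sup>2)"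
  shows "integrable M (\<lambda>x. w x * u x)" "\<bar>\<integral>x. w x * u x \<partial>M\<bar> \<le> (\<integral>x. w x \<partial>M) + (\<integral>x. (u x)\<^sup>2 \<partial>M)"
proof -
  have bound: "\<bar>w x * u x\<bar> \<le> w x + (u x)\<^sup>2" for x
  proof -
    have "\<bar>w x * u x\<bar> \<le> w x * (1 + (u x)\<^sup>2)"
      using w(2) abs_le_one_plus_square[of "u x"] by (simp add: abs_mult mult_left_mono)
    also have "\<dots> \<le> w x + (u x)\<^sup>2"
      using w(3)[of x] mult_right_mono[of "w x" 1 "(u x)\<^sup>2"] by (simp add: algebra_simps)
    finally show ?thesis .
  qed
  have sum: "integrable M (\<lambda>x. w x + (u x)\<^sup>2)" using w u by auto
  show int: "integrable M (\<lambda>x. w x * u x)"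
  proof (rule Bochner_Integration.integrable_bound[OF sum])
    show "AE x in M. norm (w x * u x) \<le> norm (w x + (u x)\<^sup>2)"
      using bound by (intro AE_I2) (metis abs_ge_self order_trans real_norm_def)
  qed (use w in measurable)
  have "norm (\<integral>x. w x * u x \<partial>M) \<le> (\<integral>x. w x + (u x)\<^sup>2 \<partial>M)"
    using int sum bound
    by (intro order_trans[OF integral_norm_bound] Bochner_Integration.integral_mono) auto
  then show "\<bar>\<integral>x. w x * u x \<partial>M\<bar> \<le> (\<integral>x. w x \<partial>M) + (\<integral>x. (u x)\<^sup>2 \<partial>M)" using w u by simp
qed

lemma cell_integral:
  assumes u: "u \<in> sobolev_ball s R" and R: "0 \<le> R"
  shows "integrable lborel (\<lambda>y. indicator (cell k x) y * u y)"
    and "\<bar>LBINT y. indicator (cell k x) y * u y\<bar> \<le> 1 + R"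
proof -
  note bounds = integrable_mult_square_integrable
    [OF integrable_indicator_cell _ _ _ sobolev_ball_square_integral(1)[OF u R], of k x]
  show "integrable lborel (\<lambda>y. indicator (cell k x) y * u y)"
    using sobolev_ball_measurable[OF u] by (intro bounds) auto
  have "\<bar>LBINT y. indicator (cell k x) y * u y\<bar>
      \<le> (LBINT y. indicator (cell k x) y) + (LBINT y. (u y)\<^sup>2)"
    using sobolev_ball_measurable[OF u] by (intro bounds) auto
  then show "\<bar>LBINT y. indicator (cell k x) y * u y\<bar> \<le> 1 + R"
    using measure_cell_le_1[of k x] sobolev_ball_square_integral(2)[OF u R] by simp
qed

lemma abs_cell_mean_le:
  assumes "u \<in> sobolev_ball s R" "0 \<le> R"
  shows "\<bar>cell_mean k u (x :: 'a::euclidean_space)\<bar> \<le> real (Suc k) ^ DIM('a) * (1 + R)"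
  using cell_integral(2)[OF assms] by (simp add: cell_mean_def abs_mult mult_left_mono)

lemma cell_mean_measurable [measurable]:
  assumes [measurable]: "u \<in> borel_measurable borel"
  shows "cell_mean k u \<in> borel_measurable borel"
proof -
  have "(\<lambda>z. indicator {z. snd z \<in> cell k (fst z)} z * u (snd z)) \<in> borel_measurable (borel \<Otimes>\<^sub>M borel)"
    by measurable
  then have "(\<lambda>(x, y). indicator (cell k x) y * u y) \<in> borel_measurable (borel \<Otimes>\<^sub>M lborel)"
    by (auto simp: indicator_def case_prod_beta cong: measurable_cong_sets)
  then have "(\<lambda>x. LBINT y. indicator (cell k x) y * u y) \<in> borel_measurable borel"
    by (rule lborel.borel_measurable_lebesgue_integral)
  then show ?thesis unfolding cell_mean_def[abs_def] by measurable
qed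

text \<open>Young's inequality in place of Cauchy-Schwarz keeps the following estimates in \<open>L\<^sup>1\<close>.\<close>

lemma abs_diff_le_frac_kernel:
  fixes u :: "'a::euclidean_space \<Rightarrow> real"
  assumes "norm (x - y) \<le> \<rho>" and \<eta>: "0 < \<eta>" and s: "0 \<le> s"
  shows "\<bar>u x - u y\<bar> \<le> \<eta> + \<rho> powr (real DIM('a) + 2 * s) / \<eta> * (frac_kernel s (x, y) * (u x - u y)\<^sup>2)"
proof (cases "x = y")
  case False
  let ?p = "real DIM('a) + 2 * s"
  have "0 < \<rho>" using False assms(1) by (meson less_le_trans zero_less_norm_iff right_minus_eq)
  have "1 = \<rho> powr ?p * \<rho> powr (- ?p)" using \<open>0 < \<rho>\<close> by (simp flip: powr_add)
  also have "\<dots> \<le> \<rho> powr ?p * frac_kernel s (x, y)"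
    using False assms by (intro mult_left_mono frac_kernel_ge) auto
  finally have "(u x - u y)\<^sup>2 / \<eta> * 1 \<le> (u x - u y)\<^sup>2 / \<eta> * (\<rho> powr ?p * frac_kernel s (x, y))"
    using \<eta> by (intro mult_left_mono) auto
  moreover have "\<bar>u x - u y\<bar> \<le> \<eta> + (u x - u y)\<^sup>2 / \<eta>"
  proof -
    have "2 * \<eta> * \<bar>u x - u y\<bar> \<le> \<eta>\<^sup>2 + (u x - u y)\<^sup>2"
      using sum_squares_bound[of \<eta> "\<bar>u x - u y\<bar>"] by simp
    then have "2 * \<bar>u x - u y\<bar> \<le> \<eta> + (u x - u y)\<^sup>2 / \<eta>"
      using \<eta> by (simp add: field_simps power2_eq_square)
    moreover have "\<bar>u x - u y\<bar> \<le> 2 * \<bar>u x - u y\<bar>" by simp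
    ultimately show ?thesis by (rule order_trans[rotated])
  qed
  ultimately show ?thesis by (simp add: mult_ac)
qed (use \<eta> in simp)

lemma abs_diff_cell_mean_le:
  fixes u :: "'a::euclidean_space \<Rightarrow> real"
  assumes u: "u \<in> sobolev_ball s R" and R: "0 \<le> R"
  shows "ennreal \<bar>u x - cell_mean k u x\<bar> \<le> ennreal (real (Suc k) ^ DIM('a)) *
    (\<integral>\<^sup>+ y. ennreal \<bar>u x - u y\<bar> * indicator (cell k x) y \<partial>lborel)"
proof -
  define n where "n = real (Suc k) ^ DIM('a)"
  have n: "0 < n" by (simp add: n_def)
  let ?jump = "\<lambda>y. indicator (cell k x) y * u x - indicator (cell k x) y * u y"
  have const_integral: "integrable lborel (\<lambda>y. indicator (cell k x) y * u x)"
      "n * (LBINT y. indicator (cell k x) y * u x) = u x"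
    using integrable_indicator_cell[of k x] by (simp_all add: n_def measure_def emeasure_cell)
  have jump_integrable: "integrable lborel ?jump"
    using const_integral(1) cell_integral(1)[OF u R] by simp
  have "u x - cell_mean k u x = n * (LBINT y. ?jump y)"
    using const_integral cell_integral(1)[OF u R]
    by (simp add: cell_mean_def n_def right_diff_distrib)
  then have "ennreal \<bar>u x - cell_mean k u x\<bar> = ennreal n * ennreal (norm (LBINT y. ?jump y))"
    using n by (simp add: abs_mult ennreal_mult)
  also have "\<dots> \<le> ennreal n * (\<integral>\<^sup>+ y. ennreal (norm (?jump y)) \<partial>lborel)"
    using jump_integrable by (intro mult_left_mono integral_norm_bound_ennreal) auto
  also have "(\<integral>\<^sup>+ y. ennreal (norm (?jump y)) \<partial>lborel)
      = (\<integral>\<^sup>+ y. ennreal \<bar>u x - u y\<bar> * indicator (cell k x) y \<partial>lborel)"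
    by (intro nn_integral_cong) (auto simp: indicator_def)
  finally show ?thesis by (simp add: n_def)
qed

lemma ennreal_abs_diff_le_frac_kernel:
  fixes u :: "'a::euclidean_space \<Rightarrow> real"
  assumes "norm (x - y) \<le> \<rho>" and \<eta>: "0 < \<eta>" and "0 \<le> s"
  shows "ennreal \<bar>u x - u y\<bar> \<le> ennreal \<eta>
    + ennreal (\<rho> powr (real DIM('a) + 2 * s) / \<eta>) * ennreal (frac_kernel s (x, y) * (u x - u y)\<^sup>2)"
proof -
  define c where "c = \<rho> powr (real DIM('a) + 2 * s) / \<eta>"
  have c: "0 \<le> c" using \<eta> by (simp add: c_def)
  have "ennreal \<bar>u x - u y\<bar> \<le> ennreal (\<eta> + c * (frac_kernel s (x, y) * (u x - u y)\<^sup>2))"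
    unfolding c_def by (intro ennreal_leI abs_diff_le_frac_kernel assms)
  also have "\<dots> = ennreal \<eta> + ennreal c * ennreal (frac_kernel s (x, y) * (u x - u y)\<^sup>2)"
    using \<eta> c frac_kernel_nonneg[of s "(x, y)"] by (subst ennreal_plus) (auto simp: ennreal_mult)
  finally show ?thesis by (simp add: c_def)
qed

lemma cell_mean_error:
  fixes u :: "'a::euclidean_space \<Rightarrow> real"
  assumes u: "u \<in> sobolev_ball s R" and R: "0 \<le> R" and s: "0 \<le> s" and \<eta>: "0 < \<eta>"
  shows "ennreal \<bar>u x - cell_mean k u x\<bar>
    \<le> ennreal \<eta> + ennreal (real DIM('a) powr (real DIM('a) + 2 * s) *
        (1 / real (Suc k)) powr (2 * s) / \<eta>) *
      (\<integral>\<^sup>+ y. ennreal (frac_kernel s (x, y) * (u x - u y)\<^sup>2) \<partial>lborel)"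
proof -
  have [measurable]: "u \<in> borel_measurable borel" by (rule sobolev_ball_measurable[OF u])
  define d where "d = real DIM('a)"
  define n where "n = real (Suc k) ^ DIM('a)"
  define c where "c = (d / real (Suc k)) powr (d + 2 * s) / \<eta>"
  have n: "0 < n" and c: "0 \<le> c" using \<eta> by (auto simp: n_def c_def)
  have n_powr: "n = (1 / real (Suc k)) powr (- d)"
    by (simp add: n_def d_def powr_minus powr_divide powr_realpow flip: of_nat_Suc)
  have const: "n * c = d powr (d + 2 * s) * (1 / real (Suc k)) powr (2 * s) / \<eta>"
  proof -
    have "(d / real (Suc k)) powr (d + 2 * s)
        = d powr (d + 2 * s) * (1 / real (Suc k)) powr (d + 2 * s)"
      using powr_mult[of d "1 / real (Suc k)" "d + 2 * s"] by (simp add: d_def)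
    moreover have "n * (1 / real (Suc k)) powr (d + 2 * s) = (1 / real (Suc k)) powr (2 * s)"
      unfolding n_powr by (simp flip: powr_add)
    ultimately show ?thesis by (simp add: c_def mult_ac)
  qed
  let ?kernel = "\<lambda>y. ennreal (frac_kernel s (x, y) * (u x - u y)\<^sup>2)"
  have jump: "ennreal \<bar>u x - u y\<bar> \<le> ennreal \<eta> + ennreal c * ?kernel y" if "y \<in> cell k x" for y
    unfolding c_def d_def by (intro ennreal_abs_diff_le_frac_kernel norm_diff_cell_le that \<eta> s)
  have "ennreal \<bar>u x - cell_mean k u x\<bar>
      \<le> ennreal n * (\<integral>\<^sup>+ y. ennreal \<bar>u x - u y\<bar> * indicator (cell k x) y \<partial>lborel)"
    unfolding n_def by (rule abs_diff_cell_mean_le[OF u R])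
  also have "\<dots>
      \<le> ennreal n * (\<integral>\<^sup>+ y. ennreal \<eta> * indicator (cell k x) y + ennreal c * ?kernel y \<partial>lborel)"
    using jump by (intro mult_left_mono nn_integral_mono) (auto simp: indicator_def)
  also have "\<dots> = ennreal \<eta> * (ennreal n * emeasure lborel (cell k x))
      + (ennreal n * ennreal c) * (\<integral>\<^sup>+ y. ?kernel y \<partial>lborel)"
    by (subst nn_integral_add)
       (auto simp: nn_integral_cmult_indicator nn_integral_cmult distrib_left mult_ac)
  also have "ennreal n * emeasure lborel (cell k x) = 1"
    by (simp add: n_def emeasure_cell flip: ennreal_mult)
  also have "ennreal n * ennreal c
      = ennreal (d powr (d + 2 * s) * (1 / real (Suc k)) powr (2 * s) / \<eta>)"
    using n c by (simp add: const flip: ennreal_mult)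
  finally show ?thesis by (simp add: d_def)
qed

lemma weighted_cell_mean_error:
  fixes w :: "'a::euclidean_space \<Rightarrow> real"
  assumes u: "u \<in> sobolev_ball s R" and R: "0 \<le> R" and s: "0 \<le> s" and \<eta>: "0 < \<eta>"
    and w: "integrable lborel w" "\<And>x. 0 \<le> w x" "\<And>x. w x \<le> 1"
  shows "(\<integral>\<^sup>+ x. ennreal (w x * \<bar>u x - cell_mean k u x\<bar>) \<partial>lborel) \<le> ennreal (\<eta> * (LBINT x. w x)
    + real DIM('a) powr (real DIM('a) + 2 * s) * (1 / real (Suc k)) powr (2 * s) / \<eta> * R)"
proof -
  have [measurable]: "u \<in> borel_measurable borel" "w \<in> borel_measurable borel"
    using sobolev_ball_measurable[OF u] borel_measurable_integrable[OF w(1)] by auto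
  define c where "c = real DIM('a) powr (real DIM('a) + 2 * s) * (1 / real (Suc k)) powr (2 * s) / \<eta>"
  have c: "0 \<le> c" using \<eta> by (simp add: c_def)
  let ?E = "\<lambda>x. \<integral>\<^sup>+ y. ennreal (frac_kernel s (x, y) * (u x - u y)\<^sup>2) \<partial>lborel"
  have "ennreal (w x * \<bar>u x - cell_mean k u x\<bar>)
      \<le> ennreal \<eta> * ennreal (w x) + ennreal c * ?E x" for x
  proof -
    have "ennreal (w x * \<bar>u x - cell_mean k u x\<bar>) \<le> ennreal (w x) * (ennreal \<eta> + ennreal c * ?E x)"
      using w cell_mean_error[OF u R s \<eta>, of x k] by (simp add: ennreal_mult c_def mult_left_mono)
    also have "\<dots> \<le> ennreal \<eta> * ennreal (w x) + 1 * (ennreal c * ?E x)"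
      unfolding distrib_left using w by (intro add_mono mult_right_mono) (auto simp: mult.commute)
    finally show ?thesis by simp
  qed
  then have "(\<integral>\<^sup>+ x. ennreal (w x * \<bar>u x - cell_mean k u x\<bar>) \<partial>lborel)
      \<le> (\<integral>\<^sup>+ x. ennreal \<eta> * ennreal (w x) + ennreal c * ?E x \<partial>lborel)"
    by (intro nn_integral_mono)
  also have "\<dots> = ennreal \<eta> * (\<integral>\<^sup>+ x. ennreal (w x) \<partial>lborel) + ennreal c * frac_energy s u"
    by (subst frac_energy_iterated, simp, subst nn_integral_add)
       (auto simp: nn_integral_cmult lborel.borel_measurable_nn_integral)
  also have "\<dots> \<le> ennreal \<eta> * ennreal (LBINT x. w x) + ennreal c * ennreal R"
    using u w
    by (intro add_mono mult_left_mono) (auto simp: sobolev_ball_def nn_integral_eq_integral)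
  also have "\<dots> = ennreal (\<eta> * (LBINT x. w x) + c * R)"
    using \<eta> c R w by (subst ennreal_plus) (auto simp: ennreal_mult intro!: integral_nonneg)
  finally show ?thesis by (simp add: c_def)
qed

lemma weighted_cell_mean_error_small:
  fixes w :: "'a::euclidean_space \<Rightarrow> real"
  assumes s: "0 < s" and R: "0 \<le> R" and e: "0 < e"
    and w: "integrable lborel w" "\<And>x. 0 \<le> w x" "\<And>x. w x \<le> 1"
  obtains k where "\<And>u. u \<in> sobolev_ball s R \<Longrightarrow> integrable lborel (\<lambda>x. w x * \<bar>u x - cell_mean k u x\<bar>)"
    "\<And>u. u \<in> sobolev_ball s R \<Longrightarrow> (LBINT x. w x * \<bar>u x - cell_mean k u x\<bar>) \<le> e"
proof -
  define W where "W = (LBINT x. w x)"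
  have W: "0 \<le> W" unfolding W_def using w by (intro Bochner_Integration.integral_nonneg) auto
  define \<eta> where "\<eta> = e / (2 * (W + 1))"
  have \<eta>: "0 < \<eta>" "\<eta> * W \<le> e / 2" using e W by (auto simp: \<eta>_def field_simps)
  let ?c = "\<lambda>k. real DIM('a) powr (real DIM('a) + 2 * s) * (1 / real (Suc k)) powr (2 * s) / \<eta> * R"
  have "?c \<longlonglongrightarrow> real DIM('a) powr (real DIM('a) + 2 * s) * 0 powr (2 * s) / \<eta> * R"
    using s \<eta>(1) LIMSEQ_inverse_real_of_nat
    by (intro tendsto_intros tendsto_powr2) (auto simp: inverse_eq_divide)
  then have "?c \<longlonglongrightarrow> 0" by simp
  then have "eventually (\<lambda>k. ?c k < e / 2) sequentially" using e by (intro order_tendstoD) auto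
  then obtain k where k: "?c k < e / 2" using eventually_happens'[OF sequentially_bot] by blast
  have "integrable lborel (\<lambda>x. w x * \<bar>u x - cell_mean k u x\<bar>)
      \<and> (LBINT x. w x * \<bar>u x - cell_mean k u x\<bar>) \<le> e"
    if u: "u \<in> sobolev_ball s R" for u
  proof -
    have [measurable]: "u \<in> borel_measurable borel" "w \<in> borel_measurable borel"
      using sobolev_ball_measurable[OF u] borel_measurable_integrable[OF w(1)] by auto
    have "(\<integral>\<^sup>+ x. ennreal (w x * \<bar>u x - cell_mean k u x\<bar>) \<partial>lborel) \<le> ennreal (\<eta> * W + ?c k)"
      using weighted_cell_mean_error[OF u R _ \<eta>(1) w] s by (simp add: W_def)
    also have "\<dots> \<le> ennreal e" using \<eta>(2) k by (intro ennreal_leI) linarith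
    finally show ?thesis
      using integral_le_of_nn_integral_le[of "\<lambda>x. w x * \<bar>u x - cell_mean k u x\<bar>" lborel e] w e
      by simp
  qed
  then show ?thesis using that by blast
qed

lemma cell_means_convergent_subsequence:
  fixes v :: "nat \<Rightarrow> 'a::euclidean_space \<Rightarrow> real"
  assumes v: "\<And>n. v n \<in> sobolev_ball s R" and R: "0 \<le> R"
  obtains \<rho> where "strict_mono (\<rho> :: nat \<Rightarrow> nat)" "\<And>k x. convergent (\<lambda>n. cell_mean k (v (\<rho> n)) x)"
proof -
  obtain \<rho> where \<rho>: "strict_mono \<rho>" and limit: "\<And>A. A \<in> range (\<lambda>(k, x). cell k x) \<Longrightarrow>
      \<exists>l. (\<lambda>n. LBINT y. indicator A y * v (\<rho> n) y) \<longlonglongrightarrow> l"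
  proof (rule function_convergent_subsequence[OF countable_cells,
        of "\<lambda>n A. LBINT y. indicator A y * v n y" "1 + R"])
    fix n A assume "A \<in> range (\<lambda>(k, x). cell k (x :: 'a))"
    then show "norm (LBINT y. indicator A y * v n y) \<le> 1 + R" using cell_integral(2)[OF v R] by auto
  qed blast
  have "convergent (\<lambda>n. cell_mean k (v (\<rho> n)) x)" for k x
    unfolding cell_mean_def using limit[of "cell k x"]
    by (intro convergent_mult convergent_const) (auto simp: convergent_def)
  then show ?thesis using that \<rho> by blast
qed

lemma weighted_cell_means_L1_limit:
  fixes u :: "nat \<Rightarrow> 'a::euclidean_space \<Rightarrow> real"
  assumes u: "\<And>n. u n \<in> sobolev_ball s R" and R: "0 \<le> R" and w: "integrable lborel w" "\<And>x. 0 \<le> w x"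
    and limit: "\<And>x. (\<lambda>n. cell_mean k (u n) x) \<longlonglongrightarrow> A x"
  shows "integrable lborel (\<lambda>x. w x * A x)"
    and "integrable lborel (\<lambda>x. w x * \<bar>cell_mean k (u n) x - A x\<bar>)"
    and "(\<lambda>n. LBINT x. w x * \<bar>cell_mean k (u n) x - A x\<bar>) \<longlonglongrightarrow> 0"
proof -
  have [measurable]: "u n \<in> borel_measurable borel" for n by (rule sobolev_ball_measurable[OF u])
  have [measurable]: "w \<in> borel_measurable borel" using borel_measurable_integrable[OF w(1)] by simp
  have [measurable]: "A \<in> borel_measurable borel"
    by (rule borel_measurable_LIMSEQ_metric[OF _ limit]) measurable
  define b where "b = real (Suc k) ^ DIM('a) * (1 + R)"
  have mean_le: "\<bar>cell_mean k (u n) x\<bar> \<le> b" for n x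
    using abs_cell_mean_le[OF u R] by (simp add: b_def)
  then have A_le: "\<bar>A x\<bar> \<le> b" for x
    using tendsto_upperbound[OF tendsto_rabs[OF limit] always_eventually] by simp
  have weighted_bound: "norm (w x * t) \<le> norm (2 * b * w x)" if "\<bar>t\<bar> \<le> 2 * b" for x t
    using that w(2)[of x] mult_left_mono[of "\<bar>t\<bar>" "2 * b" "w x"] by (simp add: abs_mult mult_ac)
  have diff_le: "\<bar>\<bar>cell_mean k (u n) x - A x\<bar>\<bar> \<le> 2 * b" for n x
    using mean_le[of n x] A_le[of x] by linarith
  have b: "0 \<le> b" using A_le abs_ge_zero order_trans by blast
  have dominating: "integrable lborel (\<lambda>x. 2 * b * w x)" using w by simp
  show "integrable lborel (\<lambda>x. w x * A x)"
  proof (rule Bochner_Integration.integrable_bound[OF dominating])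
    have "\<bar>A x\<bar> \<le> 2 * b" for x using A_le[of x] b by linarith
    then show "AE x in lborel. norm (w x * A x) \<le> norm (2 * b * w x)"
      by (intro AE_I2 weighted_bound)
  qed measurable
  show "integrable lborel (\<lambda>x. w x * \<bar>cell_mean k (u n) x - A x\<bar>)"
  proof (rule Bochner_Integration.integrable_bound[OF dominating])
    show "AE x in lborel. norm (w x * \<bar>cell_mean k (u n) x - A x\<bar>) \<le> norm (2 * b * w x)"
      by (intro AE_I2 weighted_bound diff_le)
  qed measurable
  have "(\<lambda>n. LBINT x. w x * \<bar>cell_mean k (u n) x - A x\<bar>) \<longlonglongrightarrow> (LBINT x. w x * \<bar>A x - A x\<bar>)"
  proof (rule integral_dominated_convergence[where w = "\<lambda>x. norm (2 * b * w x)"])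
    show "AE x in lborel. (\<lambda>n. w x * \<bar>cell_mean k (u n) x - A x\<bar>) \<longlonglongrightarrow> w x * \<bar>A x - A x\<bar>"
      by (intro AE_I2 tendsto_intros limit)
    show "AE x in lborel. norm (w x * \<bar>cell_mean k (u n) x - A x\<bar>) \<le> norm (2 * b * w x)" for n
      by (intro AE_I2 weighted_bound diff_le)
  qed (use dominating in auto)
  then show "(\<lambda>n. LBINT x. w x * \<bar>cell_mean k (u n) x - A x\<bar>) \<longlonglongrightarrow> 0" by simp
qed

lemma L1_Cauchy_if_near_limits:
  fixes f :: "nat \<Rightarrow> 'a \<Rightarrow> real"
  assumes f: "\<And>n. integrable M (f n)" and e: "0 < e"
    and near: "\<And>e. 0 < e \<Longrightarrow>
      \<exists>g. integrable M g \<and> (\<forall>\<^sub>F n in sequentially. (\<integral>x. norm (f n x - g x) \<partial>M) < e)"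
  shows "\<exists>N. \<forall>i\<ge>N. \<forall>j\<ge>N. (\<integral>x. norm (f i x - f j x) \<partial>M) < e"
proof -
  obtain g where g: "integrable M g" and "\<forall>\<^sub>F n in sequentially. (\<integral>x. norm (f n x - g x) \<partial>M) < e / 2"
    using near[of "e / 2"] e by auto
  then obtain N where N: "\<And>n. N \<le> n \<Longrightarrow> (\<integral>x. norm (f n x - g x) \<partial>M) < e / 2"
    by (auto simp: eventually_sequentially)
  have "(\<integral>x. norm (f i x - f j x) \<partial>M) < e" if "N \<le> i" "N \<le> j" for i j
  proof -
    have "(\<integral>x. norm (f i x - f j x) \<partial>M) \<le> (\<integral>x. norm (f i x - g x) + norm (f j x - g x) \<partial>M)"
      using f g norm_triangle_ineq4[of "f i x - g x" "f j x - g x" for x]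
      by (intro Bochner_Integration.integral_mono) auto
    also have "\<dots> = (\<integral>x. norm (f i x - g x) \<partial>M) + (\<integral>x. norm (f j x - g x) \<partial>M)" using f g by simp
    finally show ?thesis using N[OF that(1)] N[OF that(2)] by linarith
  qed
  then show ?thesis by blast
qed

lemma weighted_sobolev_ball_L1_Cauchy:
  fixes u :: "nat \<Rightarrow> 'a::euclidean_space \<Rightarrow> real"
  assumes s: "0 < s" and u: "\<And>n. u n \<in> sobolev_ball s R" and R: "0 \<le> R"
    and w: "integrable lborel w" "\<And>x. 0 \<le> w x" "\<And>x. w x \<le> 1"
    and means: "\<And>k x. convergent (\<lambda>n. cell_mean k (u n) x)" and e: "0 < e"
  shows "\<exists>N. \<forall>i\<ge>N. \<forall>j\<ge>N. (LBINT x. norm (w x * u i x - w x * u j x)) < e"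
proof (rule L1_Cauchy_if_near_limits[OF _ e])
  show weighted: "integrable lborel (\<lambda>x. w x * u n x)" for n
    using sobolev_ball_measurable[OF u] sobolev_ball_square_integral(1)[OF u R]
    by (intro integrable_mult_square_integrable(1) w) auto
  fix e :: real assume e: "0 < e"
  then have "0 < e / 2" by simp
  then obtain k where mean_error: "\<And>u. u \<in> sobolev_ball s R \<Longrightarrow>
      integrable lborel (\<lambda>x. w x * \<bar>u x - cell_mean k u x\<bar>)"
      "\<And>u. u \<in> sobolev_ball s R \<Longrightarrow> (LBINT x. w x * \<bar>u x - cell_mean k u x\<bar>) \<le> e / 2"
    using weighted_cell_mean_error_small[OF s R _ w, of "e / 2"] by metis
  define A where "A x = lim (\<lambda>n. cell_mean k (u n) x)" for x
  have "(\<lambda>n. cell_mean k (u n) x) \<longlonglongrightarrow> A x" for x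
    using means unfolding A_def by (simp add: convergent_LIMSEQ_iff)
  note mean_limit = weighted_cell_means_L1_limit[OF u R w(1,2) this]
  have distance_le: "(LBINT x. norm (w x * u n x - w x * A x))
      \<le> e / 2 + (LBINT x. w x * \<bar>cell_mean k (u n) x - A x\<bar>)" for n
  proof -
    have "(LBINT x. norm (w x * u n x - w x * A x))
        \<le> (LBINT x. w x * \<bar>u n x - cell_mean k (u n) x\<bar> + w x * \<bar>cell_mean k (u n) x - A x\<bar>)"
    proof (rule Bochner_Integration.integral_mono)
      fix x
      have "norm (w x * u n x - w x * A x) = w x * \<bar>u n x - A x\<bar>"
        using w(2)[of x] by (simp add: abs_mult flip: right_diff_distrib)
      also have "\<dots> \<le> w x * (\<bar>u n x - cell_mean k (u n) x\<bar> + \<bar>cell_mean k (u n) x - A x\<bar>)"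
        using w(2)[of x] by (intro mult_left_mono) auto
      finally show "norm (w x * u n x - w x * A x)
          \<le> w x * \<bar>u n x - cell_mean k (u n) x\<bar> + w x * \<bar>cell_mean k (u n) x - A x\<bar>"
        by (simp add: distrib_left)
    qed (use weighted mean_limit(1,2) mean_error(1)[OF u] in auto)
    also have "\<dots> \<le> e / 2 + (LBINT x. w x * \<bar>cell_mean k (u n) x - A x\<bar>)"
      using mean_limit(2)[of n] mean_error[OF u, of n] by simp
    finally show ?thesis .
  qed
  have "\<forall>\<^sub>F n in sequentially. (LBINT x. w x * \<bar>cell_mean k (u n) x - A x\<bar>) < e / 2"
    using mean_limit(3) e by (intro order_tendstoD) auto
  then have "\<forall>\<^sub>F n in sequentially. (LBINT x. norm (w x * u n x - w x * A x)) < e"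
    by eventually_elim (rule le_less_trans[OF distance_le], simp)
  then show "\<exists>g. integrable lborel g \<and> (\<forall>\<^sub>F n in sequentially. (LBINT x. norm (w x * u n x - g x)) < e)"
    using mean_limit(1) by blast
qed

lemma sobolev_ball_closed_AE:
  assumes v: "\<And>n. v n \<in> sobolev_ball s R" and [measurable]: "w \<in> borel_measurable borel"
    and conv: "AE x in lborel. (\<lambda>n. v n x) \<longlonglongrightarrow> w x"
  shows "w \<in> sobolev_ball s R"
proof -
  have [measurable]: "v n \<in> borel_measurable borel" for n by (rule sobolev_ball_measurable[OF v])
  have "frac_energy s w \<le> ennreal R"
    using v by (intro frac_energy_fatou[OF _ conv _ tendsto_const]) (auto simp: sobolev_ball_def)
  moreover have "(\<integral>\<^sup>+ x. ennreal ((w x)\<^sup>2) \<partial>lborel) \<le> ennreal R"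
  proof (rule nn_integral_fatou_le[OF _ _ _ tendsto_const])
    show "AE x in lborel. (\<lambda>n. (v n x)\<^sup>2) \<longlonglongrightarrow> (w x)\<^sup>2"
      using conv by eventually_elim (intro tendsto_intros)
  qed (use v in \<open>auto simp: sobolev_ball_def\<close>)
  ultimately show ?thesis by (simp add: sobolev_ball_def)
qed

lemma sobolev_ball_AE_compact:
  fixes v :: "nat \<Rightarrow> 'a::euclidean_space \<Rightarrow> real"
  assumes s: "0 < s" and v: "\<And>n. v n \<in> sobolev_ball s R" and R: "0 \<le> R"
  obtains \<rho> w where "strict_mono (\<rho> :: nat \<Rightarrow> nat)" "w \<in> sobolev_ball s R"
    "AE x in lborel. (\<lambda>n. v (\<rho> n) x) \<longlonglongrightarrow> w x"
proof -
  obtain \<omega> :: "'a \<Rightarrow> real" where \<omega>_pos: "\<And>x. 0 < \<omega> x" and \<omega>_le_1: "\<And>x. \<omega> x \<le> 1"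
    and \<omega>: "integrable lborel \<omega>"
    by (rule sigma_finite_measure.obtain_positive_integrable_function[OF sigma_finite_lborel]) blast
  obtain \<rho> where \<rho>: "strict_mono \<rho>" and means: "\<And>k x. convergent (\<lambda>n. cell_mean k (v (\<rho> n)) x)"
    using cell_means_convergent_subsequence[of v s R] v R by blast
  define u where "u n = v (\<rho> n)" for n
  have u: "u n \<in> sobolev_ball s R" for n using v by (simp add: u_def)
  have [measurable]: "u n \<in> borel_measurable borel" for n by (rule sobolev_ball_measurable[OF u])
  have \<omega>_nonneg: "0 \<le> \<omega> x" for x using \<omega>_pos less_imp_le by blast
  have weighted: "integrable lborel (\<lambda>x. \<omega> x * u n x)" for n
    using sobolev_ball_square_integral(1)[OF u R]
    by (intro integrable_mult_square_integrable(1) \<omega> \<omega>_nonneg \<omega>_le_1) auto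
  have "\<exists>N. \<forall>i\<ge>N. \<forall>j\<ge>N. (LBINT x. norm (\<omega> x * u i x - \<omega> x * u j x)) < e" if "0 < e" for e
    by (rule weighted_sobolev_ball_L1_Cauchy[OF s u R \<omega> \<omega>_nonneg \<omega>_le_1 _ that])
       (simp add: u_def means)
  then obtain r where r: "strict_mono r" and Cauchy: "AE x in lborel. Cauchy (\<lambda>i. \<omega> x * u (r i) x)"
    using cauchy_L1_AE_cauchy_subseq[of lborel "\<lambda>n x. \<omega> x * u n x"] weighted by blast
  define w where "w x = lim (\<lambda>i. u (r i) x)" for x
  have w: "w \<in> borel_measurable borel"
    unfolding w_def by (rule borel_measurable_lim_metric) measurable
  have conv: "AE x in lborel. (\<lambda>n. u (r n) x) \<longlonglongrightarrow> w x"
    using Cauchy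
  proof eventually_elim
    fix x assume "Cauchy (\<lambda>i. \<omega> x * u (r i) x)"
    then have "convergent (\<lambda>i. (1 / \<omega> x) * (\<omega> x * u (r i) x))"
      by (intro convergent_mult convergent_const Cauchy_convergent)
    then have "convergent (\<lambda>i. u (r i) x)" using \<omega>_pos[of x] by simp
    then show "(\<lambda>n. u (r n) x) \<longlonglongrightarrow> w x" unfolding w_def by (simp add: convergent_LIMSEQ_iff)
  qed
  have "w \<in> sobolev_ball s R" using u by (intro sobolev_ball_closed_AE[OF _ w conv])
  moreover have "AE x in lborel. (\<lambda>n. v ((\<rho> \<circ> r) n) x) \<longlonglongrightarrow> w x" using conv by (simp add: u_def)
  ultimately show ?thesis using that[OF strict_mono_o[OF \<rho> r]] by blast
qed

section \<open>Lipschitz test functions\<close>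

lemma frac_kernel_annulus_weight:
  fixes x :: "'a::euclidean_space"
  assumes \<rho>: "0 < \<rho>"
  shows "ennreal ((\<rho> / 2) powr (- (real DIM('a) + 2 * s))) * emeasure lborel (cball x \<rho>)
    = ennreal (unit_ball_vol (real DIM('a)) * 2 powr (real DIM('a) + 2 * s) * \<rho> powr (- 2 * s))"
proof -
  define d where "d = real DIM('a)"
  define p where "p = d + 2 * s"
  have split: "(\<rho> / 2) powr (- p) = 2 powr p * \<rho> powr (- p)"
    using \<rho> by (simp add: powr_divide powr_minus_divide)
  have "\<rho> powr (- p) * \<rho> ^ DIM('a) = \<rho> powr (- 2 * s)"
    using \<rho> by (simp add: p_def d_def flip: powr_realpow powr_add)
  then have "(\<rho> / 2) powr (- p) * (unit_ball_vol d * \<rho> ^ DIM('a))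
      = unit_ball_vol d * 2 powr p * \<rho> powr (- 2 * s)"
    unfolding split by simp
  then show ?thesis using \<rho> by (simp add: emeasure_cball p_def d_def flip: ennreal_mult)
qed

lemma frac_kernel_far_integral:
  fixes x :: "'a::euclidean_space"
  assumes s: "0 < s"
  shows "(\<integral>\<^sup>+ z. ennreal (frac_kernel s (x, z)) * indicator {z. 1 < 2 * norm (x - z)} z \<partial>lborel)
    \<le> ennreal (unit_ball_vol (real DIM('a)) * 2 powr (real DIM('a) + 2 * s) / (1 - 2 powr (- 2 * s)))"
proof -
  define A where "A = unit_ball_vol (real DIM('a)) * 2 powr (real DIM('a) + 2 * s)"
  define y :: real where "y = 2 powr (- 2 * s)"
  have y: "0 \<le> y" "y < 1" using s powr_less_mono[of "- 2 * s" 0 2] by (auto simp: y_def)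
  have "(\<integral>\<^sup>+ z. ennreal (frac_kernel s (x, z)) * indicator {z. 2 ^ 0 < 2 * norm (x - z)} z \<partial>lborel)
    \<le> ennreal (A / (1 - y))"
  proof (rule nn_integral_dyadic_le[OF _ _ _ _ y])
    fix j
    let ?c = "ennreal ((2 ^ j / 2) powr (- (real DIM('a) + 2 * s)))"
    show "z \<in> cball x (2 ^ j) \<and> ennreal (frac_kernel s (x, z)) \<le> ?c"
      if "2 ^ (0 + j) < 2 * norm (x - z)" "2 * norm (x - z) \<le> 2 ^ (0 + j + 1)" for z
      using that s frac_kernel_le[of "2 ^ j / 2" x z s] by (simp add: dist_norm ennreal_leI)
    have "?c * emeasure lborel (cball x (2 ^ j)) = ennreal (A * (2 ^ j) powr (- 2 * s))"
      unfolding A_def by (rule frac_kernel_annulus_weight) simp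
    also have "(2 ^ j) powr (- 2 * s) = y ^ j"
      by (simp add: y_def powr_power powr_powr mult.commute flip: powr_realpow)
    finally show "?c * emeasure lborel (cball x (2 ^ j)) \<le> ennreal (A * y ^ j)" by simp
  qed (simp_all add: A_def)
  then show ?thesis by (simp add: A_def y_def)
qed

lemma frac_kernel_near_integral:
  fixes x :: "'a::euclidean_space"
  assumes s: "0 < s" "s < 1"
  shows "(\<integral>\<^sup>+ z. ennreal ((norm (x - z))\<^sup>2 * frac_kernel s (x, z)) *
      indicator {z. 1 < 1 / norm (x - z)} z \<partial>lborel)
    \<le> ennreal (unit_ball_vol (real DIM('a)) * 2 powr (real DIM('a) + 2 * s) / (1 - 2 powr (2 * s - 2)))"
proof -
  define A where "A = unit_ball_vol (real DIM('a)) * 2 powr (real DIM('a) + 2 * s)"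
  define y :: real where "y = 2 powr (2 * s - 2)"
  have y: "0 \<le> y" "y < 1" using s powr_less_mono[of "2 * s - 2" 0 2] by (auto simp: y_def)
  have "(\<integral>\<^sup>+ z. ennreal ((norm (x - z))\<^sup>2 * frac_kernel s (x, z)) *
      indicator {z. 2 ^ 0 < 1 / norm (x - z)} z \<partial>lborel)
    \<le> ennreal (A / (1 - y))"
  proof (rule nn_integral_dyadic_le[OF _ _ _ _ y])
    fix j
    define \<rho> :: real where "\<rho> = 1 / 2 ^ j"
    have \<rho>: "0 < \<rho>" by (simp add: \<rho>_def)
    let ?c = "(\<rho> / 2) powr (- (real DIM('a) + 2 * s))"
    show "z \<in> cball x \<rho> \<and> ennreal ((norm (x - z))\<^sup>2 * frac_kernel s (x, z)) \<le> ennreal (\<rho>\<^sup>2 * ?c)"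
      if layer: "2 ^ (0 + j) < 1 / norm (x - z)" "1 / norm (x - z) \<le> 2 ^ (0 + j + 1)" for z
    proof -
      have "0 < norm (x - z)" using layer(1) by (cases "norm (x - z) = 0") auto
      then have upper: "norm (x - z) \<le> \<rho>" and lower: "\<rho> / 2 \<le> norm (x - z)"
        using layer by (simp_all add: \<rho>_def field_simps)
      have "(norm (x - z))\<^sup>2 * frac_kernel s (x, z) \<le> \<rho>\<^sup>2 * ?c"
        using upper lower \<rho> s by (intro mult_mono power_mono frac_kernel_le frac_kernel_nonneg) auto
      then show ?thesis using upper by (simp add: dist_norm ennreal_leI)
    qed
    have "ennreal (\<rho>\<^sup>2 * ?c) * emeasure lborel (cball x \<rho>)
        = ennreal (\<rho>\<^sup>2) * ennreal (A * \<rho> powr (- 2 * s))"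
      unfolding A_def frac_kernel_annulus_weight[OF \<rho>, of s x, symmetric]
      by (simp add: ennreal_mult mult.assoc)
    also have "\<dots> = ennreal (A * (\<rho>\<^sup>2 * \<rho> powr (- 2 * s)))"
      by (subst ennreal_mult[symmetric]) (simp_all add: A_def mult_ac)
    also have "\<rho>\<^sup>2 * \<rho> powr (- 2 * s) = y ^ j"
    proof -
      have "\<rho> = 2 powr (- real j)" by (simp add: \<rho>_def powr_minus_divide powr_realpow)
      then show ?thesis by (simp add: y_def powr_power powr_powr algebra_simps flip: powr_add)
    qed
    finally show "ennreal (\<rho>\<^sup>2 * ?c) * emeasure lborel (cball x \<rho>) \<le> ennreal (A * y ^ j)" by simp
  qed (simp_all add: A_def)
  then show ?thesis by (simp add: A_def y_def)
qed

definition truncated_frac_kernel :: "real \<Rightarrow> 'a::euclidean_space \<times> 'a \<Rightarrow> real" where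
  "truncated_frac_kernel s z = min 1 ((norm (fst z - snd z))\<^sup>2) * frac_kernel s z"

lemma truncated_frac_kernel_commute: "truncated_frac_kernel s (x, z) = truncated_frac_kernel s (z, x)"
  by (simp add: truncated_frac_kernel_def norm_minus_commute frac_kernel_commute)

lemma truncated_frac_kernel_le:
  "ennreal (truncated_frac_kernel s (x, z))
    \<le> ennreal ((norm (x - z))\<^sup>2 * frac_kernel s (x, z)) * indicator {z. 1 < 1 / norm (x - z)} z
      + ennreal (frac_kernel s (x, z)) * indicator {z. 1 < 2 * norm (x - z)} z"
proof -
  have "1 < 1 / norm (x - z)" if "z \<noteq> x" "norm (x - z) < 1"
    using that by (simp add: less_divide_eq_1_pos)
  moreover have "1 < 2 * norm (x - z)" if "\<not> norm (x - z) < 1" using that by linarith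
  ultimately consider (diagonal) "z = x"
    | (near) "1 < 1 / norm (x - z)" | (far) "1 < 2 * norm (x - z)"
    by blast
  then show ?thesis
  proof cases
    case near
    then show ?thesis
      using frac_kernel_nonneg
      by (auto simp: truncated_frac_kernel_def intro!: add_increasing2 ennreal_leI mult_right_mono)
  next
    case far
    have "truncated_frac_kernel s (x, z) \<le> 1 * frac_kernel s (x, z)"
      unfolding truncated_frac_kernel_def using frac_kernel_nonneg by (intro mult_right_mono) auto
    with far show ?thesis by (auto intro!: add_increasing ennreal_leI)
  qed (simp add: truncated_frac_kernel_def)
qed

lemma truncated_frac_kernel_integral_bounded:
  assumes s: "0 < s" "s < 1"
  obtains C where "\<And>x :: 'a::euclidean_space.
    (\<integral>\<^sup>+ z. ennreal (truncated_frac_kernel s (x, z)) \<partial>lborel) \<le> ennreal C"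
proof -
  define A where "A = unit_ball_vol (real DIM('a)) * 2 powr (real DIM('a) + 2 * s)"
  define near where "near = A / (1 - 2 powr (2 * s - 2))"
  define far where "far = A / (1 - 2 powr (- 2 * s))"
  have nonneg: "0 \<le> near" "0 \<le> far"
    using s powr_less_mono[of "2 * s - 2" 0 2] powr_less_mono[of "- 2 * s" 0 2]
    by (auto simp: near_def far_def A_def)
  have "(\<integral>\<^sup>+ z. ennreal (truncated_frac_kernel s (x, z)) \<partial>lborel) \<le> ennreal (near + far)" for x :: 'a
  proof -
    let ?near = "\<lambda>z. ennreal ((norm (x - z))\<^sup>2 * frac_kernel s (x, z)) *
      indicator {z. 1 < 1 / norm (x - z)} z"
    let ?far = "\<lambda>z. ennreal (frac_kernel s (x, z)) * indicator {z. 1 < 2 * norm (x - z)} z"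
    have "(\<integral>\<^sup>+ z. ennreal (truncated_frac_kernel s (x, z)) \<partial>lborel) \<le> (\<integral>\<^sup>+ z. ?near z + ?far z \<partial>lborel)"
      by (intro nn_integral_mono truncated_frac_kernel_le)
    also have "\<dots> = (\<integral>\<^sup>+ z. ?near z \<partial>lborel) + (\<integral>\<^sup>+ z. ?far z \<partial>lborel)"
      by (intro nn_integral_add) auto
    also have "\<dots> \<le> ennreal near + ennreal far"
      unfolding near_def far_def A_def
      by (intro add_mono frac_kernel_near_integral frac_kernel_far_integral s)
    also have "\<dots> = ennreal (near + far)" using nonneg by (simp add: ennreal_plus)
    finally show ?thesis .
  qed
  then show ?thesis using that by blast
qed

lemma lipschitz_increment_le_truncated_frac_kernel:
  fixes u :: "'a::euclidean_space \<Rightarrow> real"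
  assumes "\<bar>u x - u z\<bar> \<le> min 1 (norm (x - z))"
  shows "frac_kernel s (x, z) * (u x - u z)\<^sup>2 \<le> truncated_frac_kernel s (x, z)"
proof -
  have "(u x - u z)\<^sup>2 \<le> (min 1 (norm (x - z)))\<^sup>2"
    using assms by (simp add: abs_le_square_iff[symmetric])
  also have "\<dots> = min 1 ((norm (x - z))\<^sup>2)"
    by (cases "norm (x - z) \<le> 1") (auto simp: min_absorb1 min_absorb2 power_le_one one_le_power)
  finally show ?thesis
    using frac_kernel_nonneg[of s "(x, z)"]
    by (simp add: truncated_frac_kernel_def mult.commute mult_left_mono)
qed

lemma frac_energy_lipschitz_finite:
  fixes u :: "'a::euclidean_space \<Rightarrow> real"
  assumes s: "0 < s" "s < 1" and [measurable]: "u \<in> borel_measurable borel" "S \<in> sets borel"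
    and S: "emeasure lborel S < \<infinity>" "\<And>x. x \<notin> S \<Longrightarrow> u x = 0"
    and lipschitz: "\<And>x y. \<bar>u x - u y\<bar> \<le> min 1 (norm (x - y))"
  shows "frac_energy s u < \<infinity>"
proof -
  define \<kappa> where "\<kappa> x z = ennreal (truncated_frac_kernel s (x, z))" for x z :: 'a
  have [measurable]: "(\<lambda>z. \<kappa> (fst z) (snd z)) \<in> borel_measurable (borel \<Otimes>\<^sub>M borel)"
      "\<kappa> x \<in> borel_measurable borel" for x
    unfolding \<kappa>_def truncated_frac_kernel_def fst_conv snd_conv by measurable
  obtain C where C: "\<And>x. (\<integral>\<^sup>+ z. \<kappa> x z \<partial>lborel) \<le> ennreal C"
    unfolding \<kappa>_def using truncated_frac_kernel_integral_bounded[OF s] by blast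
  have pointwise: "ennreal (frac_kernel s (x, z) * (u x - u z)\<^sup>2)
      \<le> indicator S x * \<kappa> x z + indicator S z * \<kappa> x z" for x z
    using lipschitz_increment_le_truncated_frac_kernel[of u x z s, OF lipschitz] S(2)
    by (cases "x \<in> S \<or> z \<in> S")
       (auto simp: \<kappa>_def indicator_def intro!: ennreal_leI add_increasing add_increasing2)
  have one_sided: "(\<integral>\<^sup>+ x. \<integral>\<^sup>+ z. indicator S x * \<kappa> x z \<partial>lborel \<partial>lborel)
      \<le> ennreal C * emeasure lborel S"
  proof -
    have "(\<integral>\<^sup>+ x. \<integral>\<^sup>+ z. indicator S x * \<kappa> x z \<partial>lborel \<partial>lborel)
        = (\<integral>\<^sup>+ x. indicator S x * (\<integral>\<^sup>+ z. \<kappa> x z \<partial>lborel) \<partial>lborel)"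
      by (intro nn_integral_cong nn_integral_cmult) auto
    also have "\<dots> \<le> (\<integral>\<^sup>+ x. ennreal C * indicator S x \<partial>lborel)"
      using C by (intro nn_integral_mono) (auto simp: indicator_def)
    finally show ?thesis by (simp add: nn_integral_cmult_indicator)
  qed
  have "frac_energy s u \<le> (\<integral>\<^sup>+ x. \<integral>\<^sup>+ z. indicator S x * \<kappa> x z + indicator S z * \<kappa> x z \<partial>lborel \<partial>lborel)"
    unfolding frac_energy_iterated[OF \<open>u \<in> borel_measurable borel\<close>]
    by (intro nn_integral_mono pointwise)
  also have "\<dots> = (\<integral>\<^sup>+ x. \<integral>\<^sup>+ z. indicator S x * \<kappa> x z \<partial>lborel \<partial>lborel)
      + (\<integral>\<^sup>+ x. \<integral>\<^sup>+ z. indicator S z * \<kappa> x z \<partial>lborel \<partial>lborel)"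
    by (subst nn_integral_add[symmetric])
       (auto intro!: nn_integral_cong nn_integral_add simp: \<kappa>_def truncated_frac_kernel_def)
  also have "(\<integral>\<^sup>+ x. \<integral>\<^sup>+ z. indicator S z * \<kappa> x z \<partial>lborel \<partial>lborel)
      = (\<integral>\<^sup>+ z. \<integral>\<^sup>+ x. indicator S z * \<kappa> x z \<partial>lborel \<partial>lborel)"
    unfolding \<kappa>_def truncated_frac_kernel_def fst_conv snd_conv by (rule lborel_pair.Fubini') measurable
  also have "\<dots> = (\<integral>\<^sup>+ x. \<integral>\<^sup>+ z. indicator S x * \<kappa> x z \<partial>lborel \<partial>lborel)"
    unfolding \<kappa>_def by (subst truncated_frac_kernel_commute) (rule refl)
  also have "(\<integral>\<^sup>+ x. \<integral>\<^sup>+ z. indicator S x * \<kappa> x z \<partial>lborel \<partial>lborel) + \<dots> < \<infinity>"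
    using le_less_trans[OF one_sided] S(1) by (simp add: ennreal_mult_less_top)
  finally show ?thesis .
qed

definition bump :: "'a::euclidean_space \<Rightarrow> 'a \<Rightarrow> real" where
  "bump x0 x = max 0 (1 - dist x0 x)"

lemma bump_measurable [measurable]: "bump x0 \<in> borel_measurable borel"
  unfolding bump_def by measurable

lemma bump_bounds: "0 \<le> bump x0 x" "bump x0 x \<le> 1"
  by (auto simp: bump_def)

lemma bump_pos_iff: "0 < bump x0 x \<longleftrightarrow> x \<in> ball x0 1"
  by (auto simp: bump_def)

lemma bump_eq_0: "x \<notin> cball x0 1 \<Longrightarrow> bump x0 x = 0"
  by (simp add: bump_def)

lemma frac_energy_bump_finite:
  assumes "0 < s" "s < 1"
  shows "frac_energy s (bump (x0 :: 'a::euclidean_space)) < \<infinity>"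
proof (rule frac_energy_lipschitz_finite[OF assms, where S = "cball x0 1"])
  show "\<bar>bump x0 x - bump x0 y\<bar> \<le> min 1 (norm (x - y))" for x y
  proof -
    have "\<bar>bump x0 x - bump x0 y\<bar> \<le> dist x y"
      using dist_triangle[of x0 x y] dist_triangle[of x0 y x] by (auto simp: bump_def dist_commute)
    then show ?thesis using bump_bounds[of x0 x] bump_bounds[of x0 y] by (auto simp: dist_norm)
  qed
qed (use emeasure_lborel_cball_finite[of x0 1] in \<open>auto simp: bump_eq_0\<close>)

section \<open>The weighted fractional space\<close>

definition increment :: "('a \<Rightarrow> real) \<Rightarrow> 'a \<times> 'a \<Rightarrow> real" where
  "increment u z = u (fst z) - u (snd z)"

lemma increment_measurable [measurable]:
  assumes [measurable]: "u \<in> borel_measurable M"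
  shows "increment u \<in> borel_measurable (M \<Otimes>\<^sub>M M)"
  unfolding increment_def[abs_def] by measurable

lemma increment_linear:
  "increment (\<lambda>x. \<alpha> * u x + \<beta> * v x) z = \<alpha> * increment u z + \<beta> * increment v z"
  by (simp add: increment_def algebra_simps)

lemma gagliardo_ennreal_eq_frac_energy: "gagliardo_ennreal s u = frac_energy s u"
  by (simp add: gagliardo_ennreal_def frac_energy_def frac_kernel_def)

lemma gagliardo_ennreal_eq:
  "gagliardo_ennreal s u = (\<integral>\<^sup>+ z. ennreal (frac_kernel s z * (increment u z)\<^sup>2) \<partial>(lborel \<Otimes>\<^sub>M lborel))"
  by (simp add: gagliardo_ennreal_eq_frac_energy frac_energy_def increment_def)

lemma gagliardo_nonneg: "0 \<le> gagliardo s u"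
  by (simp add: gagliardo_def)

locale weighted_space =
  fixes s :: real and V :: "R3 \<Rightarrow> real" and \<epsilon> V0 :: real
  assumes s_pos: "0 < s" and s_less_1: "s < 1" and V_continuous: "continuous_on UNIV V"
    and V0_pos: "0 < V0" and V_ge: "V0 \<le> V x"
begin

abbreviation "W x \<equiv> V (\<epsilon> *\<^sub>R x)"
abbreviation "H \<equiv> H_eps s V \<epsilon>"
abbreviation "N \<equiv> norm_eps_sq s V \<epsilon>"

definition pot :: "(R3 \<Rightarrow> real) \<Rightarrow> real" where
  "pot u = enn2real (pot_ennreal V \<epsilon> u)"

definition inner_eps :: "(R3 \<Rightarrow> real) \<Rightarrow> (R3 \<Rightarrow> real) \<Rightarrow> real" where
  "inner_eps u v = (\<integral>z. frac_kernel s z * increment u z * increment v z \<partial>(lborel \<Otimes>\<^sub>M lborel))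
     + (LBINT x. W x * u x * v x)"

lemma W_nonneg: "0 \<le> W x"
  using V0_pos V_ge[of "\<epsilon> *\<^sub>R x"] by linarith

lemma W_continuous: "continuous_on A (\<lambda>x. W x)"
  by (rule continuous_on_compose2[OF V_continuous]) (auto intro!: continuous_intros)

lemma W_measurable [measurable]: "(\<lambda>x. W x) \<in> borel_measurable borel"
  using W_continuous by (rule borel_measurable_continuous_onI)

lemma V0_square_le: "V0 * (u x)\<^sup>2 \<le> W x * (u x)\<^sup>2"
  by (intro mult_right_mono V_ge) simp

lemma square_integrable_of_pot:
  assumes [measurable]: "u \<in> borel_measurable borel" and pot: "integrable lborel (\<lambda>x. W x * (u x)\<^sup>2)"
  shows "integrable lborel (\<lambda>x. (u x)\<^sup>2)"
proof -
  have "integrable lborel (\<lambda>x. V0 * (u x)\<^sup>2)"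
  proof (rule Bochner_Integration.integrable_bound[OF pot])
    show "AE x in lborel. norm (V0 * (u x)\<^sup>2) \<le> norm (W x * (u x)\<^sup>2)"
      using V0_square_le V0_pos W_nonneg by (intro AE_I2) (simp add: abs_mult)
  qed measurable
  then show ?thesis using V0_pos by simp
qed

lemma H_iff:
  "u \<in> H \<longleftrightarrow> u \<in> borel_measurable borel \<and>
     integrable (lborel \<Otimes>\<^sub>M lborel) (\<lambda>z. frac_kernel s z * (increment u z)\<^sup>2) \<and>
     integrable lborel (\<lambda>x. W x * (u x)\<^sup>2)"
proof (cases "u \<in> borel_measurable borel")
  case True
  note [measurable] = True
  have "integrable (lborel \<Otimes>\<^sub>M lborel) (\<lambda>z. frac_kernel s z * (increment u z)\<^sup>2)
      \<longleftrightarrow> gagliardo_ennreal s u < \<infinity>"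
    unfolding gagliardo_ennreal_eq
    by (subst integrable_iff_bounded) (auto simp: frac_kernel_nonneg abs_mult)
  moreover have "integrable lborel (\<lambda>x. W x * (u x)\<^sup>2) \<longleftrightarrow> pot_ennreal V \<epsilon> u < \<infinity>"
    unfolding pot_ennreal_def by (subst integrable_iff_bounded) (auto simp: W_nonneg abs_mult)
  ultimately show ?thesis using True square_integrable_of_pot by (auto simp: H_eps_def)
qed (auto simp: H_eps_def)

lemma
  assumes "u \<in> H"
  shows H_measurable: "u \<in> borel_measurable borel"
    and H_gagliardo: "integrable (lborel \<Otimes>\<^sub>M lborel) (\<lambda>z. frac_kernel s z * (increment u z)\<^sup>2)"
    and H_pot: "integrable lborel (\<lambda>x. W x * (u x)\<^sup>2)"
    and H_square: "integrable lborel (\<lambda>x. (u x)\<^sup>2)"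
  using assms square_integrable_of_pot by (auto simp: H_iff)

lemma H_gagliardo_product:
  assumes "u \<in> H" "v \<in> H"
  shows "integrable (lborel \<Otimes>\<^sub>M lborel) (\<lambda>z. frac_kernel s z * increment u z * increment v z)"
  using assms[THEN H_measurable]
  by (intro integrable_weighted_product assms[THEN H_gagliardo] frac_kernel_nonneg
      frac_kernel_measurable increment_measurable) auto

lemma H_pot_product:
  assumes "u \<in> H" "v \<in> H"
  shows "integrable lborel (\<lambda>x. W x * u x * v x)"
  using assms[THEN H_measurable]
  by (intro integrable_weighted_product assms[THEN H_pot] W_nonneg) auto

lemma
  assumes u: "u \<in> H"
  shows gagliardo_eq: "gagliardo s u = (\<integral>z. frac_kernel s z * (increment u z)\<^sup>2 \<partial>(lborel \<Otimes>\<^sub>M lborel))"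
    and ennreal_gagliardo: "gagliardo_ennreal s u = ennreal (gagliardo s u)"
proof -
  have ennreal_integral: "gagliardo_ennreal s u
      = ennreal (\<integral>z. frac_kernel s z * (increment u z)\<^sup>2 \<partial>(lborel \<Otimes>\<^sub>M lborel))"
    unfolding gagliardo_ennreal_eq
    by (rule nn_integral_eq_integral[OF H_gagliardo[OF u]]) (simp add: frac_kernel_nonneg)
  then show "gagliardo s u = (\<integral>z. frac_kernel s z * (increment u z)\<^sup>2 \<partial>(lborel \<Otimes>\<^sub>M lborel))"
    unfolding gagliardo_def by (simp add: Bochner_Integration.integral_nonneg frac_kernel_nonneg)
  with ennreal_integral show "gagliardo_ennreal s u = ennreal (gagliardo s u)" by simp
qed

lemma
  assumes u: "u \<in> H"
  shows pot_eq: "pot u = (LBINT x. W x * (u x)\<^sup>2)"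
    and ennreal_pot: "pot_ennreal V \<epsilon> u = ennreal (pot u)"
proof -
  have ennreal_integral: "pot_ennreal V \<epsilon> u = ennreal (LBINT x. W x * (u x)\<^sup>2)"
    unfolding pot_ennreal_def by (rule nn_integral_eq_integral[OF H_pot[OF u]]) (simp add: W_nonneg)
  then show "pot u = (LBINT x. W x * (u x)\<^sup>2)"
    unfolding pot_def by (simp add: Bochner_Integration.integral_nonneg W_nonneg)
  with ennreal_integral show "pot_ennreal V \<epsilon> u = ennreal (pot u)" by simp
qed

lemma pot_nonneg: "0 \<le> pot u"
  by (simp add: pot_def)

lemma N_eq: "N u = gagliardo s u + pot u"
  by (simp add: norm_eps_sq_def pot_def)

lemma N_nonneg: "0 \<le> N u"
  by (simp add: N_eq gagliardo_nonneg pot_nonneg)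

lemma gagliardo_le_N: "gagliardo s u \<le> N u"
  by (simp add: N_eq pot_nonneg)

lemma pot_le_N: "pot u \<le> N u"
  by (simp add: N_eq gagliardo_nonneg)

lemma V0_integral_square_le_pot:
  assumes "u \<in> H"
  shows "V0 * (LBINT x. (u x)\<^sup>2) \<le> pot u"
proof -
  have "(LBINT x. V0 * (u x)\<^sup>2) \<le> (LBINT x. W x * (u x)\<^sup>2)"
    using H_square[OF assms] H_pot[OF assms] V0_square_le
    by (intro Bochner_Integration.integral_mono) auto
  then show ?thesis by (simp add: pot_eq[OF assms])
qed

lemma N_inner: "u \<in> H \<Longrightarrow> N u = inner_eps u u"
  by (simp add: N_eq gagliardo_eq pot_eq inner_eps_def power2_eq_square mult.assoc)

lemma inner_commute: "inner_eps u v = inner_eps v u"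
  by (simp add: inner_eps_def mult.commute mult.left_commute)

lemma H_linear:
  assumes u: "u \<in> H" and v: "v \<in> H"
  shows "(\<lambda>x. \<alpha> * u x + \<beta> * v x) \<in> H"
proof -
  note [measurable] = H_measurable[OF u] H_measurable[OF v]
  have square: "k * (\<alpha> * a + \<beta> * b)\<^sup>2
      = \<alpha>\<^sup>2 * (k * a\<^sup>2) + 2 * \<alpha> * \<beta> * (k * a * b) + \<beta>\<^sup>2 * (k * b\<^sup>2)" for k a b :: real
    by (simp add: power2_eq_square algebra_simps)
  show ?thesis unfolding H_iff increment_linear square
    using H_gagliardo[OF u] H_gagliardo[OF v] H_gagliardo_product[OF u v]
      H_pot[OF u] H_pot[OF v] H_pot_product[OF u v]
    by auto
qed

lemma H_scale: "u \<in> H \<Longrightarrow> (\<lambda>x. t * u x) \<in> H"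
  using H_linear[of u u t 0] by simp

lemma H_add_scale: "u \<in> H \<Longrightarrow> v \<in> H \<Longrightarrow> (\<lambda>x. u x + t * v x) \<in> H"
  using H_linear[of u v 1 t] by simp

lemma inner_linear:
  assumes u: "u \<in> H" and v: "v \<in> H" and w: "w \<in> H"
  shows "inner_eps (\<lambda>x. \<alpha> * u x + \<beta> * v x) w = \<alpha> * inner_eps u w + \<beta> * inner_eps v w"
proof -
  have expand: "k * (\<alpha> * a + \<beta> * b) * c = \<alpha> * (k * a * c) + \<beta> * (k * b * c)" for k a b c :: real
    by (simp add: algebra_simps)
  show ?thesis unfolding inner_eps_def increment_linear expand
    using H_gagliardo_product[OF u w] H_gagliardo_product[OF v w]
      H_pot_product[OF u w] H_pot_product[OF v w]
    by (simp add: distrib_left)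
qed

lemma N_linear:
  assumes u: "u \<in> H" and v: "v \<in> H"
  shows "N (\<lambda>x. \<alpha> * u x + \<beta> * v x) = \<alpha>\<^sup>2 * N u + 2 * \<alpha> * \<beta> * inner_eps u v + \<beta>\<^sup>2 * N v"
proof -
  let ?w = "\<lambda>x. \<alpha> * u x + \<beta> * v x"
  have w: "?w \<in> H" by (rule H_linear[OF u v])
  have "N ?w = \<alpha> * inner_eps u ?w + \<beta> * inner_eps v ?w"
    unfolding N_inner[OF w] by (rule inner_linear[OF u v w])
  also have "\<dots> = \<alpha> * (\<alpha> * inner_eps u u + \<beta> * inner_eps v u)
      + \<beta> * (\<alpha> * inner_eps u v + \<beta> * inner_eps v v)"
    by (simp only: inner_commute[of u ?w] inner_commute[of v ?w]
        inner_linear[OF u v u] inner_linear[OF u v v])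
  finally show ?thesis
    by (simp add: N_inner[OF u] N_inner[OF v] inner_commute[of v u] power2_eq_square algebra_simps)
qed

lemma N_scale: "u \<in> H \<Longrightarrow> N (\<lambda>x. t * u x) = t\<^sup>2 * N u"
  using N_linear[of u u t 0] by simp

lemma pot_scale:
  assumes "u \<in> H"
  shows "pot (\<lambda>x. t * u x) = t\<^sup>2 * pot u"
proof -
  have scaled: "W x * (t * u x)\<^sup>2 = t\<^sup>2 * (W x * (u x)\<^sup>2)" for x by (simp add: power_mult_distrib)
  show ?thesis unfolding pot_eq[OF assms] pot_eq[OF H_scale[OF assms]] scaled by simp
qed

lemma gagliardo_scale: "u \<in> H \<Longrightarrow> gagliardo s (\<lambda>x. t * u x) = t\<^sup>2 * gagliardo s u"
  using N_scale[of u t] pot_scale[of u t] by (simp add: N_eq distrib_left)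

lemma H_contraction:
  assumes u: "u \<in> H" and T: "\<And>a b. \<bar>T a - T b\<bar> \<le> \<bar>a - b\<bar>" and T0: "T 0 = 0"
  shows "(\<lambda>x. T (u x)) \<in> H" and "N (\<lambda>x. T (u x)) \<le> N u"
proof -
  have "1-lipschitz_on UNIV T" using T by (intro lipschitz_onI) (auto simp: dist_real_def)
  then have [measurable]: "T \<in> borel_measurable borel"
    by (intro borel_measurable_continuous_onI lipschitz_on_continuous_on)
  note [measurable] = H_measurable[OF u]
  have gagliardo_le: "frac_kernel s z * (increment (\<lambda>x. T (u x)) z)\<^sup>2
      \<le> frac_kernel s z * (increment u z)\<^sup>2" for z
    using T
    by (intro mult_left_mono)
       (auto simp: increment_def abs_le_square_iff[symmetric] frac_kernel_nonneg)
  have pot_le: "W x * (T (u x))\<^sup>2 \<le> W x * (u x)\<^sup>2" for x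
    using T[of "u x" 0] T0
    by (intro mult_left_mono) (auto simp: abs_le_square_iff[symmetric] W_nonneg)
  have gagliardo_int: "integrable (lborel \<Otimes>\<^sub>M lborel)
      (\<lambda>z. frac_kernel s z * (increment (\<lambda>x. T (u x)) z)\<^sup>2)"
    using gagliardo_le by (intro Bochner_Integration.integrable_bound[OF H_gagliardo[OF u]])
      (auto simp: frac_kernel_nonneg abs_mult)
  have pot_int: "integrable lborel (\<lambda>x. W x * (T (u x))\<^sup>2)"
    using pot_le
    by (intro Bochner_Integration.integrable_bound[OF H_pot[OF u]]) (auto simp: W_nonneg abs_mult)
  show Tu: "(\<lambda>x. T (u x)) \<in> H" unfolding H_iff using gagliardo_int pot_int by auto
  show "N (\<lambda>x. T (u x)) \<le> N u"
    unfolding N_eq gagliardo_eq[OF Tu] gagliardo_eq[OF u] pot_eq[OF Tu] pot_eq[OF u]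
    using gagliardo_le pot_le gagliardo_int pot_int H_gagliardo[OF u] H_pot[OF u]
    by (intro add_mono Bochner_Integration.integral_mono) auto
qed

lemma H_abs: "u \<in> H \<Longrightarrow> (\<lambda>x. \<bar>u x\<bar>) \<in> H"
  by (rule H_contraction) auto

lemma
  assumes "u \<in> H"
  shows H_pos_part: "(\<lambda>x. max 0 (u x)) \<in> H" and N_pos_part_le: "N (\<lambda>x. max 0 (u x)) \<le> N u"
  using assms by (rule H_contraction; auto simp: max_def)+

lemma nontrivial_iff:
  assumes u: "u \<in> H"
  shows "nontrivial u \<longleftrightarrow> 0 < N u"
proof
  assume "nontrivial u"
  show "0 < N u"
  proof (rule ccontr)
    assume "\<not> 0 < N u"
    then have "V0 * (LBINT x. (u x)\<^sup>2) \<le> 0"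
      using V0_integral_square_le_pot[OF u] pot_le_N[of u] by linarith
    then have "(LBINT x. (u x)\<^sup>2) \<le> 0" using V0_pos by (simp add: mult_le_0_iff)
    moreover have "0 \<le> (LBINT x. (u x)\<^sup>2)" by (intro Bochner_Integration.integral_nonneg) auto
    ultimately have "AE x in lborel. (u x)\<^sup>2 = 0"
      using integral_nonneg_eq_0_iff_AE[OF H_square[OF u]] by auto
    then show False using \<open>nontrivial u\<close> by (simp add: nontrivial_def)
  qed
next
  assume N: "0 < N u"
  show "nontrivial u" unfolding nontrivial_def
  proof
    assume zero: "AE x in lborel. u x = 0"
    have "AE z in lborel \<Otimes>\<^sub>M lborel. frac_kernel s z * (increment u z)\<^sup>2 = 0"
      using lborel_pair.AE_pair_fst_snd[OF zero zero] by eventually_elim (auto simp: increment_def)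
    then have "gagliardo s u = 0" unfolding gagliardo_eq[OF u] by (rule integral_eq_zero_AE)
    moreover have "AE x in lborel. W x * (u x)\<^sup>2 = 0" using zero by eventually_elim auto
    then have "pot u = 0" unfolding pot_eq[OF u] by (rule integral_eq_zero_AE)
    ultimately show False using N by (simp add: N_eq)
  qed
qed

lemma H_sobolev_ball:
  assumes u: "u \<in> H" and R: "N u \<le> R"
  shows "u \<in> sobolev_ball s (R + R / V0)"
proof -
  have R0: "0 \<le> R / V0" using R N_nonneg[of u] V0_pos by simp
  have "V0 * (LBINT x. (u x)\<^sup>2) \<le> R"
    using V0_integral_square_le_pot[OF u] pot_le_N[of u] R by linarith
  then have "(LBINT x. (u x)\<^sup>2) \<le> R / V0" using V0_pos by (simp add: pos_le_divide_eq mult.commute)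
  then have "(\<integral>\<^sup>+ x. ennreal ((u x)\<^sup>2) \<partial>lborel) \<le> ennreal (R + R / V0)"
    using R N_nonneg[of u]
    by (subst nn_integral_eq_integral[OF H_square[OF u]]) (auto intro!: ennreal_leI)
  moreover have "frac_energy s u \<le> ennreal (R + R / V0)"
    using gagliardo_le_N[of u] R R0
    by (auto simp: ennreal_gagliardo[OF u] simp flip: gagliardo_ennreal_eq_frac_energy
        intro!: ennreal_leI)
  ultimately show ?thesis using H_measurable[OF u] by (simp add: sobolev_ball_def)
qed

lemma H_powr_integrable:
  assumes q: "2 \<le> q" "q < critical_exponent 3 s" and u: "u \<in> H"
  shows "integrable lborel (\<lambda>x. \<bar>u x\<bar> powr q)"
proof -
  let ?R = "(N u + 1) + (N u + 1) / V0"
  have "0 < N u + 1" using N_nonneg[of u] by linarith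
  then have "0 < ?R" using V0_pos by (intro add_pos_pos[of "N u + 1"] divide_pos_pos)
  then obtain D where "\<And>v :: R3 \<Rightarrow> real. v \<in> sobolev_ball s ?R \<Longrightarrow>
      integrable lborel (\<lambda>x. \<bar>v x\<bar> powr q) \<and> (LBINT x. \<bar>v x\<bar> powr q) \<le> D"
    using sobolev_ball_powr_bound[of s ?R q, where 'a = R3] s_pos s_less_1 q by auto
  moreover have "u \<in> sobolev_ball s ?R" by (rule H_sobolev_ball[OF u]) simp
  ultimately show ?thesis by blast
qed

lemma H_powr_bound:
  assumes q: "2 \<le> q" "q < critical_exponent 3 s"
  obtains D where "0 < D" "\<And>u. u \<in> H \<Longrightarrow> (LBINT x. \<bar>u x\<bar> powr q) \<le> D * N u powr (q / 2)"
proof -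
  have "0 < 1 + 1 / V0" using V0_pos by (simp add: add_pos_pos)
  then obtain D where D: "0 < D" and unit_bound: "\<And>u :: R3 \<Rightarrow> real. u \<in> sobolev_ball s (1 + 1 / V0) \<Longrightarrow>
      integrable lborel (\<lambda>x. \<bar>u x\<bar> powr q) \<and> (LBINT x. \<bar>u x\<bar> powr q) \<le> D"
    using sobolev_ball_powr_bound[of s "1 + 1 / V0" q, where 'a = R3] s_pos s_less_1 q by auto
  have "(LBINT x. \<bar>u x\<bar> powr q) \<le> D * N u powr (q / 2)" if u: "u \<in> H" for u
  proof (cases "N u = 0")
    case True
    then have "AE x in lborel. u x = 0" using nontrivial_iff[OF u] by (auto simp: nontrivial_def)
    then have "AE x in lborel. \<bar>u x\<bar> powr q = 0" by eventually_elim simp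
    then show ?thesis using integral_eq_zero_AE[of "\<lambda>x. \<bar>u x\<bar> powr q" lborel] D by simp
  next
    case False
    define n where "n = N u"
    have n: "0 < n" using False N_nonneg[of u] by (simp add: n_def)
    define w where "w x = 1 / sqrt n * u x" for x
    have w: "w \<in> H" unfolding w_def by (rule H_scale[OF u])
    have "N w = 1"
      using N_scale[OF u, of "1 / sqrt n"] n by (simp add: w_def[abs_def] power_divide flip: n_def)
    then have "w \<in> sobolev_ball s (1 + 1 / V0)" using H_sobolev_ball[OF w, of 1] by simp
    note w_bound = unit_bound[OF this]
    have scale: "\<bar>u x\<bar> powr q = n powr (q / 2) * \<bar>w x\<bar> powr q" for x
    proof -
      have "\<bar>u x\<bar> = sqrt n * \<bar>w x\<bar>" using n by (simp add: w_def abs_mult)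
      then show ?thesis using n by (simp add: powr_mult powr_half_sqrt[symmetric] powr_powr)
    qed
    show ?thesis
      unfolding scale using w_bound n by (simp add: mult.commute mult_right_mono flip: n_def)
  qed
  then show ?thesis using that[OF D] by blast
qed

lemma H_fatou:
  assumes v: "\<And>n. v n \<in> H" and w [measurable]: "w \<in> borel_measurable borel"
    and conv: "AE x in lborel. (\<lambda>n. v n x) \<longlonglongrightarrow> w x"
    and \<gamma>: "(\<lambda>n. gagliardo s (v n)) \<longlonglongrightarrow> \<gamma>" and p: "(\<lambda>n. pot (v n)) \<longlonglongrightarrow> p"
  shows "w \<in> H" "gagliardo s w \<le> \<gamma>" "pot w \<le> p"
proof -
  have [measurable]: "v n \<in> borel_measurable borel" for n by (rule H_measurable[OF v])
  have \<gamma>_nonneg: "0 \<le> \<gamma>" using \<gamma> gagliardo_nonneg by (intro LIMSEQ_le_const) auto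
  have p_nonneg: "0 \<le> p" using p pot_nonneg by (intro LIMSEQ_le_const) auto
  have gagliardo: "gagliardo_ennreal s w \<le> ennreal \<gamma>"
    unfolding gagliardo_ennreal_eq_frac_energy
    by (rule frac_energy_fatou[OF _ conv _ \<gamma>])
       (auto simp: ennreal_gagliardo[OF v] simp flip: gagliardo_ennreal_eq_frac_energy)
  have pot: "pot_ennreal V \<epsilon> w \<le> ennreal p"
    unfolding pot_ennreal_def
  proof (rule nn_integral_fatou_le[OF _ _ _ p])
    show "AE x in lborel. (\<lambda>n. W x * (v n x)\<^sup>2) \<longlonglongrightarrow> W x * (w x)\<^sup>2"
      using conv by eventually_elim (intro tendsto_intros)
    show "(\<integral>\<^sup>+ x. ennreal (W x * (v n x)\<^sup>2) \<partial>lborel) \<le> ennreal (pot (v n))" for n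
      using ennreal_pot[OF v[of n]] by (simp add: pot_ennreal_def)
  qed measurable
  show "gagliardo s w \<le> \<gamma>" unfolding gagliardo_def using \<gamma>_nonneg gagliardo by (rule enn2real_leI)
  show "pot w \<le> p" unfolding pot_def using p_nonneg pot by (rule enn2real_leI)
  have "integrable (lborel \<Otimes>\<^sub>M lborel) (\<lambda>z. frac_kernel s z * (increment w z)\<^sup>2)"
    using gagliardo
    by (intro integrableI_nonneg) (auto simp: frac_kernel_nonneg gagliardo_ennreal_eq le_less_trans)
  moreover have "integrable lborel (\<lambda>x. W x * (w x)\<^sup>2)"
    using pot by (intro integrableI_nonneg) (auto simp: W_nonneg pot_ennreal_def le_less_trans)
  ultimately show "w \<in> H" by (simp add: H_iff)
qed

lemma H_bounded_subsequence:
  assumes v: "\<And>n. v n \<in> H" and R: "\<And>n. N (v n) \<le> R"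
  obtains \<rho> w \<gamma> p where "strict_mono (\<rho> :: nat \<Rightarrow> nat)" "w \<in> borel_measurable borel"
    "AE x in lborel. (\<lambda>n. v (\<rho> n) x) \<longlonglongrightarrow> w x"
    "(\<lambda>n. gagliardo s (v (\<rho> n))) \<longlonglongrightarrow> \<gamma>" "(\<lambda>n. pot (v (\<rho> n))) \<longlonglongrightarrow> p"
proof -
  define X where "X n = (gagliardo s (v n), pot (v n))" for n
  have "bounded (range X)"
  proof (rule boundedI)
    fix y assume "y \<in> range X"
    then obtain n where "y = (gagliardo s (v n), pot (v n))" by (auto simp: X_def)
    then have "norm y \<le> \<bar>gagliardo s (v n)\<bar> + \<bar>pot (v n)\<bar>"
      using norm_Pair_le[of "gagliardo s (v n)" "pot (v n)"] by simp
    then show "norm y \<le> R"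
      using R[of n] gagliardo_nonneg[of s "v n"] pot_nonneg[of "v n"] by (simp add: N_eq)
  qed
  then obtain l \<sigma> where \<sigma>: "strict_mono \<sigma>" and l: "(X \<circ> \<sigma>) \<longlonglongrightarrow> l"
    using bounded_imp_convergent_subsequence by blast
  have "0 \<le> R" using R[of 0] N_nonneg[of "v 0"] by linarith
  then have "0 \<le> R + R / V0" using V0_pos by simp
  then obtain \<tau> w where \<tau>: "strict_mono \<tau>" and w: "w \<in> sobolev_ball s (R + R / V0)"
    and conv: "AE x in lborel. (\<lambda>n. v (\<sigma> (\<tau> n)) x) \<longlonglongrightarrow> w x"
    using sobolev_ball_AE_compact[of s "\<lambda>n. v (\<sigma> n)" "R + R / V0"] H_sobolev_ball[OF v R] s_pos
    by auto
  have subsequence: "(\<lambda>n. X (\<sigma> (\<tau> n))) \<longlonglongrightarrow> l" using LIMSEQ_subseq_LIMSEQ[OF l \<tau>] by (simp add: o_def)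
  have "(\<lambda>n. gagliardo s (v ((\<sigma> \<circ> \<tau>) n))) \<longlonglongrightarrow> fst l" "(\<lambda>n. pot (v ((\<sigma> \<circ> \<tau>) n))) \<longlonglongrightarrow> snd l"
    using tendsto_fst[OF subsequence] tendsto_snd[OF subsequence] by (simp_all add: X_def)
  moreover have "AE x in lborel. (\<lambda>n. v ((\<sigma> \<circ> \<tau>) n) x) \<longlonglongrightarrow> w x" using conv by simp
  ultimately show ?thesis
    using that[OF strict_mono_o[OF \<sigma> \<tau>] sobolev_ball_measurable[OF w]] by blast
qed

lemma H_bump: "bump x0 \<in> H"
proof -
  have "integrable (lborel \<Otimes>\<^sub>M lborel) (\<lambda>z. frac_kernel s z * (increment (bump x0) z)\<^sup>2)"
    using frac_energy_bump_finite[OF s_pos s_less_1, of x0]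
    by (intro integrableI_nonneg)
       (auto simp: frac_kernel_nonneg gagliardo_ennreal_eq simp flip: gagliardo_ennreal_eq_frac_energy)
  moreover have "integrable lborel (\<lambda>x. W x * (bump x0 x)\<^sup>2)"
  proof -
    have "bounded ((\<lambda>x. W x) ` cball x0 1)"
      by (intro compact_imp_bounded compact_continuous_image W_continuous) simp
    then obtain C where C: "\<And>x. x \<in> cball x0 1 \<Longrightarrow> \<bar>W x\<bar> \<le> C"
      unfolding bounded_iff by (metis imageI real_norm_def)
    have bound: "\<bar>W x * (bump x0 x)\<^sup>2\<bar> \<le> C * indicator (cball x0 1) x" for x
    proof (cases "x \<in> cball x0 1")
      case True
      have "(bump x0 x)\<^sup>2 \<le> 1" by (intro power_le_one bump_bounds)
      then have "\<bar>W x\<bar> * (bump x0 x)\<^sup>2 \<le> C * 1" using C[OF True] by (intro mult_mono) auto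
      then show ?thesis using True by (simp add: abs_mult)
    qed (simp add: bump_eq_0)
    show ?thesis
    proof (rule Bochner_Integration.integrable_bound)
      show "integrable lborel (\<lambda>x. C * indicator (cball x0 1) x)"
        using emeasure_lborel_cball_finite[of x0 1] by (simp add: integrable_indicator_iff)
      show "AE x in lborel. norm (W x * (bump x0 x)\<^sup>2) \<le> norm (C * indicator (cball x0 1) x)"
        using bound by (intro AE_I2) (metis abs_ge_self order_trans real_norm_def)
    qed measurable
  qed
  ultimately show ?thesis by (simp add: H_iff)
qed

end

section \<open>The nonlinearities\<close>

lemma primitive_nonpos: "t \<le> 0 \<Longrightarrow> primitive h t = 0"
  by (cases "t = 0") (auto simp: primitive_def)

lemma primitive_eq_integral:
  assumes cont: "continuous_on UNIV h" and h0: "\<And>t. t \<le> 0 \<Longrightarrow> h t = 0" and l: "l \<le> 0"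
  shows "primitive h x = integral {l..x} h"
proof (cases "x \<le> 0")
  case True
  have "integral {l..x} h = integral {l..x} (\<lambda>_. 0)"
    using True h0 by (intro Henstock_Kurzweil_Integration.integral_cong) auto
  then show ?thesis using True by (simp add: primitive_nonpos)
next
  case False
  have "integral {l..0} h + integral {0..x} h = integral {l..x} h"
    using False l continuous_on_subset[OF cont, of "{l..x}"]
    by (intro Henstock_Kurzweil_Integration.integral_combine integrable_continuous_real) auto
  moreover have "integral {l..0} h = integral {l..0} (\<lambda>_. 0)"
    using h0 by (intro Henstock_Kurzweil_Integration.integral_cong) auto
  ultimately show ?thesis by (simp add: primitive_def)
qed

lemma has_real_derivative_primitive:
  assumes cont: "continuous_on UNIV h" and h0: "\<And>t. t \<le> 0 \<Longrightarrow> h t = 0"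
  shows "(primitive h has_real_derivative h t) (at t)"
proof -
  define l where "l = min 0 t - 1"
  have l: "l \<le> 0" "l < t" by (auto simp: l_def)
  have "((\<lambda>x. integral {l..x} h) has_real_derivative h t) (at t within {l..t + 1})"
    using l cont by (intro integral_has_real_derivative continuous_on_subset[OF cont]) auto
  then have "((\<lambda>x. integral {l..x} h) has_real_derivative h t) (at t)"
    using l by (subst (asm) at_within_interior) (auto simp: interior_atLeastAtMost_real)
  moreover have "primitive h = (\<lambda>x. integral {l..x} h)"
    using primitive_eq_integral[OF assms l(1)] by blast
  ultimately show ?thesis by simp
qed

locale superquadratic_nonlinearity =
  fixes f :: "real \<Rightarrow> real" and q \<theta> :: real
  assumes f_cont: "continuous_on UNIV f"
    and f_neg: "\<And>t. t < 0 \<Longrightarrow> f t = 0"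
    and f_small: "((\<lambda>t. f t / t ^ 3) \<longlongrightarrow> 0) (at_right 0)"
    and q_gt_4: "4 < q" and f_subcritical: "((\<lambda>t. f t / t powr (q - 1)) \<longlongrightarrow> 0) at_top"
    and \<theta>_gt_4: "4 < \<theta>"
    and primitive_pos: "\<And>t. 0 < t \<Longrightarrow> 0 < \<theta> * primitive f t"
    and ambrosetti_rabinowitz: "\<And>t. 0 < t \<Longrightarrow> \<theta> * primitive f t \<le> f t * t"
    and f_over_cube_mono: "mono_on {0<..} (\<lambda>t. f t / t ^ 3)"
begin

lemma f_nonpos_zero: "t \<le> 0 \<Longrightarrow> f t = 0"
proof (cases "t = 0")
  case True
  have "isCont f 0" using f_cont by (simp add: continuous_on_eq_continuous_at)
  then have "(f \<longlongrightarrow> f 0) (at_left 0)" by (simp add: isCont_def filterlim_at_split)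
  moreover have "(f \<longlongrightarrow> 0) (at_left 0)"
    by (rule tendsto_eventually) (auto simp: eventually_at_filter f_neg)
  ultimately have "f 0 = 0" using tendsto_unique trivial_limit_at_left_real by blast
  then show ?thesis using True by simp
qed (use f_neg in auto)

lemma f_pos: "0 < t \<Longrightarrow> 0 < f t"
  using primitive_pos[of t] ambrosetti_rabinowitz[of t] by (metis less_le_trans zero_less_mult_pos2)

lemma f_nonneg: "0 \<le> f t"
  using f_pos[of t] f_nonpos_zero[of t] by (cases "0 < t") auto

lemma f_mult_nonneg: "0 \<le> f t * t"
  using f_nonneg[of t] f_nonpos_zero[of t] by (cases "0 \<le> t") auto

lemma f_over_cube_le: "0 < t1 \<Longrightarrow> t1 \<le> t2 \<Longrightarrow> f t1 / t1 ^ 3 \<le> f t2 / t2 ^ 3"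
  using f_over_cube_mono by (auto simp: mono_on_def)

lemma f_ratio_mono:
  assumes "0 < t1" "t1 \<le> t2"
  shows "f t1 / t1 \<le> f t2 / t2"
proof -
  have "f t1 / t1 = f t1 / t1 ^ 3 * t1\<^sup>2" using assms by (simp add: power2_eq_square power3_eq_cube)
  also have "\<dots> \<le> f t2 / t2 ^ 3 * t2\<^sup>2"
    using assms f_nonneg by (intro mult_mono f_over_cube_le power_mono) auto
  also have "\<dots> = f t2 / t2" using assms by (simp add: power2_eq_square power3_eq_cube)
  finally show ?thesis .
qed

lemma f_mono:
  assumes "t1 \<le> t2"
  shows "f t1 \<le> f t2"
proof (cases "0 < t1")
  case True
  have "f t1 = f t1 / t1 * t1" using True by simp
  also have "\<dots> \<le> f t2 / t2 * t2" using True assms f_nonneg by (intro mult_mono f_ratio_mono) auto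
  also have "\<dots> = f t2" using True assms by simp
  finally show ?thesis .
qed (use f_nonpos_zero f_nonneg in simp)

lemma f_le_near_zero:
  assumes "0 < \<delta>"
  obtains b where "0 < b" "\<And>t. 0 < t \<Longrightarrow> t < b \<Longrightarrow> f t \<le> \<delta> * t"
proof -
  have "eventually (\<lambda>t. f t / t ^ 3 < \<delta>) (at_right 0)" by (rule order_tendstoD(2)[OF f_small assms])
  then obtain b where b: "0 < b" "\<And>t. 0 < t \<Longrightarrow> t < b \<Longrightarrow> f t / t ^ 3 < \<delta>"
    unfolding eventually_at_right_field by auto
  have "f t \<le> \<delta> * t" if t: "0 < t" "t < min b 1" for t
  proof -
    have "f t \<le> \<delta> * t ^ 3" using b(2)[of t] t by (simp add: field_simps)
    also have "\<dots> \<le> \<delta> * t ^ 1" using t assms by (intro mult_left_mono power_decreasing) auto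
    finally show ?thesis by simp
  qed
  then show ?thesis using that[of "min b 1"] b(1) by auto
qed

lemma f_le_powr_away_from_zero:
  assumes b: "0 < b"
  obtains C where "0 < C" "\<And>t. b \<le> t \<Longrightarrow> f t \<le> C * t powr (q - 1)"
proof -
  have "eventually (\<lambda>t. f t / t powr (q - 1) < 1) at_top"
    using order_tendstoD(2)[OF f_subcritical, of 1] by simp
  then obtain T where T: "\<And>t. T \<le> t \<Longrightarrow> f t / t powr (q - 1) < 1"
    unfolding eventually_at_top_linorder by auto
  define C where "C = 1 + f T / b powr (q - 1)"
  have C: "1 \<le> C" using f_nonneg by (simp add: C_def)
  have "f t \<le> C * t powr (q - 1)" if t: "b \<le> t" for t
  proof (cases "t \<le> T")
    case True
    then have "f t \<le> f T" by (rule f_mono)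
    also have "\<dots> = f T / b powr (q - 1) * b powr (q - 1)" using b by simp
    also have "\<dots> \<le> C * t powr (q - 1)"
      using t b q_gt_4 f_nonneg by (intro mult_mono powr_mono2) (auto simp: C_def)
    finally show ?thesis .
  next
    case False
    then have "f t \<le> 1 * t powr (q - 1)" using T[of t] t b by (simp add: field_simps)
    also have "\<dots> \<le> C * t powr (q - 1)" using C by (intro mult_right_mono) auto
    finally show ?thesis .
  qed
  then show ?thesis using that[of C] C by simp
qed

lemma f_growth:
  assumes \<delta>: "0 < \<delta>"
  obtains C where "0 < C" "\<And>t. f t * t \<le> \<delta> * t\<^sup>2 + C * \<bar>t\<bar> powr q"
proof -
  obtain b where b: "0 < b" and small: "\<And>t. 0 < t \<Longrightarrow> t < b \<Longrightarrow> f t \<le> \<delta> * t"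
    using f_le_near_zero[OF \<delta>] by blast
  obtain C where C: "0 < C" and large: "\<And>t. b \<le> t \<Longrightarrow> f t \<le> C * t powr (q - 1)"
    using f_le_powr_away_from_zero[OF b] by blast
  have "f t * t \<le> \<delta> * t\<^sup>2 + C * \<bar>t\<bar> powr q" for t
  proof (cases "0 < t")
    case True
    then have "f t \<le> \<delta> * t + C * t powr (q - 1)"
      using small[of t] large[of t] C \<delta>
      by (cases "t < b") (auto intro: add_increasing add_increasing2)
    then have "f t * t \<le> (\<delta> * t + C * t powr (q - 1)) * t"
      using True by (intro mult_right_mono) auto
    also have "\<dots> = \<delta> * t\<^sup>2 + C * \<bar>t\<bar> powr q"
      using True by (simp add: power2_eq_square powr_diff algebra_simps)
    finally show ?thesis .
  qed (use C \<delta> in \<open>simp add: f_nonpos_zero\<close>)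
  then show ?thesis using that C by blast
qed

lemma primitive_f_deriv: "(primitive f has_real_derivative f t) (at t)"
  by (rule has_real_derivative_primitive[OF f_cont f_nonpos_zero])

lemma primitive_f_nonneg: "0 \<le> primitive f t"
  using primitive_pos[of t] \<theta>_gt_4
  by (cases "0 < t") (auto simp: zero_less_mult_iff primitive_nonpos)

lemma primitive_f_le: "4 * primitive f t \<le> f t * t"
proof (cases "0 < t")
  case True
  have "4 * primitive f t \<le> \<theta> * primitive f t"
    using \<theta>_gt_4 primitive_f_nonneg by (intro mult_right_mono) auto
  then show ?thesis using ambrosetti_rabinowitz[OF True] by linarith
qed (simp add: primitive_nonpos f_nonpos_zero)

lemma primitive_f_ge_powr:
  assumes t: "1 \<le> t"
  shows "primitive f 1 * t powr \<theta> \<le> primitive f t"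
proof -
  let ?h = "\<lambda>t. primitive f t * t powr (- \<theta>)"
  have "?h 1 \<le> ?h t"
  proof (rule DERIV_nonneg_imp_nondecreasing[OF t])
    fix x assume x: "1 \<le> x" "x \<le> t"
    have "x powr (- \<theta>) = x powr (- \<theta> - 1) * x" using x by (simp add: powr_diff)
    then have "f x * x powr (- \<theta>) + primitive f x * (- \<theta> * x powr (- \<theta> - 1))
        = x powr (- \<theta> - 1) * (f x * x - \<theta> * primitive f x)"
      by (simp add: algebra_simps)
    moreover have "(?h has_real_derivative
        f x * x powr (- \<theta>) + primitive f x * (- \<theta> * x powr (- \<theta> - 1))) (at x)"
      using x primitive_f_deriv[of x] by (auto intro!: derivative_eq_intros)
    moreover have "0 \<le> x powr (- \<theta> - 1) * (f x * x - \<theta> * primitive f x)"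
      using ambrosetti_rabinowitz[of x] x by auto
    ultimately show "\<exists>y. (?h has_real_derivative y) (at x) \<and> 0 \<le> y" by auto
  qed
  then have "primitive f 1 * t powr \<theta> \<le> primitive f t * t powr (- \<theta>) * t powr \<theta>"
    by (simp add: mult_right_mono)
  also have "\<dots> = primitive f t" using t by (simp add: powr_minus field_simps)
  finally show ?thesis .
qed

lemma f_superlinear:
  obtains T where "0 < T" "\<And>t. T \<le> t \<Longrightarrow> L \<le> f t / t ^ 3"
proof -
  define c where "c = \<theta> * primitive f 1"
  have c: "0 < c" unfolding c_def by (rule primitive_pos) simp
  define T where "T = max 1 ((\<bar>L\<bar> / c) powr (1 / (\<theta> - 4)))"
  have "L \<le> f t / t ^ 3" if t: "T \<le> t" for t
  proof -
    have "1 \<le> t" using t by (simp add: T_def)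
    have "\<bar>L\<bar> / c = ((\<bar>L\<bar> / c) powr (1 / (\<theta> - 4))) powr (\<theta> - 4)"
      using \<theta>_gt_4 c by (simp add: powr_powr)
    also have "\<dots> \<le> t powr (\<theta> - 4)" using t \<theta>_gt_4 by (intro powr_mono2) (auto simp: T_def)
    finally have "\<bar>L\<bar> \<le> c * t powr (\<theta> - 4)" using c by (simp add: field_simps)
    also have "\<dots> = c * t powr \<theta> / t ^ 4" using \<open>1 \<le> t\<close> by (simp add: powr_diff)
    also have "\<dots> \<le> f t * t / t ^ 4"
    proof (rule divide_right_mono)
      have "c * t powr \<theta> \<le> \<theta> * primitive f t"
        using primitive_f_ge_powr[OF \<open>1 \<le> t\<close>] \<theta>_gt_4 by (simp add: c_def mult.assoc)
      also have "\<dots> \<le> f t * t" using \<open>1 \<le> t\<close> by (intro ambrosetti_rabinowitz) simp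
      finally show "c * t powr \<theta> \<le> f t * t" .
    qed simp
    also have "\<dots> = f t / t ^ 3" using \<open>1 \<le> t\<close> by (simp add: power_eq_if)
    finally show ?thesis by linarith
  qed
  moreover have "0 < T" by (simp add: T_def)
  ultimately show ?thesis using that by blast
qed

lemma f_ray_mono:
  assumes t: "0 < t1" "t1 \<le> t2"
  shows "f (t1 * y) * y / t1 ^ 3 \<le> f (t2 * y) * y / t2 ^ 3"
proof (cases "0 < y")
  case True
  have rescale: "f (t * y) * y / t ^ 3 = f (t * y) / (t * y) ^ 3 * y ^ 4" if "0 < t" for t
    using True that by (simp add: power_mult_distrib power_eq_if)
  have "f (t1 * y) / (t1 * y) ^ 3 * y ^ 4 \<le> f (t2 * y) / (t2 * y) ^ 3 * y ^ 4"
    using t True by (intro mult_right_mono f_over_cube_le) auto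
  then show ?thesis using t rescale[of t1] rescale[of t2] by simp
next
  case False
  then have "t1 * y \<le> 0" "t2 * y \<le> 0" using t by (auto simp: mult_le_0_iff)
  then show ?thesis by (simp add: f_nonpos_zero)
qed

end

locale penalized_nonlinearity = superquadratic_nonlinearity +
  fixes V0 K a :: real
  assumes V0_pos: "0 < V0" and K_pos: "0 < K" and a_pos: "0 < a" and f_a: "f a = V0 / K * a"
begin

abbreviation "ft \<equiv> f_tilde f V0 K a"

lemma f_le_linear: "0 \<le> t \<Longrightarrow> t \<le> a \<Longrightarrow> f t \<le> V0 / K * t"
  using f_ratio_mono[of t a] f_a a_pos f_nonpos_zero[of 0]
  by (cases "t = 0") (auto simp: field_simps)

lemma f_ge_linear: "a \<le> t \<Longrightarrow> V0 / K * t \<le> f t"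
  using f_ratio_mono[of a t] f_a a_pos by (auto simp: field_simps)

lemma ft_cont: "continuous_on UNIV ft"
proof -
  have "continuous_on ({..a} \<union> {a..}) (\<lambda>t. if t \<le> a then f t else V0 / K * t)"
    using f_a by (intro continuous_on_If continuous_intros continuous_on_subset[OF f_cont]) auto
  moreover have "{..a} \<union> {a..} = UNIV" by auto
  ultimately show ?thesis by (simp add: f_tilde_def[abs_def])
qed

lemma ft_nonpos_zero: "t \<le> 0 \<Longrightarrow> ft t = 0"
  using a_pos by (simp add: f_tilde_def f_nonpos_zero)

lemma ft_nonneg: "0 \<le> ft t"
  using a_pos V0_pos K_pos by (simp add: f_tilde_def f_nonneg)

lemma ft_le_linear: "0 \<le> t \<Longrightarrow> ft t \<le> V0 / K * t"
  using f_le_linear[of t] by (simp add: f_tilde_def)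

lemma ft_le_f: "ft t \<le> f t"
  using f_ge_linear[of t] by (simp add: f_tilde_def)

lemma ft_mult_le: "ft t * t \<le> V0 / K * t\<^sup>2"
proof (cases "0 \<le> t")
  case True
  then have "ft t * t \<le> V0 / K * t * t" by (intro mult_right_mono ft_le_linear)
  then show ?thesis by (simp add: power2_eq_square)
qed (use V0_pos K_pos in \<open>simp add: ft_nonpos_zero\<close>)

lemma primitive_ft_deriv: "(primitive ft has_real_derivative ft t) (at t)"
  by (rule has_real_derivative_primitive[OF ft_cont ft_nonpos_zero])

lemma primitive_ft_nonneg: "0 \<le> primitive ft t"
  unfolding primitive_def by (cases "0 \<le> t")
    (auto intro!: Henstock_Kurzweil_Integration.integral_nonneg integrable_continuous_real
      continuous_on_subset[OF ft_cont] ft_nonneg)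

lemma primitive_ft_le: "primitive ft t \<le> V0 / (2 * K) * t\<^sup>2"
proof (cases "0 \<le> t")
  case True
  let ?gap = "\<lambda>t. V0 / (2 * K) * t\<^sup>2 - primitive ft t"
  have deriv: "(?gap has_real_derivative V0 / K * x - ft x) (at x)" for x
    using primitive_ft_deriv[of x] K_pos by (auto intro!: derivative_eq_intros)
  have "?gap 0 \<le> ?gap t"
  proof (rule DERIV_nonneg_imp_nondecreasing[where f = ?gap, OF True])
    fix x :: real assume "0 \<le> x"
    then show "\<exists>y. (?gap has_real_derivative y) (at x) \<and> 0 \<le> y"
      using deriv ft_le_linear[of x] by (intro exI[of _ "V0 / K * x - ft x"]) auto
  qed
  then show ?thesis by (simp add: primitive_nonpos)
qed (use V0_pos K_pos in \<open>simp add: primitive_nonpos\<close>)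

lemma ft_ray_le_linear:
  assumes t: "0 < t"
  shows "ft (t * y) * y / t ^ 3 \<le> V0 * y\<^sup>2 / (K * t\<^sup>2)"
proof -
  have "ft (t * y) * y / t ^ 3 = ft (t * y) * (t * y) / t ^ 4" using t by (simp add: power_eq_if)
  also have "\<dots> \<le> V0 / K * (t * y)\<^sup>2 / t ^ 4" by (intro divide_right_mono ft_mult_le) simp
  also have "\<dots> = V0 * y\<^sup>2 / (K * t\<^sup>2)" using t by (simp add: power_mult_distrib power_eq_if)
  finally show ?thesis .
qed

lemma ft_ray_eq_linear: "0 < t \<Longrightarrow> a < t * y \<Longrightarrow> ft (t * y) * y / t ^ 3 = V0 * y\<^sup>2 / (K * t\<^sup>2)"
  using K_pos by (simp add: f_tilde_def field_simps power2_eq_square power3_eq_cube)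

lemma inverse_square_ray_antimono:
  assumes "0 \<le> c" "0 < t1" "t1 \<le> t2"
  shows "c * y\<^sup>2 / (K * t2\<^sup>2) \<le> c * y\<^sup>2 / (K * t1\<^sup>2)"
  using assms K_pos by (intro divide_left_mono mult_left_mono power_mono) auto

text \<open>The quadratic part absorbs the failure of \<open>ft (t y) y / t\<^sup>3\<close> to be monotone beyond \<open>a\<close>.\<close>

lemma ft_ray_gap_antimono:
  assumes t: "0 < t1" "t1 \<le> t2"
  shows "V0 * y\<^sup>2 / (K * t2\<^sup>2) - ft (t2 * y) * y / t2 ^ 3
      \<le> V0 * y\<^sup>2 / (K * t1\<^sup>2) - ft (t1 * y) * y / t1 ^ 3"
proof (cases "a < t2 * y")
  case True
  then show ?thesis using ft_ray_eq_linear[of t2 y] ft_ray_le_linear[of t1 y] t by simp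
next
  case False
  have "t1 * y \<le> a"
  proof (cases "0 \<le> y")
    case True
    then have "t1 * y \<le> t2 * y" using t by (intro mult_right_mono) auto
    then show ?thesis using False by simp
  next
    case False
    then have "t1 * y \<le> 0" using t by (simp add: mult_le_0_iff)
    then show ?thesis using a_pos by simp
  qed
  then show ?thesis
    using False f_ray_mono[OF t, of y] inverse_square_ray_antimono[of V0 t1 t2 y] t V0_pos
    by (simp add: f_tilde_def)
qed

lemma ft_ray_antimono:
  assumes t: "0 < t1" "t1 \<le> t2" and w: "V0 \<le> w"
  shows "w * y\<^sup>2 / (K * t2\<^sup>2) - ft (t2 * y) * y / t2 ^ 3
      \<le> w * y\<^sup>2 / (K * t1\<^sup>2) - ft (t1 * y) * y / t1 ^ 3"
proof -
  have split: "w * y\<^sup>2 / (K * t\<^sup>2) = (w - V0) * y\<^sup>2 / (K * t\<^sup>2) + V0 * y\<^sup>2 / (K * t\<^sup>2)" for t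
    by (simp add: left_diff_distrib flip: add_divide_distrib)
  show ?thesis unfolding split[of t1] split[of t2]
    using inverse_square_ray_antimono[of "w - V0" t1 t2 y] ft_ray_gap_antimono[OF t, of y] t w
    by linarith
qed

end

locale kirchhoff_function =
  fixes M :: "real \<Rightarrow> real" and m0 :: real
  assumes M_cont: "continuous_on {0..} M" and m0_pos: "0 < m0" and M_ge: "\<And>t. 0 \<le> t \<Longrightarrow> m0 \<le> M t"
    and M_over_t: "\<And>t1 t2. t2 \<le> t1 \<Longrightarrow> 0 < t2 \<Longrightarrow> M t1 / t1 - M t2 / t2 \<le> m0 * (1 / t1 - 1 / t2)"
begin

lemma M_excess_ratio_antimono: "0 < t2 \<Longrightarrow> t2 \<le> t1 \<Longrightarrow> (M t1 - m0) / t1 \<le> (M t2 - m0) / t2"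
  using M_over_t[of t2 t1] by (simp add: diff_divide_distrib algebra_simps)

lemma M_scale_le:
  assumes c: "1 \<le> c" and t: "0 < t"
  shows "M (c * t) \<le> c * M t"
proof -
  have "t \<le> c * t" using c t by simp
  then have "(M (c * t) - m0) / (c * t) \<le> (M t - m0) / t" by (intro M_excess_ratio_antimono t)
  then have "M (c * t) - m0 \<le> (M t - m0) / t * (c * t)"
    using c t by (subst (asm) pos_divide_le_eq) auto
  also have "\<dots> = c * (M t - m0)" using t by simp
  finally have "M (c * t) - m0 \<le> c * (M t - m0)" .
  moreover have "1 * m0 \<le> c * m0" using c m0_pos by (intro mult_right_mono) auto
  ultimately show ?thesis by (simp add: right_diff_distrib)
qed

lemma M_cont_on: "continuous_on {0..t} M"
  using M_cont by (rule continuous_on_subset) auto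

lemma Mhat_deriv:
  assumes "0 < t"
  shows "(Mhat M has_real_derivative M t) (at t)"
proof -
  have "((\<lambda>x. integral {0..x} M) has_real_derivative M t) (at t within {0..t + 1})"
    using assms by (intro integral_has_real_derivative M_cont_on) auto
  then show ?thesis unfolding Mhat_def[abs_def]
    using assms by (subst (asm) at_within_interior) (auto simp: interior_atLeastAtMost_real)
qed

lemma Mhat_excess_mono:
  assumes "0 \<le> x" "x \<le> y"
  shows "Mhat M x - m0 * x \<le> Mhat M y - m0 * y"
proof -
  have "integral {0..x} M + integral {x..y} M = integral {0..y} M"
    using assms
    by (intro Henstock_Kurzweil_Integration.integral_combine integrable_continuous_real
        M_cont_on) auto
  moreover have "integral {x..y} (\<lambda>_. m0) \<le> integral {x..y} M"
    using assms M_ge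
    by (intro Henstock_Kurzweil_Integration.integral_le integrable_continuous_real
        continuous_on_subset[OF M_cont]) auto
  ultimately show ?thesis using assms by (simp add: Mhat_def algebra_simps)
qed

lemma Mhat_mono: "0 \<le> x \<Longrightarrow> x \<le> y \<Longrightarrow> Mhat M x \<le> Mhat M y"
  using Mhat_excess_mono[of x y] m0_pos mult_left_mono[of x y m0] by linarith

lemma Mhat_cont: "continuous_on {0..} (Mhat M)"
  unfolding continuous_on_eq_continuous_within
proof
  fix x :: real assume x: "x \<in> {0..}"
  have "continuous_on {0..x + 1} (Mhat M)"
    unfolding Mhat_def[abs_def]
    by (intro indefinite_integral_continuous_1 integrable_continuous_real M_cont_on)
  then have "continuous (at x within {0..x + 1}) (Mhat M)"
    using x by (simp add: continuous_on_eq_continuous_within)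
  moreover have "at x within {0..x + 1} = at x within {0..}"
    by (rule at_within_nhd[of x "{..<x + 1}"]) auto
  ultimately show "continuous (at x within {0..}) (Mhat M)" by simp
qed

lemma M_ge_chord:
  assumes "0 < t" "0 \<le> x" "x \<le> t"
  shows "m0 + (M t - m0) / t * x \<le> M x"
proof (cases "x = 0")
  case False
  then have "(M t - m0) / t \<le> (M x - m0) / x" using assms by (intro M_excess_ratio_antimono) auto
  then show ?thesis using False assms by (simp add: field_simps)
qed (use M_ge[of 0] in simp)

lemma Mhat_lower:
  assumes t: "0 < t"
  shows "(M t + m0) / 2 * t \<le> Mhat M t"
proof -
  have "((\<lambda>x. m0 * x + (M t - m0) / t * (x\<^sup>2 / 2))
      has_real_derivative m0 + (M t - m0) / t * x) (at x within {0..t})" for x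
    using t by (auto intro!: derivative_eq_intros)
  then have chord: "((\<lambda>x. m0 + (M t - m0) / t * x) has_integral
      (m0 * t + (M t - m0) / t * (t\<^sup>2 / 2) - (m0 * 0 + (M t - m0) / t * (0\<^sup>2 / 2)))) {0..t}"
    using t
    by (intro fundamental_theorem_of_calculus)
       (auto simp: has_real_derivative_iff_has_vector_derivative)
  have "(M t + m0) / 2 * t = integral {0..t} (\<lambda>x. m0 + (M t - m0) / t * x)"
    using integral_unique[OF chord] t by (simp add: power2_eq_square field_simps)
  also have "\<dots> \<le> integral {0..t} M"
    using chord t M_ge_chord
    by (intro Henstock_Kurzweil_Integration.integral_le integrable_continuous_real M_cont_on)
       (auto intro!: continuous_intros)
  finally show ?thesis by (simp add: Mhat_def)
qed

end

section \<open>The energy functional\<close>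

locale kirchhoff_problem =
  weighted_space s V \<epsilon> V0 + penalized_nonlinearity f q \<theta> V0 K a + kirchhoff_function M m0
  for s :: real and V :: "R3 \<Rightarrow> real" and \<epsilon> V0 :: real and f :: "real \<Rightarrow> real" and q \<theta> K a :: real
    and M :: "real \<Rightarrow> real" and m0 :: real +
  fixes B :: "R3 set"
  assumes q_subcritical: "q < critical_exponent 3 s"
    and B_measurable [measurable]: "B \<in> sets borel" and B_finite: "emeasure lborel B < \<infinity>"
    and K_large: "2 / m0 < K"
begin

definition g :: "R3 \<Rightarrow> real \<Rightarrow> real" where
  "g x t = (if x \<in> B then f t else ft t)"

definition G :: "R3 \<Rightarrow> real \<Rightarrow> real" where
  "G x t = (if x \<in> B then primitive f t else primitive ft t)"

definition \<Psi> :: "(R3 \<Rightarrow> real) \<Rightarrow> real" where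
  "\<Psi> u = (LBINT x. G x (u x))"

definition d\<Psi> :: "(R3 \<Rightarrow> real) \<Rightarrow> (R3 \<Rightarrow> real) \<Rightarrow> real" where
  "d\<Psi> u v = (LBINT x. g x (u x) * v x)"

definition J :: "(R3 \<Rightarrow> real) \<Rightarrow> real" where
  "J u = 1/2 * Mhat M (N u) - \<Psi> u"

definition dJ :: "(R3 \<Rightarrow> real) \<Rightarrow> (R3 \<Rightarrow> real) \<Rightarrow> real" where
  "dJ u v = M (N u) * inner_eps u v - d\<Psi> u v"

lemma q_ge_2: "2 \<le> q"
  using q_gt_4 by simp

lemma inverse_K: "1 / K < m0 / 2"
  using K_large m0_pos K_pos by (simp add: field_simps)

lemma H_powr_q_integrable: "u \<in> H \<Longrightarrow> integrable lborel (\<lambda>x. \<bar>u x\<bar> powr q)"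
  by (rule H_powr_integrable[OF q_ge_2 q_subcritical])

lemma primitive_f_cont: "continuous_on UNIV (primitive f)"
  using primitive_f_deriv DERIV_isCont by (simp add: continuous_on_eq_continuous_at) blast

lemma primitive_ft_cont: "continuous_on UNIV (primitive ft)"
  using primitive_ft_deriv DERIV_isCont by (simp add: continuous_on_eq_continuous_at) blast

lemma f_measurable [measurable]: "f \<in> borel_measurable borel"
  and ft_measurable [measurable]: "ft \<in> borel_measurable borel"
  and primitive_f_measurable [measurable]: "primitive f \<in> borel_measurable borel"
  and primitive_ft_measurable [measurable]: "primitive ft \<in> borel_measurable borel"
  by (intro borel_measurable_continuous_onI f_cont ft_cont primitive_f_cont primitive_ft_cont)+

lemma g_measurable [measurable]:
  assumes [measurable]: "u \<in> borel_measurable borel"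
  shows "(\<lambda>x. g x (u x)) \<in> borel_measurable borel"
  unfolding g_def using B_measurable by measurable

lemma G_measurable [measurable]:
  assumes [measurable]: "u \<in> borel_measurable borel"
  shows "(\<lambda>x. G x (u x)) \<in> borel_measurable borel"
  unfolding G_def using B_measurable by measurable

lemma g_nonneg: "0 \<le> g x t"
  by (simp add: g_def f_nonneg ft_nonneg)

lemma g_le_f: "g x t \<le> f t"
  by (simp add: g_def ft_le_f)

lemma g_nonpos_zero: "t \<le> 0 \<Longrightarrow> g x t = 0"
  by (simp add: g_def f_nonpos_zero ft_nonpos_zero)

lemma g_cont: "isCont (g x) t"
  using f_cont ft_cont by (cases "x \<in> B") (auto simp: g_def[abs_def] continuous_on_eq_continuous_at)

lemma G_deriv: "(G x has_real_derivative g x t) (at t)"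
  using primitive_f_deriv primitive_ft_deriv by (cases "x \<in> B") (auto simp: G_def[abs_def] g_def)

lemma G_0: "G x 0 = 0"
  by (simp add: G_def primitive_nonpos)

lemma G_pos_part: "G x (max 0 t) = G x t"
  by (cases "t \<le> 0") (auto simp: G_def primitive_nonpos max_def)

lemma g_mult_le_f: "0 \<le> c \<Longrightarrow> g x (c * t) * t \<le> f (c * t) * t"
  using g_le_f[of x "c * t"] g_nonpos_zero[of "c * t" x] f_nonpos_zero[of "c * t"]
  by (cases "0 \<le> t") (auto intro: mult_right_mono simp: mult_nonneg_nonpos)

lemma g_mult_nonneg: "0 \<le> c \<Longrightarrow> 0 \<le> g x (c * t) * t"
  using g_nonneg[of x "c * t"] g_nonpos_zero[of "c * t" x]
  by (cases "0 \<le> t") (auto simp: mult_nonneg_nonpos)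

lemma g_mult_le_penalized: "g x t * t \<le> indicator B x * (f t * t) + 1 / K * (W x * t\<^sup>2)"
proof -
  have "V0 / K * t\<^sup>2 \<le> 1 / K * (W x * t\<^sup>2)"
    using K_pos V_ge[of "\<epsilon> *\<^sub>R x"] by (simp add: divide_right_mono mult_right_mono)
  moreover have "0 \<le> 1 / K * (W x * t\<^sup>2)" using K_pos W_nonneg[of x] by simp
  ultimately show ?thesis using ft_mult_le[of t] by (auto simp: g_def indicator_def)
qed

lemma g_abs_le: "\<bar>t\<bar> \<le> U \<Longrightarrow> \<bar>g x t\<bar> \<le> f U"
  using g_nonneg[of x t] g_le_f[of x t] f_mono[OF abs_le_D1[of t U]] by simp

lemma g_dominated: "\<bar>t\<bar> \<le> U \<Longrightarrow> \<bar>w\<bar> \<le> U \<Longrightarrow> \<bar>g x t * w\<bar> \<le> f U * U"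
  unfolding abs_mult using g_abs_le[of t U x] f_nonneg[of U] by (intro mult_mono) auto

lemma G_lipschitz:
  assumes "\<bar>y\<bar> \<le> U" "\<bar>z\<bar> \<le> U"
  shows "\<bar>G x y - G x z\<bar> \<le> f U * \<bar>y - z\<bar>"
proof -
  have "norm (G x y - G x z) \<le> f U * norm (y - z)"
  proof (rule field_differentiable_bound[of "{-U..U}"])
    fix t assume "t \<in> {-U..U}"
    then show "norm (g x t) \<le> f U" using g_abs_le[of t U x] by auto
    show "(G x has_field_derivative g x t) (at t within {-U..U})"
      by (rule has_field_derivative_at_within[OF G_deriv])
  qed (use assms in auto)
  then show ?thesis by simp
qed

lemma integrable_if_majorized:
  assumes U: "U \<in> H" "\<And>x. 0 \<le> U x" and h: "h \<in> borel_measurable borel" "\<And>x. \<bar>h x\<bar> \<le> f (U x) * U x"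
  shows "integrable lborel h"
proof -
  obtain C where C: "\<And>t. f t * t \<le> 1 * t\<^sup>2 + C * \<bar>t\<bar> powr q" using f_growth[of 1] by auto
  show ?thesis
  proof (rule Bochner_Integration.integrable_bound)
    show "integrable lborel (\<lambda>x. (U x)\<^sup>2 + C * \<bar>U x\<bar> powr q)"
      using H_square[OF U(1)] H_powr_q_integrable[OF U(1)] by auto
    have "\<bar>h x\<bar> \<le> (U x)\<^sup>2 + C * \<bar>U x\<bar> powr q" for x using h(2)[of x] C[of "U x"] by simp
    then show "AE x in lborel. norm (h x) \<le> norm ((U x)\<^sup>2 + C * \<bar>U x\<bar> powr q)"
      by (intro AE_I2) (metis abs_ge_self order_trans real_norm_def)
  qed (use h in simp)
qed

lemma majorant_integrable:
  assumes "U \<in> H" "\<And>x. 0 \<le> U x"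
  shows "integrable lborel (\<lambda>x. f (U x) * U x)"
proof (rule integrable_if_majorized[OF assms])
  note [measurable] = H_measurable[OF assms(1)]
  show "(\<lambda>x. f (U x) * U x) \<in> borel_measurable borel" by measurable
  show "\<bar>f (U x) * U x\<bar> \<le> f (U x) * U x" for x using f_nonneg assms(2)[of x] by simp
qed

lemma H_abs_sum:
  assumes "u \<in> H" "v \<in> H"
  shows "(\<lambda>x. c * \<bar>u x\<bar> + d * \<bar>v x\<bar>) \<in> H"
  by (intro H_linear H_abs assms)

lemma g_integrable:
  assumes "u \<in> H" "v \<in> H"
  shows "integrable lborel (\<lambda>x. g x (u x) * v x)"
proof (rule integrable_if_majorized)
  note [measurable] = assms[THEN H_measurable]
  show "(\<lambda>x. g x (u x) * v x) \<in> borel_measurable borel" by measurable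
  show "(\<lambda>x. 1 * \<bar>u x\<bar> + 1 * \<bar>v x\<bar>) \<in> H" by (rule H_abs_sum[OF assms])
qed (auto intro!: g_dominated)

lemma G_integrable:
  assumes "u \<in> H"
  shows "integrable lborel (\<lambda>x. G x (u x))"
proof (rule integrable_if_majorized[OF H_abs[OF assms]])
  note [measurable] = H_measurable[OF assms]
  show "(\<lambda>x. G x (u x)) \<in> borel_measurable borel" by measurable
  show "\<bar>G x (u x)\<bar> \<le> f \<bar>u x\<bar> * \<bar>u x\<bar>" for x
    using G_lipschitz[of "u x" "\<bar>u x\<bar>" 0 x] by (simp add: G_0)
qed simp

lemma f_local_integrable:
  assumes "u \<in> H"
  shows "integrable lborel (\<lambda>x. indicator B x * (f (u x) * u x))"
proof (rule integrable_if_majorized[OF H_abs[OF assms]])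
  note [measurable] = H_measurable[OF assms] B_measurable
  show "(\<lambda>x. indicator B x * (f (u x) * u x)) \<in> borel_measurable borel" by measurable
  show "\<bar>indicator B x * (f (u x) * u x)\<bar> \<le> f \<bar>u x\<bar> * \<bar>u x\<bar>" for x
    using f_mono[of "u x" "\<bar>u x\<bar>"] f_nonneg
    by (auto simp: indicator_def abs_mult intro!: mult_right_mono)
qed simp

lemma d\<Psi>_continuous:
  assumes u: "u \<in> H" and v: "v \<in> H" and w: "w \<in> H"
  shows "continuous_on UNIV (\<lambda>p. d\<Psi> (\<lambda>x. fst p * u x + snd p * v x) w)"
  unfolding continuous_on_sequentially
proof clarsimp
  fix X :: "nat \<Rightarrow> real \<times> real" and \<alpha> \<beta> assume X: "X \<longlonglongrightarrow> (\<alpha>, \<beta>)"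
  note [measurable] = H_measurable[OF u] H_measurable[OF v] H_measurable[OF w]
  have "Bseq X" using X convergentI convergent_imp_Bseq by blast
  then obtain d where d: "0 < d" "\<And>n. norm (X n) \<le> d" unfolding Bseq_def by auto
  have X_le: "\<bar>fst (X n)\<bar> \<le> d" "\<bar>snd (X n)\<bar> \<le> d" for n
    using d(2)[of n] norm_fst_le[of "fst (X n)" "snd (X n)"] norm_snd_le[of "snd (X n)" "fst (X n)"]
    by auto
  define U where "U x = d * (1 * \<bar>u x\<bar> + 1 * \<bar>v x\<bar>) + 1 * \<bar>w x\<bar>" for x
  have U: "U \<in> H" unfolding U_def by (intro H_linear H_abs u v w)
  have bound: "\<bar>fst (X n) * u x + snd (X n) * v x\<bar> \<le> U x" "\<bar>w x\<bar> \<le> U x" for n x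
  proof -
    have "\<bar>fst (X n) * u x + snd (X n) * v x\<bar> \<le> \<bar>fst (X n)\<bar> * \<bar>u x\<bar> + \<bar>snd (X n)\<bar> * \<bar>v x\<bar>"
      using abs_triangle_ineq[of "fst (X n) * u x" "snd (X n) * v x"] by (simp add: abs_mult)
    also have "\<dots> \<le> d * \<bar>u x\<bar> + d * \<bar>v x\<bar>" by (intro add_mono mult_right_mono X_le) auto
    also have "\<dots> \<le> U x" by (simp add: U_def distrib_left)
    finally show "\<bar>fst (X n) * u x + snd (X n) * v x\<bar> \<le> U x" .
    show "\<bar>w x\<bar> \<le> U x" using d(1) by (simp add: U_def)
  qed
  have "(\<lambda>n. d\<Psi> (\<lambda>x. fst (X n) * u x + snd (X n) * v x) w) \<longlonglongrightarrow> d\<Psi> (\<lambda>x. \<alpha> * u x + \<beta> * v x) w"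
    unfolding d\<Psi>_def
  proof (rule integral_dominated_convergence[where w = "\<lambda>x. f (U x) * U x"])
    show "integrable lborel (\<lambda>x. f (U x) * U x)"
      using d(1) by (intro majorant_integrable[OF U]) (simp add: U_def)
    show "AE x in lborel. norm (g x (fst (X n) * u x + snd (X n) * v x) * w x)
        \<le> f (U x) * U x" for n
      using g_dominated bound by (intro AE_I2) simp
    show "AE x in lborel. (\<lambda>n. g x (fst (X n) * u x + snd (X n) * v x) * w x)
        \<longlonglongrightarrow> g x (\<alpha> * u x + \<beta> * v x) * w x"
      using tendsto_fst[OF X] tendsto_snd[OF X]
      by (intro AE_I2 tendsto_mult_right isCont_tendsto_compose[OF g_cont] tendsto_intros) auto
  qed measurable
  then show "((\<lambda>p. d\<Psi> (\<lambda>x. fst p * u x + snd p * v x) w) \<circ> X) \<longlonglongrightarrow> d\<Psi> (\<lambda>x. \<alpha> * u x + \<beta> * v x) w"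
    by (simp add: o_def)
qed

lemma dJ_continuous:
  assumes u: "u \<in> H" and v: "v \<in> H" and w: "w \<in> H"
  shows "continuous_on UNIV (\<lambda>p. dJ (\<lambda>x. fst p * u x + snd p * v x) w)"
proof -
  have M_clamp: "continuous_on UNIV (\<lambda>t. M (max 0 t))"
    by (rule continuous_on_compose2[OF M_cont]) (auto intro!: continuous_intros)
  have "dJ (\<lambda>x. fst p * u x + snd p * v x) w =
      M (max 0 ((fst p)\<^sup>2 * N u + 2 * fst p * snd p * inner_eps u v + (snd p)\<^sup>2 * N v))
        * (fst p * inner_eps u w + snd p * inner_eps v w)
      - d\<Psi> (\<lambda>x. fst p * u x + snd p * v x) w" for p
    using N_nonneg[of "\<lambda>x. fst p * u x + snd p * v x"]
    by (simp add: dJ_def inner_linear[OF u v w] N_linear[OF u v] max_absorb2)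
  then show ?thesis
    by (simp only:)
       (intro continuous_intros d\<Psi>_continuous u v w continuous_on_compose2[OF M_clamp], auto)
qed

lemma \<Psi>_deriv:
  assumes u: "u \<in> H" and v: "v \<in> H"
  shows "((\<lambda>t. \<Psi> (\<lambda>x. u x + t * v x)) has_real_derivative d\<Psi> u v) (at 0)"
  unfolding \<Psi>_def d\<Psi>_def
proof (rule has_real_derivative_integral_dominated)
  note [measurable] = H_measurable[OF u] H_measurable[OF v]
  define U where "U x = 1 * \<bar>u x\<bar> + 1 * \<bar>v x\<bar>" for x
  show "(\<lambda>x. g x (u x) * v x) \<in> borel_measurable lborel" by measurable
  show "integrable lborel (\<lambda>x. G x (u x + t * v x))" for t
    by (rule G_integrable[OF H_add_scale[OF u v]])
  show "((\<lambda>t. G x (u x + t * v x)) has_real_derivative g x (u x) * v x) (at 0)" for x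
    by (rule DERIV_chain'[where f = "\<lambda>t. u x + t * v x" and g = "G x", THEN DERIV_cong])
       (auto intro!: derivative_eq_intros G_deriv[THEN DERIV_cong])
  show "integrable lborel (\<lambda>x. f (U x) * U x)"
    unfolding U_def by (intro majorant_integrable H_abs_sum u v) auto
  show "\<bar>G x (u x + t * v x) - G x (u x + 0 * v x)\<bar> \<le> f (U x) * U x * \<bar>t - 0\<bar>"
    if t: "\<bar>t - 0\<bar> \<le> 1" for t x
  proof -
    have "\<bar>t * v x\<bar> \<le> 1 * \<bar>v x\<bar>" unfolding abs_mult using t by (intro mult_right_mono) auto
    then have "\<bar>u x + t * v x\<bar> \<le> U x" "\<bar>u x\<bar> \<le> U x" "\<bar>v x\<bar> \<le> U x" by (auto simp: U_def)
    then have "\<bar>G x (u x + t * v x) - G x (u x)\<bar> \<le> f (U x) * \<bar>(u x + t * v x) - u x\<bar>"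
      by (intro G_lipschitz)
    also have "\<dots> = f (U x) * \<bar>v x\<bar> * \<bar>t\<bar>" by (simp add: abs_mult)
    also have "\<dots> \<le> f (U x) * U x * \<bar>t\<bar>"
      using \<open>\<bar>v x\<bar> \<le> U x\<close> f_nonneg by (intro mult_right_mono mult_left_mono) auto
    finally show ?thesis by simp
  qed
qed

lemma J_deriv_at_0:
  assumes u: "u \<in> H" and v: "v \<in> H" and N: "0 < N u"
  shows "((\<lambda>t. J (\<lambda>x. u x + t * v x)) has_real_derivative dJ u v) (at 0)"
proof -
  have N_line: "N (\<lambda>x. u x + t * v x) = N u + 2 * t * inner_eps u v + t\<^sup>2 * N v" for t
    using N_linear[OF u v, of 1 t] by simp
  have "((\<lambda>t. Mhat M (N u + 2 * t * inner_eps u v + t\<^sup>2 * N v))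
      has_real_derivative M (N u) * (2 * inner_eps u v)) (at 0)"
    by (rule DERIV_chain'[where f = "\<lambda>t. N u + 2 * t * inner_eps u v + t\<^sup>2 * N v"
          and g = "Mhat M", THEN DERIV_cong])
       (auto intro!: derivative_eq_intros Mhat_deriv[OF N, THEN DERIV_cong])
  then have "((\<lambda>t. 1/2 * Mhat M (N u + 2 * t * inner_eps u v + t\<^sup>2 * N v) - \<Psi> (\<lambda>x. u x + t * v x))
      has_real_derivative 1/2 * (M (N u) * (2 * inner_eps u v)) - d\<Psi> u v) (at 0)"
    by (intro derivative_intros \<Psi>_deriv u v DERIV_cmult)
  then show ?thesis by (simp add: J_def N_line dJ_def)
qed

lemma J_deriv:
  assumes u: "u \<in> H" and v: "v \<in> H" and N: "0 < N (\<lambda>x. u x + t * v x)"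
  shows "((\<lambda>t. J (\<lambda>x. u x + t * v x)) has_real_derivative dJ (\<lambda>x. u x + t * v x) v) (at t)"
proof -
  have "((\<lambda>h. J (\<lambda>x. (u x + t * v x) + h * v x)) has_real_derivative dJ (\<lambda>x. u x + t * v x) v) (at 0)"
    by (rule J_deriv_at_0[OF H_add_scale[OF u v] v N])
  then have "((\<lambda>h. J (\<lambda>x. u x + (h + t) * v x)) has_real_derivative dJ (\<lambda>x. u x + t * v x) v) (at 0)"
    by (simp add: algebra_simps)
  then show ?thesis using DERIV_shift[of "\<lambda>t. J (\<lambda>x. u x + t * v x)" _ 0 t] by simp
qed

lemma d\<Psi>_linear:
  assumes z: "z \<in> H" and u: "u \<in> H" and v: "v \<in> H"
  shows "d\<Psi> z (\<lambda>x. \<alpha> * u x + \<beta> * v x) = \<alpha> * d\<Psi> z u + \<beta> * d\<Psi> z v"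
proof -
  have "g x (z x) * (\<alpha> * u x + \<beta> * v x) = \<alpha> * (g x (z x) * u x) + \<beta> * (g x (z x) * v x)" for x
    by (simp add: algebra_simps)
  then show ?thesis
    unfolding d\<Psi>_def using g_integrable[OF z u] g_integrable[OF z v] by (simp only:) simp
qed

lemma dJ_linear:
  assumes z: "z \<in> H" and u: "u \<in> H" and v: "v \<in> H"
  shows "dJ z (\<lambda>x. \<alpha> * u x + \<beta> * v x) = \<alpha> * dJ z u + \<beta> * dJ z v"
  unfolding dJ_def d\<Psi>_linear[OF z u v] inner_commute[of z "\<lambda>x. \<alpha> * u x + \<beta> * v x"]
    inner_linear[OF u v z]
  by (simp add: inner_commute[of _ z] algebra_simps)

lemma dJ_self: "u \<in> H \<Longrightarrow> dJ u u = M (N u) * N u - d\<Psi> u u"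
  by (simp add: dJ_def N_inner)

section \<open>The Nehari set\<close>

lemma nehari_eq: "nehari H J = {u \<in> H. 0 < N u \<and> dJ u u = 0}"
proof -
  have "J_dir_deriv J u u 0 \<longleftrightarrow> dJ u u = 0" if "u \<in> H" "0 < N u" for u
    using J_deriv_at_0[OF that(1,1,2)] by (auto simp: J_dir_deriv_def dest: DERIV_unique)
  then show ?thesis unfolding nehari_def using nontrivial_iff by auto
qed

lemma
  assumes "u \<in> nehari H J"
  shows nehari_H: "u \<in> H" and nehari_N_pos: "0 < N u" and nehari_dJ: "dJ u u = 0"
    and nehari_d\<Psi>: "d\<Psi> u u = M (N u) * N u"
  using assms dJ_self[of u] by (auto simp: nehari_eq)

lemma dJ_ray:
  assumes u: "u \<in> H"
  shows "dJ (\<lambda>x. t * u x) u = M (t\<^sup>2 * N u) * (t * N u) - d\<Psi> (\<lambda>x. t * u x) u"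
  using inner_linear[OF u u u, of t 0] by (simp add: dJ_def N_scale[OF u] N_inner[OF u])

lemma dJ_ray_scale:
  assumes u: "u \<in> H"
  shows "dJ (\<lambda>x. t * u x) (\<lambda>x. t * u x) = t * dJ (\<lambda>x. t * u x) u"
  using dJ_linear[OF H_scale[OF u] u u, of t t 0] by simp

lemma dJ_ray_continuous:
  assumes u: "u \<in> H"
  shows "continuous_on A (\<lambda>t. dJ (\<lambda>x. t * u x) u)"
proof -
  have "continuous_on A (\<lambda>t. dJ (\<lambda>x. fst (t, 0 :: real) * u x + snd (t, 0 :: real) * u x) u)"
    by (rule continuous_on_compose2[OF dJ_continuous[OF u u u]]) (auto intro!: continuous_intros)
  then show ?thesis by simp
qed

lemma penalized_ray_antimono:
  assumes u: "u \<in> H" and t: "0 < t1" "t1 \<le> t2"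
  shows "pot u / (K * t2\<^sup>2) - d\<Psi> (\<lambda>x. t2 * u x) u / t2 ^ 3
      \<le> pot u / (K * t1\<^sup>2) - d\<Psi> (\<lambda>x. t1 * u x) u / t1 ^ 3"
proof -
  let ?p = "\<lambda>t x. W x * (u x)\<^sup>2 / (K * t\<^sup>2) - g x (t * u x) * u x / t ^ 3"
  have integrable: "integrable lborel (?p t)"
    and integral: "(LBINT x. ?p t x) = pot u / (K * t\<^sup>2) - d\<Psi> (\<lambda>x. t * u x) u / t ^ 3" for t
    using H_pot[OF u] g_integrable[OF H_scale[OF u] u, of t] by (simp_all add: pot_eq[OF u] d\<Psi>_def)
  have "?p t2 x \<le> ?p t1 x" for x
    using f_ray_mono[OF t, of "u x"] inverse_square_ray_antimono[OF W_nonneg t, of x "u x"]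
      ft_ray_antimono[OF t V_ge, of "\<epsilon> *\<^sub>R x" "u x"]
    by (auto simp: g_def)
  then have "(LBINT x. ?p t2 x) \<le> (LBINT x. ?p t1 x)"
    by (intro Bochner_Integration.integral_mono integrable)
  then show ?thesis by (simp only: integral)
qed

lemma dJ_ray_decomposition:
  assumes u: "u \<in> H" and N: "0 < N u" and t: "0 < t"
  shows "dJ (\<lambda>x. t * u x) u / t ^ 3 = (M (t\<^sup>2 * N u) - m0) / (t\<^sup>2 * N u) * (N u)\<^sup>2
    + ((m0 - 1 / K) * N u + gagliardo s u / K) / t\<^sup>2 + (pot u / (K * t\<^sup>2) - d\<Psi> (\<lambda>x. t * u x) u / t ^ 3)"
proof -
  define n where "n = N u"
  have "dJ (\<lambda>x. t * u x) u / t ^ 3 = M (t\<^sup>2 * n) * n / t\<^sup>2 - d\<Psi> (\<lambda>x. t * u x) u / t ^ 3"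
    using t by (simp add: dJ_ray[OF u] n_def diff_divide_distrib power2_eq_square power3_eq_cube)
  moreover have "M (t\<^sup>2 * n) * n / t\<^sup>2 = (M (t\<^sup>2 * n) - m0) / (t\<^sup>2 * n) * n\<^sup>2
      + ((m0 - 1 / K) * n + gagliardo s u / K) / t\<^sup>2 + pot u / (K * t\<^sup>2)"
  proof -
    have "(M (t\<^sup>2 * n) - m0) / (t\<^sup>2 * n) * n\<^sup>2 = (M (t\<^sup>2 * n) - m0) * n / t\<^sup>2"
      using N t by (simp add: n_def power2_eq_square)
    moreover have "pot u / (K * t\<^sup>2) = (1 / K * n - gagliardo s u / K) / t\<^sup>2"
      by (simp add: n_def N_eq diff_divide_distrib add_divide_distrib)
    ultimately show ?thesis by (simp add: algebra_simps flip: add_divide_distrib)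
  qed
  ultimately show ?thesis by (simp add: n_def)
qed

lemma dJ_ray_decreasing:
  assumes u: "u \<in> H" and N: "0 < N u" and t: "0 < t1" "t1 < t2"
  shows "dJ (\<lambda>x. t2 * u x) u / t2 ^ 3 < dJ (\<lambda>x. t1 * u x) u / t1 ^ 3"
proof -
  have squares: "0 < t1\<^sup>2" "t1\<^sup>2 < t2\<^sup>2" using t by (auto intro: power_strict_mono)
  have "(M (t2\<^sup>2 * N u) - m0) / (t2\<^sup>2 * N u) * (N u)\<^sup>2 \<le> (M (t1\<^sup>2 * N u) - m0) / (t1\<^sup>2 * N u) * (N u)\<^sup>2"
    using N squares by (intro mult_right_mono M_excess_ratio_antimono) auto
  moreover have "((m0 - 1 / K) * N u + gagliardo s u / K) / t2\<^sup>2
      < ((m0 - 1 / K) * N u + gagliardo s u / K) / t1\<^sup>2"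
  proof (rule divide_strict_left_mono[OF squares(2)])
    have "0 < (m0 - 1 / K) * N u" using inverse_K m0_pos N by (intro mult_pos_pos) auto
    moreover have "0 \<le> gagliardo s u / K" using K_pos gagliardo_nonneg by (intro divide_nonneg_pos)
    ultimately show "0 < (m0 - 1 / K) * N u + gagliardo s u / K" by linarith
  qed (use squares in \<open>intro mult_pos_pos; linarith\<close>)
  ultimately show ?thesis
    using t penalized_ray_antimono[OF u, of t1 t2]
      dJ_ray_decomposition[OF u N, of t1] dJ_ray_decomposition[OF u N, of t2]
    by linarith
qed

lemma J_ray_deriv:
  assumes u: "u \<in> H" and "0 < N u" "0 < t"
  shows "((\<lambda>t. J (\<lambda>x. t * u x)) has_real_derivative dJ (\<lambda>x. t * u x) u) (at t)"
  using J_deriv[OF H_scale[OF u, of 0] u, of t] assms by (simp add: N_scale)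

lemma nehari_dJ_ray_pos:
  assumes u: "u \<in> nehari H J" and t: "0 < t" "t < 1"
  shows "0 < dJ (\<lambda>x. t * u x) u"
  using dJ_ray_decreasing[OF nehari_H[OF u] nehari_N_pos[OF u] t] nehari_dJ[OF u] t
  by (simp add: zero_less_divide_iff)

lemma nehari_dJ_ray_neg:
  assumes u: "u \<in> nehari H J" and t: "1 < t"
  shows "dJ (\<lambda>x. t * u x) u < 0"
  using dJ_ray_decreasing[OF nehari_H[OF u] nehari_N_pos[OF u] _ t] nehari_dJ[OF u] t
  by (simp add: divide_less_0_iff)

lemma nehari_J_ray_max:
  assumes u: "u \<in> nehari H J" and t: "0 < t"
  shows "J (\<lambda>x. t * u x) \<le> J u"
proof -
  let ?j = "\<lambda>t. J (\<lambda>x. t * u x)"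
  note deriv = J_ray_deriv[OF nehari_H[OF u] nehari_N_pos[OF u]]
  have "?j t \<le> ?j 1"
  proof (cases "t \<le> 1")
    case True
    then show ?thesis
    proof (rule DERIV_nonneg_imp_nondecreasing[where f = ?j])
      fix x assume x: "t \<le> x" "x \<le> 1"
      have "0 \<le> dJ (\<lambda>y. x * u y) u"
        using nehari_dJ_ray_pos[OF u, of x] nehari_dJ[OF u] x t by (cases "x = 1") auto
      then show "\<exists>y. (?j has_real_derivative y) (at x) \<and> 0 \<le> y" using deriv[of x] x t by auto
    qed
  next
    case False
    then have "1 \<le> t" by simp
    then show ?thesis
    proof (rule DERIV_nonpos_imp_nonincreasing[where f = ?j])
      fix x assume x: "1 \<le> x" "x \<le> t"
      have "dJ (\<lambda>y. x * u y) u \<le> 0"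
        using nehari_dJ_ray_neg[OF u, of x] nehari_dJ[OF u] x by (cases "x = 1") auto
      then show "\<exists>y. (?j has_real_derivative y) (at x) \<and> y \<le> 0" using deriv[of x] x by auto
    qed
  qed
  then show ?thesis by simp
qed

lemma nehari_local_mass:
  assumes u: "u \<in> nehari H J"
  shows "m0 / 2 * N u \<le> (LBINT x. indicator B x * (f (u x) * u x))"
proof -
  note uH = nehari_H[OF u]
  have "d\<Psi> u u \<le> (LBINT x. indicator B x * (f (u x) * u x) + 1 / K * (W x * (u x)\<^sup>2))"
    unfolding d\<Psi>_def using H_pot[OF uH] f_local_integrable[OF uH] g_integrable[OF uH uH]
    by (intro Bochner_Integration.integral_mono g_mult_le_penalized) auto
  also have "\<dots> = (LBINT x. indicator B x * (f (u x) * u x)) + 1 / K * pot u"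
    using H_pot[OF uH] f_local_integrable[OF uH] by (simp add: pot_eq[OF uH])
  also have "1 / K * pot u \<le> m0 / 2 * N u"
    using pot_le_N inverse_K K_pos pot_nonneg m0_pos by (intro mult_mono) auto
  finally have "M (N u) * N u \<le> (LBINT x. indicator B x * (f (u x) * u x)) + m0 / 2 * N u"
    by (simp add: nehari_d\<Psi>[OF u])
  moreover have "m0 * N u \<le> M (N u) * N u" by (intro mult_right_mono M_ge N_nonneg)
  ultimately show ?thesis by simp
qed

lemma coercivity_constant_pos: "0 < m0 / 4 - 1 / (2 * K)"
  using inverse_K by simp

lemma nehari_coercive:
  assumes u: "u \<in> nehari H J"
  shows "(m0 / 4 - 1 / (2 * K)) * N u \<le> J u"
proof -
  note uH = nehari_H[OF u]
  have "G x t - g x t * t / 4 \<le> 1 / (2 * K) * (W x * t\<^sup>2)" for x t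
  proof -
    have "V0 / (2 * K) * t\<^sup>2 \<le> 1 / (2 * K) * (W x * t\<^sup>2)"
      using K_pos V_ge[of "\<epsilon> *\<^sub>R x"] by (simp add: divide_right_mono mult_right_mono)
    moreover have "0 \<le> 1 / (2 * K) * (W x * t\<^sup>2)" using K_pos W_nonneg[of x] by simp
    ultimately show ?thesis
      using primitive_f_le[of t] primitive_ft_le[of t] g_mult_nonneg[of 1 x t]
      by (auto simp: G_def g_def)
  qed
  then have "(LBINT x. G x (u x) - g x (u x) * u x / 4) \<le> (LBINT x. 1 / (2 * K) * (W x * (u x)\<^sup>2))"
    using H_pot[OF uH] G_integrable[OF uH] g_integrable[OF uH uH]
    by (intro Bochner_Integration.integral_mono) auto
  then have "\<Psi> u - d\<Psi> u u / 4 \<le> 1 / (2 * K) * pot u"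
    using G_integrable[OF uH] g_integrable[OF uH uH] by (simp add: \<Psi>_def d\<Psi>_def pot_eq[OF uH])
  moreover have "1 / (2 * K) * pot u \<le> 1 / (2 * K) * N u"
    using K_pos pot_le_N by (intro mult_left_mono) auto
  moreover have "(M (N u) + m0) / 2 * N u \<le> Mhat M (N u)"
    by (rule Mhat_lower[OF nehari_N_pos[OF u]])
  moreover have "(m0 / 4 - 1 / (2 * K)) * N u
      = 1/2 * ((M (N u) + m0) / 2 * N u) - M (N u) * N u / 4 - 1 / (2 * K) * N u"
    by (simp add: algebra_simps add_divide_distrib)
  ultimately show ?thesis unfolding J_def nehari_d\<Psi>[OF u] by linarith
qed

lemma d\<Psi>_le_powr:
  assumes \<delta>: "0 < \<delta>"
  obtains C where "0 < C" "\<And>u. u \<in> H \<Longrightarrow> d\<Psi> u u \<le> \<delta> * N u + C * N u powr (q / 2)"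
proof -
  obtain C where C: "0 < C" and growth: "\<And>t. f t * t \<le> \<delta> * V0 * t\<^sup>2 + C * \<bar>t\<bar> powr q"
    using f_growth[of "\<delta> * V0"] \<delta> V0_pos by (metis mult_pos_pos)
  obtain D where D: "0 < D"
    and powr_bound: "\<And>u. u \<in> H \<Longrightarrow> (LBINT x. \<bar>u x\<bar> powr q) \<le> D * N u powr (q / 2)"
    by (rule H_powr_bound[OF q_ge_2 q_subcritical]) blast
  have "d\<Psi> u u \<le> \<delta> * N u + C * D * N u powr (q / 2)" if u: "u \<in> H" for u
  proof -
    have "d\<Psi> u u \<le> (LBINT x. \<delta> * V0 * (u x)\<^sup>2 + C * \<bar>u x\<bar> powr q)"
      unfolding d\<Psi>_def
    proof (rule Bochner_Integration.integral_mono[OF g_integrable[OF u u]])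
      show "integrable lborel (\<lambda>x. \<delta> * V0 * (u x)\<^sup>2 + C * \<bar>u x\<bar> powr q)"
        using H_square[OF u] H_powr_q_integrable[OF u] by auto
      show "g x (u x) * u x \<le> \<delta> * V0 * (u x)\<^sup>2 + C * \<bar>u x\<bar> powr q" for x
        using g_mult_le_f[of 1 x "u x"] growth[of "u x"] by simp
    qed
    also have "\<dots> = \<delta> * (V0 * (LBINT x. (u x)\<^sup>2)) + C * (LBINT x. \<bar>u x\<bar> powr q)"
      using H_square[OF u] H_powr_q_integrable[OF u] by simp
    also have "\<dots> \<le> \<delta> * N u + C * (D * N u powr (q / 2))"
      using V0_integral_square_le_pot[OF u] pot_le_N[of u] powr_bound[OF u] \<delta> C
      by (intro add_mono mult_left_mono) auto
    finally show ?thesis by simp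
  qed
  then show ?thesis using that[of "C * D"] C D by simp
qed

lemma dJ_pos_near_zero:
  obtains \<rho> where "0 < \<rho>" "\<And>u. u \<in> H \<Longrightarrow> 0 < N u \<Longrightarrow> N u < \<rho> \<Longrightarrow> 0 < dJ u u"
proof -
  obtain C where C: "0 < C" and bound: "\<And>u. u \<in> H \<Longrightarrow> d\<Psi> u u \<le> m0 / 2 * N u + C * N u powr (q / 2)"
    using d\<Psi>_le_powr[of "m0 / 2"] m0_pos by auto
  define r where "r = q / 2 - 1"
  have r: "0 < r" using q_gt_4 by (simp add: r_def)
  define \<rho> where "\<rho> = (m0 / (2 * C)) powr (1 / r)"
  have "0 < dJ u u" if u: "u \<in> H" and N: "0 < N u" "N u < \<rho>" for u
  proof -
    have "N u powr r < \<rho> powr r" using N r by (intro powr_less_mono2) auto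
    also have "\<rho> powr r = m0 / (2 * C)" using r C m0_pos by (simp add: \<rho>_def powr_powr)
    finally have "C * N u powr r * N u < m0 / 2 * N u"
      using C N by (intro mult_strict_right_mono) (auto simp: field_simps)
    moreover have "N u powr (q / 2) = N u powr r * N u" using N by (simp add: r_def powr_diff)
    moreover have "m0 * N u \<le> M (N u) * N u" by (intro mult_right_mono M_ge N_nonneg)
    ultimately show ?thesis using bound[OF u] dJ_self[OF u] by (simp add: mult.assoc)
  qed
  moreover have "0 < \<rho>" using C m0_pos by (simp add: \<rho>_def)
  ultimately show ?thesis using that by blast
qed

lemma nehari_bounded_below:
  obtains \<rho> where "0 < \<rho>" "\<And>u. u \<in> nehari H J \<Longrightarrow> \<rho> \<le> N u"
proof -
  obtain \<rho> where \<rho>: "0 < \<rho>" and pos: "\<And>u. u \<in> H \<Longrightarrow> 0 < N u \<Longrightarrow> N u < \<rho> \<Longrightarrow> 0 < dJ u u"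
    by (rule dJ_pos_near_zero) blast
  have "\<rho> \<le> N u" if "u \<in> nehari H J" for u
    using pos[OF nehari_H nehari_N_pos, OF that that] nehari_dJ[OF that] by (cases "N u < \<rho>") auto
  then show ?thesis using that \<rho> by blast
qed

lemma dJ_ray_pos_small:
  assumes u: "u \<in> H" and N: "0 < N u"
  obtains t where "0 < t" "0 < dJ (\<lambda>x. t * u x) u"
proof -
  obtain \<rho> where \<rho>: "0 < \<rho>" and pos: "\<And>u. u \<in> H \<Longrightarrow> 0 < N u \<Longrightarrow> N u < \<rho> \<Longrightarrow> 0 < dJ u u"
    by (rule dJ_pos_near_zero) blast
  define t where "t = sqrt (\<rho> / (2 * N u))"
  have t: "0 < t" using \<rho> N by (simp add: t_def)
  have "N (\<lambda>x. t * u x) = \<rho> / 2" using \<rho> N by (simp add: N_scale[OF u] t_def)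
  then have "0 < dJ (\<lambda>x. t * u x) (\<lambda>x. t * u x)" using \<rho> by (intro pos H_scale u) auto
  then show ?thesis using that[OF t] t by (simp add: dJ_ray_scale[OF u] zero_less_mult_iff)
qed

lemma d\<Psi>_ray_lower:
  assumes u: "u \<in> H" and \<delta>: "0 < \<delta>" and t: "0 \<le> t"
  shows "f (t * \<delta>) * \<delta> * measure lborel {x \<in> B. \<delta> < u x} \<le> d\<Psi> (\<lambda>x. t * u x) u"
proof -
  note [measurable] = H_measurable[OF u] B_measurable
  define E where "E = {x \<in> B. \<delta> < u x}"
  have [measurable]: "E \<in> sets borel" unfolding E_def by measurable
  have E_finite: "emeasure lborel E < \<infinity>"
    using emeasure_mono[of E B lborel] B_finite by (auto simp: E_def)
  have "f (t * \<delta>) * \<delta> * indicator E x \<le> g x (t * u x) * u x" for x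
  proof (cases "x \<in> E")
    case True
    then have x: "x \<in> B" "\<delta> < u x" by (auto simp: E_def)
    have "f (t * \<delta>) \<le> f (t * u x)" using x t by (intro f_mono mult_left_mono) auto
    then have "f (t * \<delta>) * \<delta> \<le> f (t * u x) * u x" using x \<delta> f_nonneg by (intro mult_mono) auto
    then show ?thesis using True x by (simp add: g_def)
  qed (use g_mult_nonneg[OF t] in simp)
  moreover have "integrable lborel (\<lambda>x. f (t * \<delta>) * \<delta> * indicator E x)"
    using E_finite by (intro integrable_mult_right) (simp add: integrable_indicator_iff)
  ultimately have "(LBINT x. f (t * \<delta>) * \<delta> * indicator E x) \<le> d\<Psi> (\<lambda>x. t * u x) u"
    unfolding d\<Psi>_def by (intro Bochner_Integration.integral_mono g_integrable H_scale u)
  then show ?thesis by (simp add: E_def)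
qed

lemma dJ_ray_neg_large:
  assumes u: "u \<in> H" and N: "0 < N u" and pos: "\<not> (AE x in lborel. x \<in> B \<longrightarrow> u x \<le> 0)"
  obtains t where "0 < t" "dJ (\<lambda>x. t * u x) u < 0"
proof -
  have "u \<in> borel_measurable lborel" "B \<in> sets lborel"
    using H_measurable[OF u] B_measurable by simp_all
  then obtain \<delta> where \<delta>: "0 < \<delta>" and E: "emeasure lborel {x \<in> B. \<delta> < u x} \<noteq> 0"
    using positive_superlevel_set pos by blast
  define \<mu> where "\<mu> = measure lborel {x \<in> B. \<delta> < u x}"
  have "emeasure lborel {x \<in> B. \<delta> < u x} < \<infinity>"
    using emeasure_mono[of "{x \<in> B. \<delta> < u x}" B lborel] B_finite by auto
  then have \<mu>: "0 < \<mu>"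
    using E by (auto simp: \<mu>_def measure_def enn2real_positive_iff zero_less_iff_neq_zero)
  define n where "n = N u"
  define L where "L = (M n * n + 1) / (\<delta> ^ 4 * \<mu>)"
  obtain T where T: "\<And>t. T \<le> t \<Longrightarrow> L \<le> f t / t ^ 3" by (rule f_superlinear) blast
  define t where "t = max 1 (T / \<delta>)"
  have t: "1 \<le> t" "1 \<le> t\<^sup>2" by (auto simp: t_def)
  have "L \<le> f (t * \<delta>) / (t * \<delta>) ^ 3" using \<delta> by (intro T) (simp add: t_def field_simps max_def)
  then have "L * (\<delta> ^ 4 * \<mu>) \<le> f (t * \<delta>) / (t * \<delta>) ^ 3 * (\<delta> ^ 4 * \<mu>)"
    using \<delta> \<mu> by (intro mult_right_mono) auto
  then have "t ^ 3 * (M n * n + 1) \<le> t ^ 3 * (f (t * \<delta>) / (t * \<delta>) ^ 3 * (\<delta> ^ 4 * \<mu>))"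
    using \<delta> \<mu> t by (intro mult_left_mono) (auto simp: L_def)
  also have "\<dots> = f (t * \<delta>) * \<delta> * \<mu>" using t \<delta> by (simp add: power_mult_distrib power_eq_if)
  also have "\<dots> \<le> d\<Psi> (\<lambda>x. t * u x) u" unfolding \<mu>_def using t by (intro d\<Psi>_ray_lower u \<delta>) simp
  finally have large: "t ^ 3 * (M n * n + 1) \<le> d\<Psi> (\<lambda>x. t * u x) u" .
  have "M (t\<^sup>2 * n) * (t * n) \<le> t\<^sup>2 * M n * (t * n)"
    using t N by (intro mult_right_mono M_scale_le) (auto simp: n_def)
  also have "\<dots> = t ^ 3 * (M n * n)" by (simp add: power2_eq_square power3_eq_cube)
  also have "\<dots> < t ^ 3 * (M n * n + 1)" using t by (intro mult_strict_left_mono) auto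
  finally have "dJ (\<lambda>x. t * u x) u < 0" using large by (simp add: dJ_ray[OF u] n_def)
  then show ?thesis using that[of t] t by simp
qed

lemma nehari_projection:
  assumes u: "u \<in> H" and pos: "\<not> (AE x in lborel. x \<in> B \<longrightarrow> u x \<le> 0)"
  obtains t where "0 < t" "(\<lambda>x. t * u x) \<in> nehari H J"
proof -
  have "\<not> (AE x in lborel. u x = 0)"
    using pos by (rule contrapos_nn) (auto elim!: eventually_mono)
  then have N: "0 < N u" using nontrivial_iff[OF u] by (simp add: nontrivial_def)
  obtain t1 where t1: "0 < t1" "0 < dJ (\<lambda>x. t1 * u x) u" using dJ_ray_pos_small[OF u N] by blast
  obtain t2 where t2: "0 < t2" "dJ (\<lambda>x. t2 * u x) u < 0" using dJ_ray_neg_large[OF u N pos] by blast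
  have "t1 < t2"
  proof (rule ccontr)
    assume "\<not> t1 < t2"
    moreover have "t1 \<noteq> t2" using t1 t2 by auto
    ultimately have "dJ (\<lambda>x. t1 * u x) u / t1 ^ 3 < dJ (\<lambda>x. t2 * u x) u / t2 ^ 3"
      using t2 by (intro dJ_ray_decreasing[OF u N]) auto
    moreover have "0 < dJ (\<lambda>x. t1 * u x) u / t1 ^ 3" "dJ (\<lambda>x. t2 * u x) u / t2 ^ 3 < 0"
      using t1 t2 by (auto simp: divide_less_0_iff)
    ultimately show False by linarith
  qed
  then obtain t where t: "t1 \<le> t" "dJ (\<lambda>x. t * u x) u = 0"
    using IVT2'[of "\<lambda>t. dJ (\<lambda>x. t * u x) u" t2 0 t1] t1 t2 dJ_ray_continuous[OF u] by auto
  have "(\<lambda>x. t * u x) \<in> nehari H J"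
    unfolding nehari_eq using t t1 N by (auto simp: H_scale[OF u] N_scale[OF u] dJ_ray_scale[OF u])
  then show ?thesis using that t t1 by (meson less_le_trans)
qed

end

section \<open>Existence of a ground state\<close>

lemma open_contains_rectangle:
  fixes U :: "(real \<times> real) set"
  assumes "open U" "(a, b) \<in> U"
  obtains \<eta> where "0 < \<eta>" "\<And>\<alpha> \<beta>. \<bar>\<alpha> - a\<bar> \<le> \<eta> \<Longrightarrow> \<bar>\<beta> - b\<bar> \<le> \<eta> \<Longrightarrow> (\<alpha>, \<beta>) \<in> U"
proof -
  obtain A A' where A: "open A" "open A'" "(a, b) \<in> A \<times> A'" "A \<times> A' \<subseteq> U"
    using assms by (rule open_prod_elim)
  then have "a \<in> A" "b \<in> A'" by auto
  then obtain d e where d: "0 < d" "cball a d \<subseteq> A" and e: "0 < e" "cball b e \<subseteq> A'"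
    using open_contains_cball_eq[OF A(1)] open_contains_cball_eq[OF A(2)] by blast
  have "(\<alpha>, \<beta>) \<in> U" if "\<bar>\<alpha> - a\<bar> \<le> min d e" "\<bar>\<beta> - b\<bar> \<le> min d e" for \<alpha> \<beta>
  proof -
    have "\<alpha> \<in> cball a d" "\<beta> \<in> cball b e" using that by (auto simp: dist_real_def abs_minus_commute)
    then show ?thesis using d(2) e(2) A(4) by blast
  qed
  then show ?thesis using that[of "min d e"] d(1) e(1) by auto
qed

lemma zero_near_sign_change:
  fixes S :: "real \<times> real \<Rightarrow> real"
  assumes cont: "continuous_on UNIV S" and ab: "a \<le> b" and pos: "0 < S (a, 0)"
    and neg: "S (b, 0) < 0" and \<eta>: "0 < \<eta>"
  obtains \<alpha> \<beta> where "a \<le> \<alpha>" "\<alpha> \<le> b" "0 < \<beta>" "\<beta> \<le> \<eta>" "S (\<alpha>, \<beta>) = 0"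
proof -
  have slice: "continuous_on UNIV (\<lambda>\<beta>. S (\<alpha>, \<beta>))" "continuous_on A (\<lambda>\<alpha>. S (\<alpha>, \<beta>))" for \<alpha> \<beta> A
    by (rule continuous_on_compose2[OF cont]; auto intro!: continuous_intros)+
  have "open ({\<beta>. 0 < S (a, \<beta>)} \<inter> {\<beta>. S (b, \<beta>) < 0})"
    by (intro open_Int open_Collect_less slice continuous_on_const)
  moreover have "0 \<in> {\<beta>. 0 < S (a, \<beta>)} \<inter> {\<beta>. S (b, \<beta>) < 0}" using pos neg by simp
  ultimately obtain d where d: "0 < d" "cball 0 d \<subseteq> {\<beta>. 0 < S (a, \<beta>)} \<inter> {\<beta>. S (b, \<beta>) < 0}"
    using open_contains_cball_eq by metis
  define \<beta> where "\<beta> = min \<eta> d"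
  have \<beta>: "0 < \<beta>" "\<beta> \<le> \<eta>" using \<eta> d(1) by (auto simp: \<beta>_def)
  have "\<beta> \<in> cball 0 d" using \<eta> d(1) by (auto simp: \<beta>_def)
  then have "0 < S (a, \<beta>)" "S (b, \<beta>) < 0" using d(2) by auto
  then obtain \<alpha> where "a \<le> \<alpha>" "\<alpha> \<le> b" "S (\<alpha>, \<beta>) = 0"
    using IVT2'[of "\<lambda>\<alpha>. S (\<alpha>, \<beta>)" b 0 a] slice(2) ab by auto
  then show ?thesis using that \<beta> by blast
qed

context kirchhoff_problem
begin

lemma nehari_nonempty:
  assumes B: "open B" "B \<noteq> {}"
  shows "nehari H J \<noteq> {}"
proof -
  obtain x0 where x0: "x0 \<in> B" using B by blast
  have "\<not> (AE x in lborel. x \<in> B \<longrightarrow> bump x0 x \<le> 0)"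
  proof
    assume "AE x in lborel. x \<in> B \<longrightarrow> bump x0 x \<le> 0"
    then have "AE x in lborel. x \<notin> B \<inter> ball x0 1"
      by eventually_elim (use bump_pos_iff not_less in blast)
    moreover have "open (B \<inter> ball x0 1)" "B \<inter> ball x0 1 \<noteq> {}" using B x0 by auto
    ultimately show False using open_not_AE_avoided by blast
  qed
  then show ?thesis using nehari_projection[OF H_bump] by blast
qed

lemma f_le_one_plus_powr:
  obtains C where "\<And>t. \<bar>f t * t\<bar> \<le> C * (1 + \<bar>t\<bar> powr q)"
proof -
  obtain C where C: "0 < C" "\<And>t. f t * t \<le> 1 * t\<^sup>2 + C * \<bar>t\<bar> powr q" using f_growth[of 1] by auto
  have "\<bar>f t * t\<bar> \<le> (1 + C) * (1 + \<bar>t\<bar> powr q)" for t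
  proof -
    have "t\<^sup>2 \<le> 1 + \<bar>t\<bar> powr q"
    proof (cases "\<bar>t\<bar> \<le> 1")
      case True
      then have "t\<^sup>2 \<le> 1" by (simp add: abs_square_le_1)
      then show ?thesis by (simp add: add_increasing2)
    next
      case False
      then have "\<bar>t\<bar> powr 2 \<le> \<bar>t\<bar> powr q" using q_ge_2 by (intro powr_mono) auto
      then show ?thesis using False by simp
    qed
    moreover have "C * \<bar>t\<bar> powr q \<le> C * (1 + \<bar>t\<bar> powr q)" using C(1) by (intro mult_left_mono) auto
    moreover have "\<bar>f t * t\<bar> = f t * t" using f_mult_nonneg by simp
    ultimately show ?thesis using C(2)[of t] by (simp add: algebra_simps)
  qed
  then show ?thesis using that by blast
qed

lemma local_integral_tendsto:
  assumes v: "\<And>n. v n \<in> H" and bounded: "Bseq (\<lambda>n. N (v n))" and w: "w \<in> H"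
    and conv: "AE x in lborel. (\<lambda>n. v n x) \<longlonglongrightarrow> w x"
    and cont: "continuous_on UNIV h" and growth: "\<And>t. \<bar>h t\<bar> \<le> \<bar>f t * t\<bar>"
  shows "(\<lambda>n. LBINT x. indicator B x * h (v n x)) \<longlonglongrightarrow> (LBINT x. indicator B x * h (w x))"
proof -
  obtain R where R: "\<And>n. \<bar>N (v n)\<bar> \<le> R" using bounded by (auto simp: Bseq_def)
  define R' where "R' = R + N w + 1"
  have "0 \<le> R" using R[of 0] by linarith
  then have "0 < R'" using N_nonneg[of w] by (simp add: R'_def)
  then have radius: "0 < R' + R' / V0" using V0_pos by (simp add: add_pos_pos)
  obtain C where C: "\<And>t. \<bar>f t * t\<bar> \<le> C * (1 + \<bar>t\<bar> powr q)" by (rule f_le_one_plus_powr) blast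
  have tails: "uniform_tails lborel q (sobolev_ball s (R' + R' / V0) :: (R3 \<Rightarrow> real) set)"
    using radius s_pos s_less_1 q_gt_4 q_subcritical by (intro sobolev_ball_uniform_tails) auto
  show ?thesis
  proof (rule uniform_tails_integral_tendsto[OF _ B_finite cont _ _ tails _ _ _ conv])
    show "\<bar>h t\<bar> \<le> C * (1 + \<bar>t\<bar> powr q)" for t using growth C order_trans by blast
    show "v n \<in> sobolev_ball s (R' + R' / V0)" for n
      using R[of n] N_nonneg[of w] by (intro H_sobolev_ball[OF v]) (auto simp: R'_def)
    show "w \<in> sobolev_ball s (R' + R' / V0)"
      using \<open>0 \<le> R\<close> by (intro H_sobolev_ball[OF w]) (simp add: R'_def)
  qed (use q_ge_2 B_measurable sobolev_ball_measurable in auto)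
qed

text \<open>Splitting \<open>m\<^sub>0 t\<close> off \<open>Mhat M t\<close> makes the part of the functional outside \<open>B\<close> nonnegative,
  so that Fatou's lemma applies to it although there is no compactness there.\<close>

definition outer :: "(R3 \<Rightarrow> real) \<Rightarrow> R3 \<Rightarrow> real" where
  "outer u x = m0 / 2 * (W x * (u x)\<^sup>2) - indicator (- B) x * primitive ft (u x)"

lemma outer_nonneg: "0 \<le> outer u x"
proof -
  have "indicator (- B) x * primitive ft (u x) \<le> primitive ft (u x)"
    using primitive_ft_nonneg by (auto simp: indicator_def)
  also have "\<dots> \<le> (1 / K) / 2 * (V0 * (u x)\<^sup>2)" using primitive_ft_le[of "u x"] by simp
  also have "\<dots> \<le> m0 / 2 * (W x * (u x)\<^sup>2)"
    using inverse_K m0_pos V0_pos by (intro mult_mono V0_square_le) auto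
  finally show ?thesis by (simp add: outer_def)
qed

lemma
  assumes u: "u \<in> H"
  shows outer_integrable: "integrable lborel (outer u)"
    and J_split: "J u = 1/2 * (Mhat M (N u) - m0 * N u) + m0 / 2 * gagliardo s u
      + (LBINT x. outer u x) - (LBINT x. indicator B x * primitive f (u x))"
proof -
  note [measurable] = H_measurable[OF u] B_measurable
  let ?inside = "\<lambda>x. indicator B x * primitive f (u x)"
  let ?outside = "\<lambda>x. indicator (- B) x * primitive ft (u x)"
  have parts: "integrable lborel ?inside" "integrable lborel ?outside"
    by (rule Bochner_Integration.integrable_bound[OF G_integrable[OF u]];
        auto simp: indicator_def G_def)+
  then show "integrable lborel (outer u)" unfolding outer_def[abs_def] using H_pot[OF u] by auto
  have "\<Psi> u = (LBINT x. ?inside x + ?outside x)"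
    unfolding \<Psi>_def by (intro Bochner_Integration.integral_cong) (auto simp: G_def)
  then have "\<Psi> u = (LBINT x. ?inside x) + (LBINT x. ?outside x)" using parts by simp
  moreover have "(LBINT x. outer u x) = m0 / 2 * pot u - (LBINT x. ?outside x)"
    unfolding outer_def using parts(2) H_pot[OF u] by (simp add: pot_eq[OF u])
  ultimately show "J u = 1/2 * (Mhat M (N u) - m0 * N u) + m0 / 2 * gagliardo s u
      + (LBINT x. outer u x) - (LBINT x. ?inside x)"
    unfolding J_def N_eq by (simp add: algebra_simps)
qed

lemma outer_fatou:
  assumes v: "\<And>n. v n \<in> H" and w: "w \<in> H" and conv: "AE x in lborel. (\<lambda>n. v n x) \<longlonglongrightarrow> w x"
    and bound: "\<And>n. (LBINT x. outer (v n) x) \<le> e n" and e: "e \<longlonglongrightarrow> l"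
  shows "(LBINT x. outer w x) \<le> l"
proof -
  have "0 \<le> (LBINT x. outer (v n) x)" for n
    by (intro Bochner_Integration.integral_nonneg outer_nonneg)
  then have "0 \<le> e n" for n using bound[of n] by (rule order_trans)
  then have l: "0 \<le> l" using e by (intro LIMSEQ_le_const) auto
  have "(\<integral>\<^sup>+ x. ennreal (outer w x) \<partial>lborel) \<le> ennreal l"
  proof (rule nn_integral_fatou_le[OF _ _ _ e])
    show "outer (v n) \<in> borel_measurable lborel" for n
      by (rule borel_measurable_integrable[OF outer_integrable[OF v]])
    have isCont: "isCont (primitive ft) t" for t using primitive_ft_deriv by (rule DERIV_isCont)
    show "AE x in lborel. (\<lambda>n. outer (v n) x) \<longlonglongrightarrow> outer w x"
      unfolding outer_def using conv
      by eventually_elim (intro tendsto_intros isCont_tendsto_compose[OF isCont])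
    show "(\<integral>\<^sup>+ x. ennreal (outer (v n) x) \<partial>lborel) \<le> ennreal (e n)" for n
      using bound[of n] outer_integrable[OF v[of n]]
      by (subst nn_integral_eq_integral) (auto simp: outer_nonneg ennreal_leI)
  qed
  then have "ennreal (LBINT x. outer w x) \<le> ennreal l"
    using outer_integrable[OF w] by (subst (asm) nn_integral_eq_integral) (auto simp: outer_nonneg)
  then show ?thesis using l by (simp add: ennreal_le_iff)
qed

lemma J_fatou:
  assumes v: "\<And>n. v n \<in> H" and w: "w \<in> borel_measurable borel"
    and conv: "AE x in lborel. (\<lambda>n. v n x) \<longlonglongrightarrow> w x"
    and \<gamma>: "(\<lambda>n. gagliardo s (v n)) \<longlonglongrightarrow> \<gamma>" and p: "(\<lambda>n. pot (v n)) \<longlonglongrightarrow> p"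
    and bound: "\<And>n. J (v n) \<le> c n" and c: "c \<longlonglongrightarrow> l"
  shows "J w \<le> l"
proof -
  note limit = H_fatou[OF v w conv \<gamma> p]
  define P where "P t = Mhat M t - m0 * t" for t
  define F where "F u = (LBINT x. indicator B x * primitive f (u x))" for u
  have norms: "(\<lambda>n. N (v n)) \<longlonglongrightarrow> \<gamma> + p" unfolding N_eq by (intro tendsto_add \<gamma> p)
  then have bounded: "Bseq (\<lambda>n. N (v n))" using convergentI convergent_imp_Bseq by blast
  have "\<bar>primitive f t\<bar> \<le> \<bar>f t * t\<bar>" for t
    using primitive_f_le[of t] primitive_f_nonneg[of t] by linarith
  then have F: "(\<lambda>n. F (v n)) \<longlonglongrightarrow> F w"
    unfolding F_def by (intro local_integral_tendsto[OF v bounded limit(1) conv primitive_f_cont])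
  have "0 \<le> \<gamma> + p" using norms N_nonneg by (intro LIMSEQ_le_const) auto
  then have "(\<lambda>n. Mhat M (N (v n))) \<longlonglongrightarrow> Mhat M (\<gamma> + p)"
    using N_nonneg by (intro continuous_on_tendsto_compose[OF Mhat_cont norms]) auto
  then have budget: "(\<lambda>n. c n - 1/2 * P (N (v n)) - m0 / 2 * gagliardo s (v n) + F (v n))
      \<longlonglongrightarrow> l - 1/2 * P (\<gamma> + p) - m0 / 2 * \<gamma> + F w"
    unfolding P_def by (intro tendsto_intros norms \<gamma> c F)
  have outer_le: "(LBINT x. outer (v n) x)
      \<le> c n - 1/2 * P (N (v n)) - m0 / 2 * gagliardo s (v n) + F (v n)" for n
    using bound[of n] J_split[OF v[of n]] by (simp add: F_def P_def)
  have "(LBINT x. outer w x) \<le> l - 1/2 * P (\<gamma> + p) - m0 / 2 * \<gamma> + F w"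
    by (rule outer_fatou[OF v limit(1) conv outer_le budget])
  moreover have "P (N w) \<le> P (\<gamma> + p)"
    unfolding P_def using limit(2,3) N_nonneg[of w] by (intro Mhat_excess_mono) (auto simp: N_eq)
  moreover have "m0 / 2 * gagliardo s w \<le> m0 / 2 * \<gamma>"
    using limit(2) m0_pos by (intro mult_left_mono) auto
  moreover have "J w = 1/2 * P (N w) + m0 / 2 * gagliardo s w + (LBINT x. outer w x) - F w"
    using J_split[OF limit(1)] by (simp add: F_def P_def)
  ultimately show ?thesis by linarith
qed

lemma nehari_limit_ray:
  assumes v: "\<And>n. v n \<in> nehari H J" and c: "(\<lambda>n. J (v n)) \<longlonglongrightarrow> c"
    and w [measurable]: "w \<in> borel_measurable borel" and conv: "AE x in lborel. (\<lambda>n. v n x) \<longlonglongrightarrow> w x"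
    and \<gamma>: "(\<lambda>n. gagliardo s (v n)) \<longlonglongrightarrow> \<gamma>" and p: "(\<lambda>n. pot (v n)) \<longlonglongrightarrow> p" and t: "0 < t"
  shows "J (\<lambda>x. t * w x) \<le> c"
proof (rule J_fatou[OF H_scale[OF nehari_H[OF v]]])
  show "(\<lambda>x. t * w x) \<in> borel_measurable borel" by measurable
  show "AE x in lborel. (\<lambda>n. t * v n x) \<longlonglongrightarrow> t * w x"
    using conv by eventually_elim (intro tendsto_intros)
  show "(\<lambda>n. gagliardo s (\<lambda>x. t * v n x)) \<longlonglongrightarrow> t\<^sup>2 * \<gamma>"
    unfolding gagliardo_scale[OF nehari_H[OF v]] by (intro tendsto_intros \<gamma>)
  show "(\<lambda>n. pot (\<lambda>x. t * v n x)) \<longlonglongrightarrow> t\<^sup>2 * p"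
    unfolding pot_scale[OF nehari_H[OF v]] by (intro tendsto_intros p)
  show "J (\<lambda>x. t * v n x) \<le> J (v n)" for n by (rule nehari_J_ray_max[OF v t])
qed (rule c)

lemma nehari_limit_positive_on_B:
  assumes v: "\<And>n. v n \<in> nehari H J" and bounded: "Bseq (\<lambda>n. N (v n))" and w: "w \<in> H"
    and conv: "AE x in lborel. (\<lambda>n. v n x) \<longlonglongrightarrow> w x"
  shows "\<not> (AE x in lborel. x \<in> B \<longrightarrow> w x \<le> 0)"
proof
  assume "AE x in lborel. x \<in> B \<longrightarrow> w x \<le> 0"
  then have "AE x in lborel. indicator B x * (f (w x) * w x) = 0"
    by eventually_elim (auto simp: indicator_def f_nonpos_zero)
  then have "(LBINT x. indicator B x * (f (w x) * w x)) = 0" by (rule integral_eq_zero_AE)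
  moreover have "continuous_on UNIV (\<lambda>t. f t * t)" by (intro continuous_intros f_cont)
  ultimately have vanish: "(\<lambda>n. LBINT x. indicator B x * (f (v n x) * v n x)) \<longlonglongrightarrow> 0"
    using local_integral_tendsto[OF nehari_H[OF v] bounded w conv, of "\<lambda>t. f t * t"] by simp
  obtain \<rho> where \<rho>: "0 < \<rho>" "\<And>u. u \<in> nehari H J \<Longrightarrow> \<rho> \<le> N u" by (rule nehari_bounded_below) blast
  have "m0 / 2 * \<rho> \<le> (LBINT x. indicator B x * (f (v n x) * v n x))" for n
  proof -
    have "m0 / 2 * \<rho> \<le> m0 / 2 * N (v n)" using \<rho>(2)[OF v] m0_pos by (intro mult_left_mono) auto
    also have "\<dots> \<le> (LBINT x. indicator B x * (f (v n x) * v n x))" by (rule nehari_local_mass[OF v])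
    finally show ?thesis .
  qed
  then have "m0 / 2 * \<rho> \<le> 0" using vanish by (intro LIMSEQ_le_const) auto
  then show False using \<rho>(1) m0_pos by (simp add: mult_le_0_iff)
qed

lemma nehari_bounded:
  assumes "u \<in> nehari H J" "J u \<le> c"
  shows "N u \<le> c / (m0 / 4 - 1 / (2 * K))"
proof -
  have "(m0 / 4 - 1 / (2 * K)) * N u \<le> c"
    using nehari_coercive[OF assms(1)] assms(2) by (rule order_trans)
  then show ?thesis by (subst pos_le_divide_eq[OF coercivity_constant_pos]) (simp add: mult.commute)
qed

lemma nehari_J_nonneg:
  assumes "u \<in> nehari H J"
  shows "0 \<le> J u"
proof -
  have "0 \<le> (m0 / 4 - 1 / (2 * K)) * N u"
    using coercivity_constant_pos N_nonneg by (intro mult_nonneg_nonneg) auto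
  also have "\<dots> \<le> J u" by (rule nehari_coercive[OF assms])
  finally show ?thesis .
qed

lemma nehari_bdd_below: "bdd_below (J ` nehari H J)"
  by (rule bdd_belowI2[OF nehari_J_nonneg])

lemma J_pos_part_le:
  assumes u: "u \<in> H"
  shows "J (\<lambda>x. max 0 (u x)) \<le> J u"
proof -
  have "Mhat M (N (\<lambda>x. max 0 (u x))) \<le> Mhat M (N u)" by (intro Mhat_mono N_nonneg N_pos_part_le u)
  then show ?thesis by (simp add: J_def \<Psi>_def G_pos_part)
qed

lemma nehari_minimizing_sequence:
  assumes "nehari H J \<noteq> {}"
  obtains v w \<gamma> p where "\<And>n. v n \<in> nehari H J" "(\<lambda>n. J (v n)) \<longlonglongrightarrow> Inf (J ` nehari H J)"
    "w \<in> borel_measurable borel" "AE x in lborel. (\<lambda>n. v n x) \<longlonglongrightarrow> w x"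
    "(\<lambda>n. gagliardo s (v n)) \<longlonglongrightarrow> \<gamma>" "(\<lambda>n. pot (v n)) \<longlonglongrightarrow> p"
proof -
  have "Inf (J ` nehari H J) \<in> closure (J ` nehari H J)"
    using assms nehari_bdd_below by (intro closure_contains_Inf) auto
  then obtain j where j: "\<And>n. j n \<in> J ` nehari H J" "j \<longlonglongrightarrow> Inf (J ` nehari H J)"
    unfolding closure_sequential by blast
  then have "\<exists>u. u \<in> nehari H J \<and> J u = j n" for n by (metis imageE)
  then obtain u where u: "\<And>n. u n \<in> nehari H J" "\<And>n. J (u n) = j n" by metis
  have "Bseq j" using j(2) convergentI convergent_imp_Bseq by blast
  then obtain c where c: "\<And>n. \<bar>j n\<bar> \<le> c" by (auto simp: Bseq_def)
  have "N (u n) \<le> c / (m0 / 4 - 1 / (2 * K))" for n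
    using c[of n] u(2)[of n] by (intro nehari_bounded u(1)) simp
  then obtain \<rho> w \<gamma> p where \<rho>: "strict_mono (\<rho> :: nat \<Rightarrow> nat)"
    and limits: "w \<in> borel_measurable borel"
      "AE x in lborel. (\<lambda>n. u (\<rho> n) x) \<longlonglongrightarrow> w x"
      "(\<lambda>n. gagliardo s (u (\<rho> n))) \<longlonglongrightarrow> \<gamma>" "(\<lambda>n. pot (u (\<rho> n))) \<longlonglongrightarrow> p"
    using H_bounded_subsequence[of u "c / (m0 / 4 - 1 / (2 * K))"] nehari_H[OF u(1)] by blast
  have "(\<lambda>n. J (u (\<rho> n))) \<longlonglongrightarrow> Inf (J ` nehari H J)"
    using LIMSEQ_subseq_LIMSEQ[OF j(2) \<rho>] by (simp add: u(2) o_def)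
  then show ?thesis using that[of "\<lambda>n. u (\<rho> n)" w \<gamma> p] limits u(1) by simp
qed

lemma nehari_minimizer:
  assumes "nehari H J \<noteq> {}"
  obtains z where "z \<in> nehari H J" "\<And>x. 0 \<le> z x" "J z = Inf (J ` nehari H J)"
proof -
  obtain v w \<gamma> p where v: "\<And>n. v n \<in> nehari H J" and Jv: "(\<lambda>n. J (v n)) \<longlonglongrightarrow> Inf (J ` nehari H J)"
    and w: "w \<in> borel_measurable borel" and conv: "AE x in lborel. (\<lambda>n. v n x) \<longlonglongrightarrow> w x"
    and \<gamma>: "(\<lambda>n. gagliardo s (v n)) \<longlonglongrightarrow> \<gamma>" and p: "(\<lambda>n. pot (v n)) \<longlonglongrightarrow> p"
    using nehari_minimizing_sequence[OF assms] by blast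
  have wH: "w \<in> H" by (rule H_fatou(1)[OF nehari_H[OF v] w conv \<gamma> p])
  have "(\<lambda>n. N (v n)) \<longlonglongrightarrow> \<gamma> + p" unfolding N_eq by (intro tendsto_add \<gamma> p)
  then have "Bseq (\<lambda>n. N (v n))" using convergentI convergent_imp_Bseq by blast
  then have "\<not> (AE x in lborel. x \<in> B \<longrightarrow> max 0 (w x) \<le> 0)"
    using nehari_limit_positive_on_B[OF v _ wH conv] by simp
  then obtain t where t: "0 < t" and z: "(\<lambda>x. t * max 0 (w x)) \<in> nehari H J"
    using nehari_projection[OF H_pos_part[OF wH]] by blast
  have "(\<lambda>x. t * max 0 (w x)) = (\<lambda>x. max 0 (t * w x))"
    using t by (simp add: max_def mult_le_0_iff zero_le_mult_iff fun_eq_iff)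
  then have "J (\<lambda>x. t * max 0 (w x)) \<le> J (\<lambda>x. t * w x)"
    using J_pos_part_le[OF H_scale[OF wH]] by simp
  also have "\<dots> \<le> Inf (J ` nehari H J)" by (rule nehari_limit_ray[OF v Jv w conv \<gamma> p t])
  finally have "J (\<lambda>x. t * max 0 (w x)) \<le> Inf (J ` nehari H J)" .
  moreover have "Inf (J ` nehari H J) \<le> J (\<lambda>x. t * max 0 (w x))"
    using z by (intro cInf_lower nehari_bdd_below) auto
  ultimately show ?thesis using that[OF z] t by simp
qed

lemma J_decreasing_on_segment:
  assumes z: "z \<in> H" and v: "v \<in> H" and \<beta>: "0 < \<beta>"
    and neg: "\<And>b. 0 \<le> b \<Longrightarrow> b \<le> \<beta> \<Longrightarrow> dJ (\<lambda>x. z x + b * v x) v < 0 \<and> 0 < N (\<lambda>x. z x + b * v x)"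
  shows "J (\<lambda>x. z x + \<beta> * v x) < J z"
proof -
  let ?j = "\<lambda>b. J (\<lambda>x. z x + b * v x)"
  have "?j \<beta> < ?j 0"
  proof (rule DERIV_neg_imp_decreasing[where f = ?j, OF \<beta>])
    fix b assume "0 \<le> b" "b \<le> \<beta>"
    then show "\<exists>y. (?j has_real_derivative y) (at b) \<and> y < 0"
      using J_deriv[OF z v, of b] neg[of b] by blast
  qed
  then show ?thesis by simp
qed

lemma dJ_self_zero_near_ray:
  assumes z: "z \<in> nehari H J" and v: "v \<in> H" and \<eta>: "0 < \<eta>" "\<eta> < 1"
  obtains \<alpha> \<beta> where "1 - \<eta> \<le> \<alpha>" "\<alpha> \<le> 1 + \<eta>" "0 < \<beta>" "\<beta> \<le> \<eta>"
    "dJ (\<lambda>x. \<alpha> * z x + \<beta> * v x) (\<lambda>x. \<alpha> * z x + \<beta> * v x) = 0"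
proof -
  note zH = nehari_H[OF z]
  define u where "u p = (\<lambda>x. fst p * z x + snd p * v x)" for p :: "real \<times> real"
  define S where "S p = dJ (u p) (u p)" for p
  have uH: "u p \<in> H" for p unfolding u_def by (rule H_linear[OF zH v])
  have "S p = fst p * dJ (u p) z + snd p * dJ (u p) v" for p
    unfolding S_def using dJ_linear[OF uH zH v, of p "fst p" "snd p"] by (simp add: u_def)
  then have "S = (\<lambda>p. fst p * dJ (u p) z + snd p * dJ (u p) v)" by (rule ext)
  moreover have "continuous_on UNIV (\<lambda>p. dJ (u p) w)" if "w \<in> H" for w
    unfolding u_def by (rule dJ_continuous[OF zH v that])
  ultimately have S_cont: "continuous_on UNIV S" using zH v by (simp only:) (intro continuous_intros)
  have "S (\<alpha>, 0) = \<alpha> * dJ (\<lambda>x. \<alpha> * z x) z" for \<alpha>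
    using dJ_ray_scale[OF zH] by (simp add: S_def u_def)
  then have "0 < S (1 - \<eta>, 0)" "S (1 + \<eta>, 0) < 0"
    using nehari_dJ_ray_pos[OF z, of "1 - \<eta>"] nehari_dJ_ray_neg[OF z, of "1 + \<eta>"] \<eta>
    by (simp_all add: mult_pos_neg)
  then obtain \<alpha> \<beta> where "1 - \<eta> \<le> \<alpha>" "\<alpha> \<le> 1 + \<eta>" "0 < \<beta>" "\<beta> \<le> \<eta>" "S (\<alpha>, \<beta>) = 0"
    using zero_near_sign_change[OF S_cont, of "1 - \<eta>" "1 + \<eta>" \<eta>] \<eta>(1) by auto
  then show ?thesis using that[of \<alpha> \<beta>] by (simp add: S_def u_def)
qed

lemma dJ_neg_near:
  assumes z: "z \<in> H" and v: "v \<in> H" and neg: "dJ z v < 0" and N: "0 < N z"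
  obtains r where "0 < r" "\<And>\<alpha> \<beta>. \<bar>\<alpha> - 1\<bar> \<le> r \<Longrightarrow> \<bar>\<beta>\<bar> \<le> r \<Longrightarrow>
    dJ (\<lambda>x. \<alpha> * z x + \<beta> * v x) v < 0 \<and> 0 < N (\<lambda>x. \<alpha> * z x + \<beta> * v x)"
proof -
  define u where "u p = (\<lambda>x. fst p * z x + snd p * v x)" for p :: "real \<times> real"
  have "continuous_on UNIV (\<lambda>p. dJ (u p) v)"
    unfolding u_def by (rule dJ_continuous[OF z v v])
  moreover have "continuous_on UNIV (\<lambda>p. N (u p))"
    unfolding u_def N_linear[OF z v] by (intro continuous_intros)
  ultimately have "open ({p. dJ (u p) v < 0} \<inter> {p. 0 < N (u p)})"
    by (intro open_Int open_Collect_less continuous_on_const)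
  moreover have "(1, 0) \<in> {p. dJ (u p) v < 0} \<inter> {p. 0 < N (u p)}"
    using neg N by (simp add: u_def)
  ultimately obtain r where "0 < r" and near: "\<And>\<alpha> \<beta>. \<bar>\<alpha> - 1\<bar> \<le> r \<Longrightarrow> \<bar>\<beta> - 0\<bar> \<le> r \<Longrightarrow>
      (\<alpha>, \<beta>) \<in> {p. dJ (u p) v < 0} \<inter> {p. 0 < N (u p)}"
    by (rule open_contains_rectangle) blast
  then show ?thesis using that[of r] by (auto simp: u_def)
qed

lemma nehari_minimizer_dJ_nonneg:
  assumes z: "z \<in> nehari H J" and min: "\<And>y. y \<in> nehari H J \<Longrightarrow> J z \<le> J y" and v: "v \<in> H"
  shows "0 \<le> dJ z v"
proof (rule ccontr)
  assume "\<not> 0 \<le> dJ z v"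
  then have neg: "dJ z v < 0" by simp
  note zH = nehari_H[OF z]
  let ?u = "\<lambda>\<alpha> \<beta> x. \<alpha> * z x + \<beta> * v x"
  obtain r where r: "0 < r" and near: "\<And>\<alpha> \<beta>. \<bar>\<alpha> - 1\<bar> \<le> r \<Longrightarrow> \<bar>\<beta>\<bar> \<le> r \<Longrightarrow>
      dJ (?u \<alpha> \<beta>) v < 0 \<and> 0 < N (?u \<alpha> \<beta>)"
    using dJ_neg_near[OF zH v neg nehari_N_pos[OF z]] by blast
  define \<eta> where "\<eta> = min (1/2) r"
  have \<eta>: "0 < \<eta>" "\<eta> < 1" "\<eta> \<le> r" using r by (auto simp: \<eta>_def)
  obtain \<alpha> \<beta> where \<alpha>: "1 - \<eta> \<le> \<alpha>" "\<alpha> \<le> 1 + \<eta>" and \<beta>: "0 < \<beta>" "\<beta> \<le> \<eta>"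
    and zero: "dJ (?u \<alpha> \<beta>) (?u \<alpha> \<beta>) = 0"
    by (rule dJ_self_zero_near_ray[OF z v \<eta>(1,2)])
  have segment: "dJ (?u \<alpha> b) v < 0 \<and> 0 < N (?u \<alpha> b)" if "0 \<le> b" "b \<le> \<beta>" for b
    using \<alpha> \<beta> \<eta> that by (intro near) auto
  then have "?u \<alpha> \<beta> \<in> nehari H J"
    unfolding nehari_eq using H_linear[OF zH v] \<beta>(1) zero by simp
  then have "J z \<le> J (?u \<alpha> \<beta>)" by (rule min)
  also have "\<dots> < J (\<lambda>x. \<alpha> * z x)"
    by (rule J_decreasing_on_segment[OF H_scale[OF zH] v \<beta>(1) segment])
  also have "\<dots> \<le> J z" using \<alpha> \<eta> by (intro nehari_J_ray_max z) linarith
  finally show False by simp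
qed

lemma nehari_minimizer_critical:
  assumes z: "z \<in> nehari H J" and min: "\<And>y. y \<in> nehari H J \<Longrightarrow> J z \<le> J y"
  shows "critical_point H J z"
proof -
  note zH = nehari_H[OF z]
  have "dJ z v = 0" if v: "v \<in> H" for v
  proof -
    have "dJ z (\<lambda>x. (- 1) * v x + 0 * v x) = - dJ z v" using dJ_linear[OF zH v v, of "-1" 0] by simp
    moreover have "0 \<le> dJ z (\<lambda>x. (- 1) * v x + 0 * v x)"
      by (rule nehari_minimizer_dJ_nonneg[OF z min H_linear[OF v v]])
    ultimately show ?thesis using nehari_minimizer_dJ_nonneg[OF z min v] by linarith
  qed
  then have "J_dir_deriv J z v 0" if "v \<in> H" for v
    using J_deriv_at_0[OF zH that nehari_N_pos[OF z]] that by (simp add: J_dir_deriv_def)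
  then show ?thesis using zH by (simp add: critical_point_def)
qed

theorem ground_state_exists:
  assumes "open B" "B \<noteq> {}"
  shows "\<exists>u. ground_state H J u \<and> (AE x in lborel. 0 \<le> u x)"
proof -
  obtain z where z: "z \<in> nehari H J" "\<And>x. 0 \<le> z x" "J z = Inf (J ` nehari H J)"
    using nehari_minimizer[OF nehari_nonempty[OF assms]] by blast
  have "J z \<le> J y" if "y \<in> nehari H J" for y
    unfolding z(3) using that by (intro cInf_lower nehari_bdd_below) auto
  then have "critical_point H J z" by (rule nehari_minimizer_critical[OF z(1)])
  moreover have "nontrivial z" using z(1) by (simp add: nehari_def)
  ultimately show ?thesis using z(2,3) by (auto simp: ground_state_def)
qed

lemma J_eps_eq_J:
  assumes "B = {x. \<epsilon> *\<^sub>R x \<in> \<Omega>}"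
  shows "J_eps M s V \<epsilon> (G_pen \<Omega> f V0 K a) = J"
proof -
  have "g_pen \<Omega> f V0 K a (\<epsilon> *\<^sub>R x) = (if x \<in> B then f else ft)" for x by (auto simp: g_pen_def assms)
  then have "G_pen \<Omega> f V0 K a (\<epsilon> *\<^sub>R x) t = G x t" for x t
    by (simp add: G_pen_def G_def primitive_def)
  then show ?thesis by (intro ext) (simp add: J_eps_def J_def \<Psi>_def)
qed

end

lemma
  fixes \<Omega> :: "'a::euclidean_space set"
  assumes \<epsilon>: "0 < \<epsilon>"
  shows open_scaled_domain: "open \<Omega> \<Longrightarrow> open {x. \<epsilon> *\<^sub>R x \<in> \<Omega>}"
    and scaled_domain_nonempty: "\<Omega> \<noteq> {} \<Longrightarrow> {x. \<epsilon> *\<^sub>R x \<in> \<Omega>} \<noteq> {}"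
    and bounded_scaled_domain: "bounded \<Omega> \<Longrightarrow> bounded {x. \<epsilon> *\<^sub>R x \<in> \<Omega>}"
proof -
  have image: "{x. \<epsilon> *\<^sub>R x \<in> \<Omega>} = (\<lambda>x. (1 / \<epsilon>) *\<^sub>R x) ` \<Omega>"
    using \<epsilon> by (auto intro!: image_eqI[where x = "\<epsilon> *\<^sub>R x" for x])
  show "open \<Omega> \<Longrightarrow> open {x. \<epsilon> *\<^sub>R x \<in> \<Omega>}" unfolding image using \<epsilon> by (intro open_scaling) auto
  show "\<Omega> \<noteq> {} \<Longrightarrow> {x. \<epsilon> *\<^sub>R x \<in> \<Omega>} \<noteq> {}" unfolding image by simp
  show "bounded \<Omega> \<Longrightarrow> bounded {x. \<epsilon> *\<^sub>R x \<in> \<Omega>}" unfolding image by (rule bounded_scaling)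
qed

theorem theorem3p1:
  fixes s m0 V0 K a :: real and M f :: "real \<Rightarrow> real" and V :: "R3 \<Rightarrow> real"
    and \<Omega> :: "R3 set"
  assumes s: "3/4 < s" "s < 1"
    and M_cont: "continuous_on {0..} M"
    and M1: "m0 > 0" "\<forall>t\<ge>0. M t \<ge> m0"
    and M2: "mono_on {0..} M"
    and M3: "\<forall>t1 t2. t1 \<ge> t2 \<and> t2 > 0 \<longrightarrow> M t1 / t1 - M t2 / t2 \<le> m0 * (1/t1 - 1/t2)"
    and V_cont: "continuous_on UNIV V"
    and V_bdd: "bdd_below (range V)"
    and V0_def: "V0 = Inf (range V)"
    and V0_pos: "V0 > 0"
    and f_cont: "continuous_on UNIV f"
    and f_neg: "\<forall>t<0. f t = 0"
    and f1: "((\<lambda>t. f t / t ^ 3) \<longlongrightarrow> 0) (at_right 0)"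
    and f2: "\<exists>q. 4 < q \<and> q < 6 / (3 - 2 * s) \<and> ((\<lambda>t. f t / t powr (q - 1)) \<longlongrightarrow> 0) at_top"
    and f3: "\<exists>\<theta>. 4 < \<theta> \<and> \<theta> < 6 / (3 - 2 * s) \<and>
               (\<forall>t>0. 0 < \<theta> * primitive f t \<and> \<theta> * primitive f t \<le> f t * t)"
    and f4: "mono_on {0<..} (\<lambda>t. f t / t ^ 3)"
    and \<Omega>_dom: "lipschitz_domain \<Omega>" "bounded \<Omega>"
    and \<Omega>_bdry: "\<forall>x\<in>frontier \<Omega>. V0 < V x"
    and \<Omega>_min: "{x \<in> \<Omega>. V x = V0} \<noteq> {}"
    and K: "K > 2 / m0"
    and a: "a > 0" "f a = V0 / K * a"
  shows "\<forall>\<epsilon>>0. \<exists>u. ground_state (H_eps s V \<epsilon>)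
                      (J_eps M s V \<epsilon> (G_pen \<Omega> f V0 K a)) u
                 \<and> (AE x in lborel. u x \<ge> 0)"
proof (intro allI impI)
  fix \<epsilon> :: real assume \<epsilon>: "\<epsilon> > 0"
  obtain q where q: "4 < q" "q < 6 / (3 - 2 * s)" "((\<lambda>t. f t / t powr (q - 1)) \<longlongrightarrow> 0) at_top"
    using f2 by blast
  obtain \<theta> where \<theta>: "4 < \<theta>" "\<And>t. t > 0 \<Longrightarrow> 0 < \<theta> * primitive f t"
      "\<And>t. t > 0 \<Longrightarrow> \<theta> * primitive f t \<le> f t * t"
    using f3 by blast
  define B where "B = {x. \<epsilon> *\<^sub>R x \<in> \<Omega>}"
  have B: "open B" "B \<noteq> {}" "bounded B"
    using \<Omega>_dom open_scaled_domain[OF \<epsilon>] scaled_domain_nonempty[OF \<epsilon>] bounded_scaled_domain[OF \<epsilon>]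
    by (auto simp: B_def lipschitz_domain_def)
  have "0 < 2 / m0" using M1(1) by simp
  then have K_pos: "0 < K" using K by linarith
  interpret kirchhoff_problem s V \<epsilon> V0 f q \<theta> K a M m0 B
  proof
    show "V0 \<le> V x" for x unfolding V0_def by (rule cInf_lower[OF _ V_bdd]) simp
    show "B \<in> sets borel" using B(1) by simp
    show "emeasure lborel B < \<infinity>" using B(3) by (rule emeasure_bounded_finite)
    show "q < critical_exponent 3 s" using q(2) by (simp add: critical_exponent_def)
  qed (use assms q(1,3) \<theta> K_pos in auto)
  show "\<exists>u. ground_state (H_eps s V \<epsilon>) (J_eps M s V \<epsilon> (G_pen \<Omega> f V0 K a)) u
      \<and> (AE x in lborel. u x \<ge> 0)"
    using ground_state_exists[OF B(1,2)] by (simp add: J_eps_eq_J[OF B_def])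
qed

end
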